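(* Let $a,b>0$ and $2<p\le 6$. For sufficiently small $c>0$ let $u_c^{+}$ and $u_c^-$ denote the following solutions of $$-\Big(a+b\int_{\mathbb{R}^3}|\nabla u|^2\,dx\Big)\Delta u=\lambda u+|u|^{p-2}u+u\log u^2\ \text{ in }\mathbb{R}^3,\qquad \int_{\mathbb{R}^3}u^2\,dx=c^2$$ (for some $\lambda\in\mathbb{R}$), each bounded, positive and radially symmetric: if $2<p\le\frac{14}{3}$, $u_c^+:=u_c\in S(c)$ is a ground state solution with $I(u_c)=m(c)$; if $\frac{14}{3}<p\le6$, $u_c^+\in\Lambda_c^+$ is a ground state solution with $I(u_c^+)=m_c^+$; if $\frac{14}{3}<p<6$, or if $p=6$ and $\frac{4a^2}{b^3\mathcal S^3}+\frac{3a}{b}+\frac{3b\mathcal S^3}{4}\ge\widetilde R^2$, $u_c^-\in\Lambda_c^-$ is a solution with $I(u_c^-)=m_c^-$. Then: (i) For all $2<p\le6$, the ground state solution satisfies $\|\nabla u_c^+\|_2^2\to0$ as $c\to0^+$; moreover $m(c)\to0$ as $c\to 0^+$ if $2<p\le\frac{14}{3}$, and $m_c^+\to0$ as $c\to0^+$ if $\frac{14}{3}<p\le6$. (ii) For $\frac{14}{3}<p<6$, the second solution satisfies $\|\nabla u_c^-\|_2^2\to+\infty$ as $c\to0^+$. (iii) For $p=6$ (under the condition $\frac{4a^2}{b^3\mathcal S^3}+\frac{3a}{b}+\frac{3b\mathcal S^3}{4}\ge\widetilde R^2$), the second solution satisfies $\|\nabla u_c^-\|_2^2\to\frac{\mathcal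 S}{2}\Big(b\mathcal S^2+\sqrt{b^2\mathcal S^4+4a\mathcal S}\Big)$ and $I(u_c^-)\to C(a,b,\mathcal S)$ as $c\to0^+$, where $$C(a,b,\mathcal S)=\frac{ab\mathcal S^3}{4}+\frac{b^3\mathcal S^6}{24}+\frac{(b^2\mathcal S^4+4a\mathcal S)^{3/2}}{24}.$$
   Context: $\|\cdot\|_r$ is the $L^r(\mathbb{R}^3)$ norm. $W:=\{u\in H^1(\mathbb{R}^3):\int_{\mathbb{R}^3}u^2|\log u^2|\,dx<\infty\}$, with norm $\|u\|_W=\|u\|_{H^1}+\|u\|_V$, where $\|u\|_V=\inf\{k>0:\int_{\mathbb{R}^3}A(|u|/k)\,dx\le 1\}$, $A(s)=-s^2\log s^2$ for $0\le s<e^{-3}$ and $A(s)=3s^2+4e^{-3}s-e^{-6}$ for $s\ge e^{-3}$. $S(c):=\{u\in W:\|u\|_2=c\}$ and $$I(u)=\frac a2\|\nabla u\|_2^2+\frac b4\|\nabla u\|_2^4-\frac1p\|u\|_p^p+\frac12c^2-\frac12\int_{\mathbb{R}^3}u^2\log u^2\,dx ,\qquad m(c):=\inf_{S(c)}I.$$ $\gamma_p=\frac{3(p-2)}{2p}$. For $s\in\mathbb{R}$, $(s*u)(x)=e^{3s/2}u(e^sx)$ and $\Phi_u(s):=I(s*u)$. $\Lambda_c:=\{u\in S(c):\Phi_u'(0)=0\}$, where $\Phi_u'(0)=a\|\nabla u\|_2^2+b\|\nabla u\|_2^4-\gamma_p\|u\|_p^p-\frac32c^2$; $\Lambda_c^{+}$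 (resp. $\Lambda_c^-$) is the set of $u\in\Lambda_c$ with $\Phi_u''(0)>0$ (resp. $<0$); $m_c^\pm:=\inf_{\Lambda_c^\pm}I$. A function $u_0\in S(c)$ is a ground state solution if $dI|_{S(c)}(u_0)=0$ and $I(u_0)=\inf\{I(u): u\in S(c),\ dI|_{S(c)}(u)=0\}$. $\mathcal S>0$ is the optimal constant in $\mathcal S\|u\|_6^2\le\|\nabla u\|_2^2$, $u\in H^1(\mathbb{R}^3)$, and $\widetilde R:=\Big(\frac{b+\sqrt{b^2+3a\mathcal S^{-3}}}{3\mathcal S^{-3}}\Big)^{1/2}$. Such solutions $u_c^\pm$ exist for all sufficiently small $c>0$. *)

theory Defs
  imports "HOL-Analysis.Analysis"
begin

type_synonym fn3 = "real^3 \<Rightarrow> real"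

text \<open>
  Elements of Lebesgue and Sobolev spaces are represented by Borel measurable functions on
  \<open>real^3\<close>; every Lebesgue class has such a representative. All notions below are invariant under
  changing a representative on a null set, so pointwise properties of solutions (boundedness,
  positivity, radial symmetry) are required almost everywhere.
  Note that \<open>ln 0 = 0\<close> and \<open>0 powr r = 0\<close>, which give the usual convention
  \<open>0 * ln 0 = 0\<close> in the logarithmic terms.
\<close>

section \<open>Sobolev space\<close>

definition partial_deriv :: "3 \<Rightarrow> fn3 \<Rightarrow> fn3" where
  "partial_deriv i f x = frechet_derivative f (at x) (axis i 1)"

definition grad :: "fn3 \<Rightarrow> real^3 \<Rightarrow> real^3" where
  "grad f x = (\<chi> i. partial_deriv i f x)"

text \<open>Differentiability of every iterated partial derivative makes all of them continuous, so this is
  exactly the class of infinitely differentiable functions.\<close>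

definition smooth :: "fn3 \<Rightarrow> bool" where
  "smooth f \<longleftrightarrow> (\<forall>js x. foldr partial_deriv js f differentiable (at x))"

definition test_fun :: "fn3 \<Rightarrow> bool" where
  "test_fun \<phi> \<longleftrightarrow> smooth \<phi> \<and> compact (closure {x. \<phi> x \<noteq> 0})"

definition locally_integrable :: "(real^3 \<Rightarrow> 'b::{banach, second_countable_topology}) \<Rightarrow> bool" where
  "locally_integrable f \<longleftrightarrow>
     f \<in> borel_measurable lborel \<and> (\<forall>K. compact K \<longrightarrow> set_integrable lborel K f)"

definition in_L :: "real \<Rightarrow> fn3 \<Rightarrow> bool" where
  "in_L r f \<longleftrightarrow> f \<in> borel_measurable lborel \<and> integrable lborel (\<lambda>x. \<bar>f x\<bar> powr r)"

definition L_norm :: "real \<Rightarrow> fn3 \<Rightarrow> real" where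
  "L_norm r f = (LINT x|lborel. \<bar>f x\<bar> powr r) powr (1 / r)"

definition weak_gradient :: "fn3 \<Rightarrow> (real^3 \<Rightarrow> real^3) \<Rightarrow> bool" where
  "weak_gradient u G \<longleftrightarrow> locally_integrable u \<and> locally_integrable G \<and>
     (\<forall>\<phi> i. test_fun \<phi> \<longrightarrow>
        (LINT x|lborel. u x * partial_deriv i \<phi> x) = - (LINT x|lborel. G x $ i * \<phi> x))"

text \<open>The choice is harmless: weak gradients are unique up to null sets.\<close>

definition wgrad :: "fn3 \<Rightarrow> real^3 \<Rightarrow> real^3" where
  "wgrad u = (SOME G. weak_gradient u G)"

definition H1 :: "fn3 set" where
  "H1 = {u. in_L 2 u \<and> (\<exists>G. weak_gradient u G \<and> in_L 2 (\<lambda>x. norm (G x)))}"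

definition grad_norm :: "fn3 \<Rightarrow> real" where
  "grad_norm u = L_norm 2 (\<lambda>x. norm (wgrad u x))"

definition H1_norm :: "fn3 \<Rightarrow> real" where
  "H1_norm u = sqrt ((grad_norm u)\<^sup>2 + (L_norm 2 u)\<^sup>2)"

text \<open>The optimal, i.e. largest, constant in \<open>S * (L_norm 6 u)\<^sup>2 \<le> (grad_norm u)\<^sup>2\<close> on \<open>H1\<close>.
  Membership in \<open>L\<^sup>6\<close> is demanded because a divergent Bochner integral is \<open>0\<close>.\<close>

definition sobolev_const :: real where
  "sobolev_const =
     Sup {s. \<forall>u\<in>H1. in_L 6 u \<and> s * (L_norm 6 u)\<^sup>2 \<le> (grad_norm u)\<^sup>2}"

section \<open>The space \<open>W\<close> and the energy functional\<close>

definition W :: "fn3 set" where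
  "W = {u \<in> H1. integrable lborel (\<lambda>x. (u x)\<^sup>2 * \<bar>ln ((u x)\<^sup>2)\<bar>)}"

definition orlicz_A :: "real \<Rightarrow> real" where
  "orlicz_A s = (if s < exp (-3) then - (s\<^sup>2) * ln (s\<^sup>2)
                 else 3 * s\<^sup>2 + 4 * exp (-3) * s - exp (-6))"

definition V_norm :: "fn3 \<Rightarrow> real" where
  "V_norm u = Inf {k. k > 0 \<and> integrable lborel (\<lambda>x. orlicz_A (\<bar>u x\<bar> / k)) \<and>
                     (LINT x|lborel. orlicz_A (\<bar>u x\<bar> / k)) \<le> 1}"

definition W_norm :: "fn3 \<Rightarrow> real" where
  "W_norm u = H1_norm u + V_norm u"

definition S :: "real \<Rightarrow> fn3 set" where
  "S c = {u \<in> W. L_norm 2 u = c}"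

definition energy :: "real \<Rightarrow> real \<Rightarrow> real \<Rightarrow> real \<Rightarrow> fn3 \<Rightarrow> real" where
  "energy a b p c u =
     a / 2 * (grad_norm u)\<^sup>2 + b / 4 * (grad_norm u) ^ 4 - 1 / p * L_norm p u powr p
     + 1 / 2 * c\<^sup>2 - 1 / 2 * (LINT x|lborel. (u x)\<^sup>2 * ln ((u x)\<^sup>2))"

text \<open>\<open>L\<close> is the Frechet derivative of \<open>J\<close> at \<open>u\<close> in the normed space \<open>(W, W_norm)\<close>.\<close>

definition W_derivative :: "(fn3 \<Rightarrow> real) \<Rightarrow> fn3 \<Rightarrow> (fn3 \<Rightarrow> real) \<Rightarrow> bool" where
  "W_derivative J u L \<longleftrightarrow>
     (\<forall>v\<in>W. \<forall>w\<in>W. \<forall>r t. L (\<lambda>x. r * v x + t * w x) = r * L v + t * L w) \<and>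
     (\<exists>K. \<forall>v\<in>W. \<bar>L v\<bar> \<le> K * W_norm v) \<and>
     (\<forall>\<epsilon>>0. \<exists>\<delta>>0. \<forall>v\<in>W. W_norm v < \<delta> \<longrightarrow>
        \<bar>J (\<lambda>x. u x + v x) - J u - L v\<bar> \<le> \<epsilon> * W_norm v)"

text \<open>The differential of \<open>J\<close> restricted to \<open>S c\<close> is zero at \<open>u\<close>: the derivative on \<open>W\<close> vanishes on the tangent space of \<open>S c\<close> at \<open>u\<close>.\<close>

definition constrained_critical :: "(fn3 \<Rightarrow> real) \<Rightarrow> real \<Rightarrow> fn3 \<Rightarrow> bool" where
  "constrained_critical J c u \<longleftrightarrow> u \<in> S c \<and>
     (\<exists>L. W_derivative J u L \<and> (\<forall>v\<in>W. (LINT x|lborel. u x * v x) = 0 \<longrightarrow> L v = 0))"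

definition ground_state :: "real \<Rightarrow> real \<Rightarrow> real \<Rightarrow> real \<Rightarrow> fn3 \<Rightarrow> bool" where
  "ground_state a b p c u \<longleftrightarrow>
     constrained_critical (energy a b p c) c u \<and>
     ereal (energy a b p c u) =
       (INF v\<in>{v \<in> S c. constrained_critical (energy a b p c) c v}. ereal (energy a b p c v))"

text \<open>Infima are taken in the extended reals, so that they make sense without any a priori
  knowledge of boundedness from below or nonemptiness.\<close>

definition m :: "real \<Rightarrow> real \<Rightarrow> real \<Rightarrow> real \<Rightarrow> ereal" where
  "m a b p c = (INF u\<in>S c. ereal (energy a b p c u))"

definition dilate :: "real \<Rightarrow> fn3 \<Rightarrow> fn3" where
  "dilate s u x = exp (3 * s / 2) * u (exp s *\<^sub>R x)"

definition fiber :: "real \<Rightarrow> real \<Rightarrow> real \<Rightarrow> real \<Rightarrow> fn3 \<Rightarrow> real \<Rightarrow> real" where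
  "fiber a b p c u s = energy a b p c (dilate s u)"

definition Lambda :: "real \<Rightarrow> real \<Rightarrow> real \<Rightarrow> real \<Rightarrow> fn3 set" where
  "Lambda a b p c = {u \<in> S c. (fiber a b p c u has_real_derivative 0) (at 0)}"

definition Lambda_plus :: "real \<Rightarrow> real \<Rightarrow> real \<Rightarrow> real \<Rightarrow> fn3 set" where
  "Lambda_plus a b p c = {u \<in> Lambda a b p c. deriv (deriv (fiber a b p c u)) 0 > 0}"

definition Lambda_minus :: "real \<Rightarrow> real \<Rightarrow> real \<Rightarrow> real \<Rightarrow> fn3 set" where
  "Lambda_minus a b p c = {u \<in> Lambda a b p c. deriv (deriv (fiber a b p c u)) 0 < 0}"

definition m_plus :: "real \<Rightarrow> real \<Rightarrow> real \<Rightarrow> real \<Rightarrow> ereal" where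
  "m_plus a b p c = (INF u\<in>Lambda_plus a b p c. ereal (energy a b p c u))"

definition m_minus :: "real \<Rightarrow> real \<Rightarrow> real \<Rightarrow> real \<Rightarrow> ereal" where
  "m_minus a b p c = (INF u\<in>Lambda_minus a b p c. ereal (energy a b p c u))"

section \<open>The solutions\<close>

text \<open>Weak solutions of \<open>-(a + b \<integral>|\<nabla>u|\<^sup>2) \<Delta>u = \<lambda>u + |u|\<^sup>p\<^sup>-\<^sup>2 u + u log u\<^sup>2\<close> with mass \<open>c\<^sup>2\<close>.\<close>

definition solution :: "real \<Rightarrow> real \<Rightarrow> real \<Rightarrow> real \<Rightarrow> fn3 \<Rightarrow> bool" where
  "solution a b p c u \<longleftrightarrow> u \<in> S c \<and>
     (\<exists>\<mu>. \<forall>\<phi>. test_fun \<phi> \<longrightarrow>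
        (a + b * (grad_norm u)\<^sup>2) * (LINT x|lborel. wgrad u x \<bullet> grad \<phi> x) =
        (LINT x|lborel. (\<mu> * u x + \<bar>u x\<bar> powr (p - 2) * u x + u x * ln ((u x)\<^sup>2)) * \<phi> x))"

definition bounded_positive_radial :: "fn3 \<Rightarrow> bool" where
  "bounded_positive_radial u \<longleftrightarrow>
     (\<exists>M. AE x in lborel. \<bar>u x\<bar> \<le> M) \<and>
     (AE x in lborel. u x > 0) \<and>
     (\<exists>f. AE x in lborel. u x = f (norm x))"

definition is_u_plus :: "real \<Rightarrow> real \<Rightarrow> real \<Rightarrow> real \<Rightarrow> fn3 \<Rightarrow> bool" where
  "is_u_plus a b p c u \<longleftrightarrow>
     solution a b p c u \<and> bounded_positive_radial u \<and> ground_state a b p c u \<and>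
     (if p \<le> 14 / 3 then ereal (energy a b p c u) = m a b p c
      else u \<in> Lambda_plus a b p c \<and> ereal (energy a b p c u) = m_plus a b p c)"

definition is_u_minus :: "real \<Rightarrow> real \<Rightarrow> real \<Rightarrow> real \<Rightarrow> fn3 \<Rightarrow> bool" where
  "is_u_minus a b p c u \<longleftrightarrow>
     solution a b p c u \<and> bounded_positive_radial u \<and>
     u \<in> Lambda_minus a b p c \<and> ereal (energy a b p c u) = m_minus a b p c"

definition R_tilde :: "real \<Rightarrow> real \<Rightarrow> real \<Rightarrow> real" where
  "R_tilde a b s = sqrt ((b + sqrt (b\<^sup>2 + 3 * a * (1 / s ^ 3))) / (3 * (1 / s ^ 3)))"

definition critical_condition :: "real \<Rightarrow> real \<Rightarrow> real \<Rightarrow> bool" where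
  "critical_condition a b s \<longleftrightarrow>
     4 * a\<^sup>2 / (b ^ 3 * s ^ 3) + 3 * a / b + 3 * b * s ^ 3 / 4 \<ge> (R_tilde a b s)\<^sup>2"

definition C_limit :: "real \<Rightarrow> real \<Rightarrow> real \<Rightarrow> real" where
  "C_limit a b s = a * b * s ^ 3 / 4 + b ^ 3 * s ^ 6 / 24
     + (b\<^sup>2 * s ^ 4 + 4 * a * s) powr (3 / 2) / 24"

end

theory Submission
  imports Defs "HOL-Real_Asymp.Real_Asymp"
begin

text \<open>For a function \<open>u\<close> of mass \<open>c\<^sup>2\<close> write \<open>A = \<parallel>\<nabla>u\<parallel>\<^sub>2\<^sup>2\<close>, \<open>B = \<parallel>u\<parallel>\<^sub>p\<^sup>p\<close> and \<open>q = p \<gamma>\<^sub>p = 3(p - 2)/2\<close>. The fibre map is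
  \<open>\<Phi>(s) = (a/2) e\<^sup>2\<^sup>s A + (b/4) e\<^sup>4\<^sup>s A\<^sup>2 - (1/p) e\<^sup>q\<^sup>s B - (3/2) s c\<^sup>2 + const\<close> (\<open>fiber_eq\<close>), so \<open>\<Lambda>\<close> and \<open>\<Lambda>\<^sup>\<plusminus>\<close> are
  described by algebraic relations between \<open>A\<close>, \<open>B\<close> and \<open>c\<close> (\<open>Lambda_iff\<close>). The limits follow from these
  relations, from the extremality of the energies, and from two consequences of the Sobolev
  inequality: \<open>B \<le> K A\<^sup>q\<^sup>/\<^sup>2 c\<^sup>(\<^sup>6\<^sup>-\<^sup>p\<^sup>)\<^sup>/\<^sup>2\<close> (\<open>gagliardo_nirenberg\<close>) and \<open>\<integral>u\<^sup>2 ln u\<^sup>2 \<le> K A\<^sup>3\<^sup>/\<^sup>4 c\<^sup>3\<^sup>/\<^sup>2\<close>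
  (\<open>log_int_upper\<close>).

  If \<open>p \<le> 14/3\<close> then \<open>q/2 \<le> 2\<close>, so for small \<open>c\<close> the term \<open>(b/4) A\<^sup>2\<close> dominates and \<open>I(u) \<ge> (a/2) A - o(1)\<close> on \<open>S c\<close>, whereas
  multiples of a fixed function show \<open>m(c) \<le> o(1)\<close>; both claims of (i) follow (\<open>subcritical\<close>). If
  \<open>p > 14/3\<close> then \<open>q > 4\<close>, and eliminating \<open>B\<close> gives \<open>A \<le> K c\<^sup>2\<close> on \<open>\<Lambda>\<^sup>+\<close> (\<open>Lambda_plus_bound\<close>); the energy is
  bounded below by \<open>-o(1)\<close> there, and a dilated multiple of a fixed function gives the upper bound for
  \<open>m\<^sub>c\<^sup>+\<close> (\<open>supercritical_plus\<close>). On \<open>\<Lambda>\<^sup>-\<close> the inequality \<open>\<Phi>''(0) < 0\<close> gives \<open>4b A\<^sup>2 < (q\<^sup>2/p) B\<close>, and for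
  \<open>14/3 < p < 6\<close> the interpolation inequality makes \<open>A\<close> tend to infinity (\<open>supercritical_minus\<close>). For
  \<open>p = 6\<close> the relations force \<open>A\<close> to be asymptotically at least the positive root \<open>R\<close> of
  \<open>a + b R = R\<^sup>2/\<sigma>\<^sup>3\<close>, where \<open>\<sigma>\<close> is the Sobolev constant, and the energy equals
  \<open>(a/3) A + (b/12) A\<^sup>2\<close> up to controlled errors. Rescaled almost optimal functions for the Sobolev
  inequality show that the energy is asymptotically at most the value of this expression at \<open>R\<close>, which is
  \<open>C(a, b, \<sigma>)\<close>, so \<open>A \<rightarrow> R\<close> (\<open>critical_minus\<close>).

  The Sobolev inequality on \<open>H1\<close> is proved without mollification. An integrable function with integrable
  weak derivatives is, on almost every line parallel to an axis, the primitive of its derivative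
  (\<open>weak_partial_prim\<close>). A chain rule inequality on lines bounds a bounded version of \<open>u\<^sup>4\<close> by the
  line integrals of its derivative, and the Loomis-Whitney inequality combines the three directions
  (\<open>sobolev_integrable\<close>). Truncation carries the inequality over to \<open>H1\<close> (\<open>sobolev_H1\<close>) and supplies
  almost optimal functions in \<open>W\<close> (\<open>sobolev_const\<close>). Uniqueness of weak gradients, which underlies
  the scaling laws, is the fundamental lemma tested with smooth approximations of indicators of boxes.\<close>

section \<open>Smooth functions of one variable\<close>

text \<open>\<open>ktimes k f\<close>: the function \<open>f\<close> is \<open>k\<close> times differentiable on the line.\<close>

primrec ktimes :: "nat \<Rightarrow> (real \<Rightarrow> real) \<Rightarrow> bool" where
  "ktimes 0 f = True"
| "ktimes (Suc k) f = (\<exists>f'. (\<forall>x. (f has_real_derivative f' x) (at x)) \<and> ktimes k f')"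

text \<open>Infinitely differentiable functions on the line.\<close>

definition smooth1 :: "(real \<Rightarrow> real) \<Rightarrow> bool" where
  "smooth1 f \<longleftrightarrow> (\<forall>k. ktimes k f)"

lemma ktimes_Suc_imp: "ktimes (Suc k) f \<Longrightarrow> ktimes k f"
proof (induction k arbitrary: f)
  case (Suc k)
  then obtain f' where "\<forall>x. (f has_real_derivative f' x) (at x)" "ktimes (Suc k) f'" by (metis ktimes.simps(2))
  with Suc.IH show ?case by auto
qed simp

lemma ktimes_add: "ktimes k f \<Longrightarrow> ktimes k g \<Longrightarrow> ktimes k (\<lambda>x. f x + g x)"
proof (induction k arbitrary: f g)
  case (Suc k)
  then obtain f' g' where *: "\<forall>x. (f has_real_derivative f' x) (at x)" "ktimes k f'"
     "\<forall>x. (g has_real_derivative g' x) (at x)" "ktimes k g'" by auto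
  then have "\<forall>x. ((\<lambda>x. f x + g x) has_real_derivative f' x + g' x) (at x)"
    by (auto intro!: derivative_intros)
  with Suc.IH[OF *(2,4)] show ?case by auto
qed simp

lemma ktimes_mult: "ktimes k f \<Longrightarrow> ktimes k g \<Longrightarrow> ktimes k (\<lambda>x. f x * g x)"
proof (induction k arbitrary: f g)
  case (Suc k)
  then obtain f' g' where *: "\<forall>x. (f has_real_derivative f' x) (at x)" "ktimes k f'"
     "\<forall>x. (g has_real_derivative g' x) (at x)" "ktimes k g'" by auto
  then have d: "\<forall>x. ((\<lambda>x. f x * g x) has_real_derivative f' x * g x + g' x * f x) (at x)"
    by (auto intro!: DERIV_mult)
  have "ktimes k f" "ktimes k g" using Suc.prems by (auto intro: ktimes_Suc_imp simp del: ktimes.simps)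
  then have "ktimes k (\<lambda>x. f' x * g x + g' x * f x)"
    using * by (intro ktimes_add Suc.IH)
  with d show ?case by auto
qed simp

lemma ktimes_const: "ktimes k (\<lambda>x. c)"
proof (induction k arbitrary: c)
  case (Suc k)
  have "\<forall>x. ((\<lambda>x. c) has_real_derivative 0) (at x)" by simp
  with Suc[of 0] show ?case unfolding ktimes.simps by (intro exI[of _ "\<lambda>_. 0"] conjI)
qed simp

lemma ktimes_affine: "ktimes k f \<Longrightarrow> ktimes k (\<lambda>x. f (r * x + t))"
proof (induction k arbitrary: f)
  case (Suc k)
  then obtain f' where *: "\<forall>x. (f has_real_derivative f' x) (at x)" "ktimes k f'" by auto
  have "\<forall>x. ((\<lambda>x. f (r * x + t)) has_real_derivative f' (r * x + t) * r) (at x)"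
    by (auto intro!: DERIV_chain2[where g="\<lambda>x. r*x+t"] * [rule_format] derivative_eq_intros)
  moreover have "ktimes k (\<lambda>x. f' (r * x + t) * r)"
    by (intro ktimes_mult ktimes_const Suc.IH *)
  ultimately show ?case by auto
qed simp

lemma smooth1_mult: "smooth1 f \<Longrightarrow> smooth1 g \<Longrightarrow> smooth1 (\<lambda>x. f x * g x)"
  and smooth1_const: "smooth1 (\<lambda>x. c)"
  and smooth1_affine: "smooth1 f \<Longrightarrow> smooth1 (\<lambda>x. f (r * x + t))"
  by (auto simp: smooth1_def intro: ktimes_mult ktimes_const ktimes_affine)

lemma smooth1_deriv:
  assumes "smooth1 f"
  shows smooth1_DERIV: "(f has_real_derivative deriv f x) (at x)" and "smooth1 (deriv f)"
proof -
  have *: "\<exists>f'. (\<forall>x. (f has_real_derivative f' x) (at x)) \<and> ktimes k f'" for k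
    using assms[unfolded smooth1_def, rule_format, of "Suc k"] by simp
  show "(f has_real_derivative deriv f x) (at x)"
    using *[of 0] by (metis DERIV_imp_deriv)
  have "ktimes k (deriv f)" for k
  proof -
    obtain f' where f': "\<forall>x. (f has_real_derivative f' x) (at x)" "ktimes k f'" using * by blast
    then have "deriv f = f'" by (auto intro!: ext DERIV_imp_deriv)
    with f' show ?thesis by simp
  qed
  then show "smooth1 (deriv f)" by (simp add: smooth1_def)
qed

lemma smooth1_I:
  assumes "\<And>x. (f has_real_derivative f' x) (at x)" "smooth1 f'"
  shows "smooth1 f"
  unfolding smooth1_def
proof
  fix k show "ktimes k f"
    using assms by (cases k) (auto simp: smooth1_def)
qed

lemma smooth1_continuous: "smooth1 f \<Longrightarrow> continuous_on A f"
  using smooth1_DERIV by (meson DERIV_isCont continuous_at_imp_continuous_on)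

lemma smooth1_measurable[measurable_dest]: "smooth1 f \<Longrightarrow> f \<in> borel_measurable borel"
  by (intro borel_measurable_continuous_onI smooth1_continuous)

text \<open>The family \<open>t\<^sup>-\<^sup>j e\<^sup>-\<^sup>1\<^sup>/\<^sup>t\<close>, extended by \<open>0\<close> to \<open>t \<le> 0\<close>. It is closed under differentiation up to linear
  combinations, so all its members are smooth.\<close>

definition flat :: "nat \<Rightarrow> real \<Rightarrow> real" where
  "flat j t = (if t > 0 then (1 / t) ^ j * exp (- (1 / t)) else 0)"

lemma flat_DERIV: "(flat j has_real_derivative flat (j + 2) t - real j * flat (j + 1) t) (at t)"
proof -
  consider "t > 0" | "t < 0" | "t = 0" by linarith
  then show ?thesis
  proof cases
    case 1
    have "((\<lambda>t. (1 / t) ^ j * exp (- (1 / t))) has_real_derivative flat (j + 2) t - real j * flat (j + 1) t) (at t)"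
    proof -
      have u: "((\<lambda>t. 1 / t) has_real_derivative - ((1 / t)\<^sup>2)) (at t)"
        using 1 by (auto intro!: derivative_eq_intros simp: power2_eq_square)
      have "((\<lambda>u. u ^ j * exp (- u)) has_real_derivative
          (real j * u ^ (j - 1) - u ^ j) * exp (- u)) (at u)" for u :: real
        by (auto intro!: derivative_eq_intros simp: algebra_simps)
      from DERIV_chain2[OF this u]
      show ?thesis using 1
        by (cases j) (simp_all add: flat_def power2_eq_square algebra_simps add_divide_distrib)
    qed
    then show ?thesis
      by (rule has_field_derivative_transform_within_open[where S="{0<..}"]) (use 1 in \<open>auto simp: flat_def\<close>)
  next
    case 2
    have "((\<lambda>t. 0) has_real_derivative flat (j + 2) t - real j * flat (j + 1) t) (at t)"
      using 2 by (auto simp: flat_def)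
    then show ?thesis
      by (rule has_field_derivative_transform_within_open[where S="{..<0}"]) (use 2 in \<open>auto simp: flat_def\<close>)
  next
    case 3
    have "((\<lambda>h. flat j h / h) \<longlongrightarrow> 0) (at_right 0)"
    proof (rule Lim_transform_eventually)
      show "((\<lambda>h. (inverse h) ^ (Suc j) / exp (inverse h)) \<longlongrightarrow> (0::real)) (at_right 0)"
        by (rule filterlim_compose[OF tendsto_power_div_exp_0 filterlim_inverse_at_top_right])
      show "\<forall>\<^sub>F x in at_right 0. inverse x ^ Suc j / exp (inverse x) = flat j x / x"
        by (auto simp: eventually_at_filter flat_def field_simps exp_minus)
    qed
    moreover have "((\<lambda>h. flat j h / h) \<longlongrightarrow> 0) (at_left 0)"
      by (rule Lim_transform_eventually[of "\<lambda>_. 0"]) (auto simp: eventually_at_filter flat_def)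
    ultimately have "((\<lambda>h. flat j h / h) \<longlongrightarrow> 0) (at 0)"
      by (simp add: filterlim_split_at)
    then show ?thesis using 3 by (simp add: DERIV_def flat_def)
  qed
qed

lemma smooth1_flat: "smooth1 (flat j)"
proof -
  have "ktimes k (flat j)" for k
  proof (induction k arbitrary: j)
    case (Suc k)
    have "ktimes k (\<lambda>t. flat (j + 2) t + (- real j) * flat (j + 1) t)"
      by (intro ktimes_add ktimes_mult ktimes_const Suc.IH)
    then have "ktimes k (\<lambda>t. flat (j + 2) t - real j * flat (j + 1) t)" by simp
    moreover have "\<forall>x. (flat j has_real_derivative flat (j + 2) x - real j * flat (j + 1) x) (at x)"
      using flat_DERIV by blast
    ultimately show ?case
      unfolding ktimes.simps by (intro exI[of _ "\<lambda>t. flat (j + 2) t - real j * flat (j + 1) t"] conjI)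
  qed simp
  then show ?thesis by (simp add: smooth1_def)
qed

text \<open>A smooth function supported on \<open>[a, b]\<close> with values in \<open>[0, 1]\<close>. As \<open>n\<close> grows it converges pointwise to
  the indicator of the open interval, which is all that the fundamental lemma needs; no plateau is
  required.\<close>

definition bump :: "nat \<Rightarrow> real \<Rightarrow> real \<Rightarrow> real \<Rightarrow> real" where
  "bump n a b t = flat 0 (real n * (t - a)) * flat 0 (real n * (b - t))"

lemma smooth1_bump: "smooth1 (bump n a b)"
proof -
  have eq: "bump n a b = (\<lambda>t. flat 0 (real n * t + (- real n * a)) * flat 0 ((- real n) * t + real n * b))"
    by (auto simp: bump_def algebra_simps fun_eq_iff)
  show ?thesis unfolding eq by (intro smooth1_mult smooth1_affine smooth1_flat)
qed

lemma flat0_bounds: "0 \<le> flat 0 t" "flat 0 t \<le> 1"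
  by (auto simp: flat_def)

lemma bump_bounds: "0 \<le> bump n a b t" "bump n a b t \<le> 1"
  using flat0_bounds by (auto simp: bump_def intro!: mult_le_one)

lemma bump_outside: "t \<notin> {a<..<b} \<Longrightarrow> bump n a b t = 0"
  by (auto simp: bump_def flat_def zero_less_mult_iff)

lemma integrable_bump: "integrable lborel (bump n a b)"
proof (rule Bochner_Integration.integrable_bound)
  show "integrable lborel (indicator {a..b} :: real \<Rightarrow> real)"
    by (intro integrable_real_indicator) (auto simp: emeasure_lborel_Icc_eq)
  show "bump n a b \<in> borel_measurable lborel" using smooth1_measurable[OF smooth1_bump] by simp
  show "AE t in lborel. norm (bump n a b t) \<le> norm (indicator {a..b} t :: real)"
    using bump_bounds bump_outside[of _ a b n] by (intro AE_I2) (auto split: split_indicator)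
qed

lemma bump_tendsto: "(\<lambda>n. bump n a b t) \<longlonglongrightarrow> indicator {a<..<b} t"
proof (cases "t \<in> {a<..<b}")
  case True
  have "((\<lambda>n. exp (- (1 / (t - a) * (1 / real n))) * exp (- (1 / (b - t) * (1 / real n)))) \<longlongrightarrow> exp (- (1/(t-a) * 0)) * exp (-(1/(b-t) * 0))) sequentially"
    by (intro tendsto_intros lim_1_over_n)
  then have "((\<lambda>n. exp (- (1 / (t - a) * (1 / real n))) * exp (- (1 / (b - t) * (1 / real n)))) \<longlongrightarrow> indicator {a<..<b} t) sequentially"
    using True by simp
  then show ?thesis
    by (rule Lim_transform_eventually)
      (use True in \<open>auto intro!: eventually_sequentiallyI[of 1] simp: bump_def flat_def field_simps\<close>)
qed (simp add: bump_outside)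

section \<open>Smooth functions and test functions in three variables\<close>

lemma partial_deriv_eq:
  assumes "(f has_derivative D) (at x)"
  shows "partial_deriv i f x = D (axis i 1)"
  using frechet_derivative_at[OF assms] by (simp add: partial_deriv_def)

lemma partial_deriv_add:
  assumes "\<And>x. f differentiable (at x)" "\<And>x. g differentiable (at x)"
  shows "partial_deriv i (\<lambda>x. f x + g x) = (\<lambda>x. partial_deriv i f x + partial_deriv i g x)"
proof
  fix x
  obtain F G where "(f has_derivative F) (at x)" "(g has_derivative G) (at x)"
    using assms unfolding differentiable_def by blast
  then show "partial_deriv i (\<lambda>x. f x + g x) x = partial_deriv i f x + partial_deriv i g x"
    by (simp add: partial_deriv_eq partial_deriv_eq[OF has_derivative_add])
qed

lemma partial_deriv_mult:
  assumes "\<And>x. f differentiable (at x)" "\<And>x. g differentiable (at x)"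
  shows "partial_deriv i (\<lambda>x. f x * g x) =
    (\<lambda>x. f x * partial_deriv i g x + partial_deriv i f x * g x)"
proof
  fix x
  obtain F G where "(f has_derivative F) (at x)" "(g has_derivative G) (at x)"
    using assms unfolding differentiable_def by blast
  then show "partial_deriv i (\<lambda>x. f x * g x) x = f x * partial_deriv i g x + partial_deriv i f x * g x"
    by (simp add: partial_deriv_eq partial_deriv_eq[OF has_derivative_mult])
qed

lemma partial_deriv_scale:
  assumes "\<And>x. f differentiable (at x)"
  shows "partial_deriv i (\<lambda>x. k * f (r *\<^sub>R x)) = (\<lambda>x. k * r * partial_deriv i f (r *\<^sub>R x))"
    and "(\<lambda>x. k * f (r *\<^sub>R x)) differentiable (at x)"
proof -
  have *: "((\<lambda>x. k * f (r *\<^sub>R x)) has_derivative (\<lambda>h. k * frechet_derivative f (at (r *\<^sub>R x)) (r *\<^sub>R h))) (at x)" for x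
  proof -
    have "(f has_derivative frechet_derivative f (at (r *\<^sub>R x))) (at (r *\<^sub>R x))"
      using assms frechet_derivative_works by blast
    with has_derivative_compose[of "\<lambda>x. r *\<^sub>R x" "\<lambda>h. r *\<^sub>R h" x UNIV f "frechet_derivative f (at (r *\<^sub>R x))"]
    have "((\<lambda>x. f (r *\<^sub>R x)) has_derivative (\<lambda>h. frechet_derivative f (at (r *\<^sub>R x)) (r *\<^sub>R h))) (at x)"
      by (simp add: bounded_linear_imp_has_derivative bounded_linear_scaleR_right)
    then show ?thesis by (auto intro!: derivative_eq_intros)
  qed
  then show "(\<lambda>x. k * f (r *\<^sub>R x)) differentiable (at x)"
    unfolding differentiable_def by blast
  show "partial_deriv i (\<lambda>x. k * f (r *\<^sub>R x)) = (\<lambda>x. k * r * partial_deriv i f (r *\<^sub>R x))"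
  proof
    fix x
    have "linear (frechet_derivative f (at (r *\<^sub>R x)))"
      using assms by (intro linear_frechet_derivative)
    then show "partial_deriv i (\<lambda>x. k * f (r *\<^sub>R x)) x = k * r * partial_deriv i f (r *\<^sub>R x)"
      by (simp add: partial_deriv_eq[OF *] linear_cmul) (simp add: partial_deriv_def)
  qed
qed

text \<open>Smoothness by coinduction: membership in any class of differentiable functions that is stable under
  partial derivatives.\<close>

lemma smooth_coinduct:
  assumes "P f" and step: "\<And>g. P g \<Longrightarrow> (\<forall>x. g differentiable (at x)) \<and> (\<forall>i. P (partial_deriv i g))"
  shows "smooth f"
proof -
  have "P (foldr partial_deriv js f)" for js
    by (induction js) (use assms in auto)
  then show ?thesis using step unfolding smooth_def by blast
qed

lemma smooth_differentiable: "smooth f \<Longrightarrow> f differentiable (at x)"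
  unfolding smooth_def by (metis foldr.simps(1) id_apply)

lemma smooth_partial_deriv: "smooth f \<Longrightarrow> smooth (partial_deriv i f)"
  unfolding smooth_def
proof (intro allI)
  fix js x assume *: "\<forall>js x. foldr partial_deriv js f differentiable (at x)"
  show "foldr partial_deriv js (partial_deriv i f) differentiable (at x)"
    using *[rule_format, of "js @ [i]" x] by simp
qed

lemma smooth_continuous: "smooth f \<Longrightarrow> continuous_on A f"
  by (meson continuous_at_imp_continuous_on differentiable_imp_continuous_within smooth_differentiable)

lemma smooth_measurable: "smooth f \<Longrightarrow> f \<in> borel_measurable borel"
  by (intro borel_measurable_continuous_onI smooth_continuous)

text \<open>Sums of products of smooth functions; by the Leibniz rule this class is stable under partial
  derivatives.\<close>

inductive prod_span :: "fn3 \<Rightarrow> bool" where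
  "smooth f \<Longrightarrow> smooth g \<Longrightarrow> prod_span (\<lambda>x. f x * g x)"
| "prod_span f \<Longrightarrow> prod_span g \<Longrightarrow> prod_span (\<lambda>x. f x + g x)"

lemma smooth_mult:
  assumes "smooth f" "smooth g"
  shows "smooth (\<lambda>x. f x * g x)"
proof (rule smooth_coinduct[of prod_span])
  show "prod_span (\<lambda>x. f x * g x)" using assms by (rule prod_span.intros)
  show "(\<forall>x. h differentiable (at x)) \<and> (\<forall>i. prod_span (partial_deriv i h))" if "prod_span h" for h
    using that
  proof induction
    case (1 f g)
    then have "prod_span (partial_deriv i (\<lambda>x. f x * g x))" for i
      by (auto simp: partial_deriv_mult smooth_differentiable intro!: prod_span.intros smooth_partial_deriv)
    moreover have "\<forall>x. (\<lambda>x. f x * g x) differentiable (at x)"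
      by (intro allI differentiable_mult smooth_differentiable 1)
    ultimately show ?case by blast
  next
    case (2 f g)
    then have "prod_span (partial_deriv i (\<lambda>x. f x + g x))" for i
      by (auto simp: partial_deriv_add intro!: prod_span.intros)
    then show ?case using 2 by auto
  qed
qed

lemma smooth_scale:
  assumes "smooth f"
  shows "smooth (\<lambda>x. k * f (r *\<^sub>R x))"
proof (rule smooth_coinduct[of "\<lambda>g. \<exists>k f. smooth f \<and> g = (\<lambda>x. k * f (r *\<^sub>R x))"])
  show "\<exists>k' f'. smooth f' \<and> (\<lambda>x. k * f (r *\<^sub>R x)) = (\<lambda>x. k' * f' (r *\<^sub>R x))"
    using assms by blast
  fix g assume "\<exists>k f. smooth f \<and> g = (\<lambda>x. k * f (r *\<^sub>R x))"
  then obtain k f where f: "smooth f" and g: "g = (\<lambda>x. k * f (r *\<^sub>R x))" by blast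
  show "(\<forall>x. g differentiable (at x)) \<and>
     (\<forall>i. \<exists>k f. smooth f \<and> partial_deriv i g = (\<lambda>x. k * f (r *\<^sub>R x)))"
    unfolding g using partial_deriv_scale[OF smooth_differentiable[OF f]] smooth_partial_deriv[OF f]
    by blast
qed

text \<open>The tensor product \<open>F\<^sub>1(x\<^sub>1) F\<^sub>2(x\<^sub>2) F\<^sub>3(x\<^sub>3)\<close>. Partial derivatives act on a single factor, and the test
  functions used below are all of this form or products with it.\<close>

definition tens :: "(3 \<Rightarrow> real \<Rightarrow> real) \<Rightarrow> fn3" where
  "tens F x = (\<Prod>i\<in>UNIV. F i (x $ i))"

lemma tens_has_derivative:
  assumes "\<And>i. smooth1 (F i)"
  shows "(tens F has_derivative
     (\<lambda>h. \<Sum>i\<in>UNIV. deriv (F i) (x $ i) * (h $ i) * (\<Prod>j\<in>UNIV - {i}. F j (x $ j)))) (at x)"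
  unfolding tens_def
proof (rule has_derivative_prod)
  fix i
  have "(F i has_derivative (\<lambda>h. deriv (F i) (x $ i) * h)) (at (x $ i))"
    using smooth1_DERIV[OF assms] by (simp add: has_field_derivative_def)
  with has_derivative_compose[of "\<lambda>x. x $ i" "\<lambda>h. h $ i" x UNIV "F i" "\<lambda>h. deriv (F i) (x $ i) * h"]
  show "((\<lambda>x. F i (x $ i)) has_derivative (\<lambda>h. deriv (F i) (x $ i) * (h $ i))) (at x)"
    by (simp add: bounded_linear_imp_has_derivative bounded_linear_vec_nth)
qed

lemma partial_deriv_tens:
  assumes "\<And>i. smooth1 (F i)"
  shows "partial_deriv i (tens F) = tens (F(i := deriv (F i)))"
proof
  fix x
  have "partial_deriv i (tens F) x =
     (\<Sum>k\<in>UNIV. deriv (F k) (x $ k) * (axis i 1 $ k) * (\<Prod>j\<in>UNIV - {k}. F j (x $ j)))"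
    by (rule partial_deriv_eq[OF tens_has_derivative[OF assms]])
  also have "\<dots> = (\<Sum>k\<in>UNIV. if k = i then deriv (F i) (x $ i) * (\<Prod>j\<in>UNIV - {i}. F j (x $ j)) else 0)"
    by (intro sum.cong) (auto simp: axis_def)
  also have "\<dots> = deriv (F i) (x $ i) * (\<Prod>j\<in>UNIV - {i}. F j (x $ j))" by simp
  also have "\<dots> = tens (F(i := deriv (F i))) x"
    unfolding tens_def by (subst prod.remove[of UNIV i]) auto
  finally show "partial_deriv i (tens F) x = tens (F(i := deriv (F i))) x" .
qed

lemma smooth_tens:
  assumes "\<And>i. smooth1 (F i)"
  shows "smooth (tens F)"
proof (rule smooth_coinduct[of "\<lambda>g. \<exists>F. (\<forall>i. smooth1 (F i)) \<and> g = tens F"])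
  show "\<exists>F'. (\<forall>i. smooth1 (F' i)) \<and> tens F = tens F'" using assms by blast
  fix g assume "\<exists>F. (\<forall>i. smooth1 (F i)) \<and> g = tens F"
  then obtain F where F: "\<And>i. smooth1 (F i)" and g: "g = tens F" by blast
  have "\<forall>x. g differentiable (at x)" unfolding g using tens_has_derivative[of F, OF F] differentiableI by blast
  moreover have "\<exists>F'. (\<forall>i. smooth1 (F' i)) \<and> partial_deriv i g = tens F'" for i
    unfolding g using F by (intro exI[of _ "F(i := deriv (F i))"]) (auto simp: partial_deriv_tens smooth1_deriv)
  ultimately show "(\<forall>x. g differentiable (at x)) \<and>
     (\<forall>i. \<exists>F'. (\<forall>i. smooth1 (F' i)) \<and> partial_deriv i g = tens F')" by blast
qed

lemma compact_closure_support:
  fixes \<phi> :: "'a::euclidean_space \<Rightarrow> real"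
  assumes "\<And>x. \<phi> x \<noteq> 0 \<Longrightarrow> x \<in> cbox l u"
  shows "compact (closure {x. \<phi> x \<noteq> 0})"
  using assms by (intro compact_closure[THEN iffD2] bounded_subset[OF bounded_cbox[of l u]]) auto

lemma test_fun_tens:
  assumes "\<And>i. smooth1 (F i)" and supp: "\<And>i t. t \<notin> {l $ i .. u $ i} \<Longrightarrow> F i t = 0"
  shows "test_fun (tens F)"
  unfolding test_fun_def
proof (intro conjI smooth_tens assms(1) compact_closure_support)
  fix x assume "tens F x \<noteq> 0"
  then have "F i (x $ i) \<noteq> 0" for i
    by (auto simp: tens_def)
  then have "x $ i \<in> {l $ i .. u $ i}" for i using supp by blast
  then show "x \<in> cbox l u" by (auto simp: mem_box_cart)
qed

lemma test_fun_bounded: "test_fun \<phi> \<Longrightarrow> bounded {x. \<phi> x \<noteq> 0}"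
  using bounded_subset[OF compact_imp_bounded closure_subset] by (auto simp: test_fun_def)

lemma test_fun_mult:
  assumes "smooth \<theta>" "test_fun \<phi>"
  shows "test_fun (\<lambda>x. \<theta> x * \<phi> x)" "test_fun (\<lambda>x. \<phi> x * \<theta> x)"
proof -
  have "compact (closure {x. \<theta> x * \<phi> x \<noteq> 0})"
  proof (rule compact_closure[THEN iffD2])
    have "bounded {x. \<phi> x \<noteq> 0}"
      using assms(2) by (rule test_fun_bounded)
    then show "bounded {x. \<theta> x * \<phi> x \<noteq> 0}"
      by (rule bounded_subset) auto
  qed
  then show "test_fun (\<lambda>x. \<theta> x * \<phi> x)" "test_fun (\<lambda>x. \<phi> x * \<theta> x)"
    using assms by (auto simp: test_fun_def mult.commute intro!: smooth_mult)
qed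

lemma test_fun_scale:
  assumes "test_fun \<phi>" "r \<noteq> 0"
  shows "test_fun (\<lambda>x. k * \<phi> (r *\<^sub>R x))"
proof -
  have "bounded {x. \<phi> x \<noteq> 0}"
    using assms(1) by (rule test_fun_bounded)
  then have "bounded ((\<lambda>x. (1/r) *\<^sub>R x) ` {x. \<phi> x \<noteq> 0})" by (rule bounded_scaling)
  moreover have "{x. k * \<phi> (r *\<^sub>R x) \<noteq> 0} \<subseteq> (\<lambda>x. (1/r) *\<^sub>R x) ` {x. \<phi> x \<noteq> 0}"
  proof
    fix x assume "x \<in> {x. k * \<phi> (r *\<^sub>R x) \<noteq> 0}"
    then show "x \<in> (\<lambda>x. (1/r) *\<^sub>R x) ` {x. \<phi> x \<noteq> 0}"
      using assms(2) by (intro image_eqI[of _ _ "r *\<^sub>R x"]) auto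
  qed
  ultimately have "bounded {x. k * \<phi> (r *\<^sub>R x) \<noteq> 0}" by (rule bounded_subset)
  then show ?thesis using assms by (auto simp: test_fun_def intro!: smooth_scale)
qed

lemma test_fun_support:
  assumes "test_fun \<phi>"
  obtains l u where "\<And>x. x \<notin> cbox l u \<Longrightarrow> \<phi> x = 0"  "\<And>x i. x \<notin> cbox l u \<Longrightarrow> partial_deriv i \<phi> x = 0"
proof -
  define K where "K = closure {x. \<phi> x \<noteq> 0}"
  have "bounded K" "closed K" using assms by (auto simp: test_fun_def compact_imp_bounded K_def)
  then obtain l u where lu: "K \<subseteq> cbox l u" using bounded_subset_cbox_symmetric by blast
  have zero: "\<phi> x = 0" if "x \<notin> K" for x
    using that unfolding K_def by (metis (mono_tags, lifting) closure_subset in_mono mem_Collect_eq)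
  have "partial_deriv i \<phi> x = 0" if "x \<notin> K" for i x
  proof -
    have "((\<lambda>x. 0) has_derivative (\<lambda>h. 0)) (at x)" by simp
    then have "(\<phi> has_derivative (\<lambda>h. 0)) (at x)"
      by (rule has_derivative_transform_within_open[where s="- K"]) (use that zero \<open>closed K\<close> in auto)
    from partial_deriv_eq[OF this] show ?thesis by simp
  qed
  with zero show ?thesis using lu that[of l u] by blast
qed

lemma test_fun_partial_deriv:
  assumes "test_fun \<phi>"
  shows "test_fun (partial_deriv i \<phi>)"
proof -
  obtain l u where "\<And>x. x \<notin> cbox l u \<Longrightarrow> partial_deriv i \<phi> x = 0"
    using test_fun_support[OF assms] by metis
  then have "compact (closure {x. partial_deriv i \<phi> x \<noteq> 0})"
    by (intro compact_closure_support) blast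
  then show ?thesis using assms by (simp only: test_fun_def smooth_partial_deriv simp_thms)
qed

lemma test_fun_bound:
  assumes "test_fun \<phi>"
  obtains M where "M \<ge> 0" "\<And>x. \<bar>\<phi> x\<bar> \<le> M"
proof -
  obtain l u where lu: "\<And>x. x \<notin> cbox l u \<Longrightarrow> \<phi> x = 0"
    using test_fun_support[OF assms] by metis
  have "compact (\<phi> ` cbox l u)"
    using assms by (intro compact_continuous_image smooth_continuous) (auto simp: test_fun_def)
  then obtain M where M: "\<And>x. x \<in> cbox l u \<Longrightarrow> \<bar>\<phi> x\<bar> \<le> M"
    using compact_imp_bounded[of "\<phi> ` cbox l u"] by (auto simp: bounded_iff)
  show ?thesis
  proof (rule that[of "max M 0"])
    show "\<bar>\<phi> x\<bar> \<le> max M 0" for x using M[of x] lu[of x] by (cases "x \<in> cbox l u") auto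
  qed simp
qed

section \<open>Weak gradients\<close>

text \<open>Boxes form a generator stable under intersection, so the positive and negative parts of \<open>D\<close> have the
  same density measure.\<close>

lemma box_integrals_zero_AE:
  fixes D :: "'a::euclidean_space \<Rightarrow> real"
  assumes [measurable]: "D \<in> borel_measurable borel"
    and int: "\<And>l u. set_integrable lborel (box l u) D"
    and zero: "\<And>l u. (LINT x:box l u|lborel. D x) = 0"
  shows "AE x in lborel. D x = 0"
proof -
  define P where "P = density lborel (\<lambda>x. ennreal (max 0 (D x)))"
  define N where "N = density lborel (\<lambda>x. ennreal (max 0 (- D x)))"
  have ip: "integrable lborel (\<lambda>x. indicator (box l u) x * max 0 (D x))"
       "integrable lborel (\<lambda>x. indicator (box l u) x * max 0 (- D x))" for l u
    by (rule Bochner_Integration.integrable_bound[OF int[of l u, unfolded set_integrable_def]];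
        auto intro!: AE_I2 simp: indicator_def)+
  have P: "emeasure P (box l u) = ennreal (LINT x|lborel. indicator (box l u) x * max 0 (D x))" for l u
    unfolding P_def
    by (subst nn_integral_eq_integral[OF ip(1), symmetric])
       (auto simp: emeasure_density intro!: nn_integral_cong AE_I2 split: split_indicator)
  have N: "emeasure N (box l u) = ennreal (LINT x|lborel. indicator (box l u) x * max 0 (- D x))" for l u
    unfolding N_def
    by (subst nn_integral_eq_integral[OF ip(2), symmetric])
       (auto simp: emeasure_density intro!: nn_integral_cong AE_I2 split: split_indicator)
  have "(LINT x|lborel. indicator (box l u) x * max 0 (D x)) -
        (LINT x|lborel. indicator (box l u) x * max 0 (- D x)) = 0" for l u
  proof -
    have "(LINT x|lborel. indicator (box l u) x * max 0 (D x)) -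
        (LINT x|lborel. indicator (box l u) x * max 0 (- D x)) =
        (LINT x|lborel. indicator (box l u) x * max 0 (D x) - indicator (box l u) x * max 0 (- D x))"
      by (rule Bochner_Integration.integral_diff[OF ip, symmetric])
    also have "\<dots> = (LINT x:box l u|lborel. D x)"
      unfolding set_lebesgue_integral_def
      by (intro Bochner_Integration.integral_cong) (auto split: split_indicator)
    finally show ?thesis using zero by simp
  qed
  then have eq: "emeasure P (box l u) = emeasure N (box l u)" for l u
    unfolding P N by simp
  have "P = N"
  proof (rule measure_eqI_generator_eq)
    let ?E = "range (\<lambda>(a, b). box a b::'a set)"
    show "Int_stable ?E" by (auto simp: Int_stable_def box_Int_box)
    show "?E \<subseteq> Pow UNIV" "sets P = sigma_sets UNIV ?E" "sets N = sigma_sets UNIV ?E"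
      by (simp_all add: P_def N_def borel_eq_box)
    let ?A = "\<lambda>n::nat. box (- (real n *\<^sub>R One)) (real n *\<^sub>R One) :: 'a set"
    show "range ?A \<subseteq> ?E" "(\<Union>i. ?A i) = UNIV"
      unfolding UN_box_eq_UNIV by auto
    show "emeasure P (?A i) \<noteq> \<infinity>" for i unfolding P by simp
    show "emeasure P X = emeasure N X" if "X \<in> ?E" for X using that eq by auto
  qed
  then have "AE x in lborel. ennreal (max 0 (D x)) = ennreal (max 0 (- D x))"
    unfolding P_def N_def by (intro sigma_finite_measure.density_unique[OF sigma_finite_lborel]) auto
  then show ?thesis
    by eventually_elim (auto simp: max_def split: if_splits)
qed

lemma set_integrable_mult_bounded_support:
  fixes f \<phi> :: "'a::euclidean_space \<Rightarrow> real"
  assumes [measurable]: "f \<in> borel_measurable borel" "\<phi> \<in> borel_measurable borel"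
    and "set_integrable lborel (cbox l u) f"
    and "\<And>x. \<bar>\<phi> x\<bar> \<le> M" "\<And>x. x \<notin> cbox l u \<Longrightarrow> \<phi> x = 0"
  shows "integrable lborel (\<lambda>x. f x * \<phi> x)"
proof (rule Bochner_Integration.integrable_bound)
  show "integrable lborel (\<lambda>x. M * (indicator (cbox l u) x *\<^sub>R f x))"
    using assms(3) unfolding set_integrable_def by (intro integrable_mult_right)
  show "AE x in lborel. norm (f x * \<phi> x) \<le> norm (M * (indicator (cbox l u) x *\<^sub>R f x))"
  proof (rule AE_I2)
    fix x
    have "\<bar>\<phi> x\<bar> * \<bar>f x\<bar> \<le> \<bar>M\<bar> * \<bar>f x\<bar>" using assms(4)[of x] by (intro mult_right_mono) auto
    then show "norm (f x * \<phi> x) \<le> norm (M * (indicator (cbox l u) x *\<^sub>R f x))"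
      using assms(5)[of x] by (cases "x \<in> cbox l u") (auto simp: abs_mult mult.commute)
  qed
qed simp

lemma loc_integrable_test_fun:
  fixes f :: fn3
  assumes "f \<in> borel_measurable borel" "\<And>l u. set_integrable lborel (cbox l u) f" "test_fun \<phi>"
  shows "integrable lborel (\<lambda>x. f x * \<phi> x)"
proof -
  obtain l u where "\<And>x. x \<notin> cbox l u \<Longrightarrow> \<phi> x = 0"
    using test_fun_support[OF assms(3)] by metis
  moreover obtain M where "\<And>x. \<bar>\<phi> x\<bar> \<le> M" using test_fun_bound[OF assms(3)] by metis
  ultimately show ?thesis
    using assms by (intro set_integrable_mult_bounded_support) (auto intro: smooth_measurable simp: test_fun_def)
qed

text \<open>Smooth approximations of the indicator of a box.\<close>

definition box_bump :: "nat \<Rightarrow> real^3 \<Rightarrow> real^3 \<Rightarrow> fn3" where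
  "box_bump n l u = tens (\<lambda>i. bump n (l $ i) (u $ i))"

lemma test_fun_box_bump: "test_fun (box_bump n l u)"
  unfolding box_bump_def by (intro test_fun_tens[of _ l u] smooth1_bump bump_outside) auto

lemma box_bump_bound: "0 \<le> box_bump n l u x" "box_bump n l u x \<le> 1"
  unfolding box_bump_def tens_def using bump_bounds by (auto intro!: prod_nonneg prod_le_1)

lemma box_bump_outside: "x \<notin> box l u \<Longrightarrow> box_bump n l u x = 0"
proof -
  assume "x \<notin> box l u"
  then obtain i where "x $ i \<notin> {l $ i<..<u $ i}" by (auto simp: mem_box_cart)
  then have "bump n (l $ i) (u $ i) (x $ i) = 0" by (rule bump_outside)
  then show "box_bump n l u x = 0" unfolding box_bump_def tens_def by (meson UNIV_I finite prod_zero)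
qed

lemma box_bump_tendsto: "(\<lambda>n. box_bump n l u x) \<longlonglongrightarrow> indicator (box l u) x"
proof -
  have "(\<lambda>n. box_bump n l u x) \<longlonglongrightarrow> (\<Prod>i\<in>UNIV. indicator {l $ i<..<u $ i} (x $ i))"
    unfolding box_bump_def tens_def by (intro tendsto_prod bump_tendsto)
  also have "(\<Prod>i\<in>UNIV. indicator {l $ i<..<u $ i} (x $ i)) = (indicator (box l u) x :: real)"
    by (auto simp: mem_box_cart indicator_def prod.If_cases)
  finally show ?thesis .
qed

text \<open>The fundamental lemma of the calculus of variations; it suffices to test with the functions
  \<open>box_bump\<close>.\<close>

lemma fundamental_lemma:
  fixes D :: fn3
  assumes [measurable]: "D \<in> borel_measurable borel"
    and int: "\<And>l u. set_integrable lborel (cbox l u) D"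
    and zero: "\<And>n l u. (LINT x|lborel. D x * box_bump n l u x) = 0"
  shows "AE x in lborel. D x = 0"
proof (rule box_integrals_zero_AE)
  fix l u :: "real^3"
  show "set_integrable lborel (box l u) D"
    by (rule set_integrable_subset[OF int[of l u]]) (auto simp: box_subset_cbox)
  have "(\<lambda>n. LINT x|lborel. D x * box_bump n l u x) \<longlonglongrightarrow> (LINT x|lborel. D x * indicator (box l u) x)"
  proof (rule integral_dominated_convergence)
    show "integrable lborel (\<lambda>x. norm (indicator (cbox l u) x *\<^sub>R D x))"
      using int unfolding set_integrable_def by (rule integrable_norm)
    show "(\<lambda>x. D x * box_bump n l u x) \<in> borel_measurable lborel" for n
    proof -
      have [measurable]: "box_bump n l u \<in> borel_measurable borel"
        using test_fun_box_bump[of n l u] by (intro smooth_measurable) (simp add: test_fun_def)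
      show ?thesis by measurable
    qed
    show "AE x in lborel. (\<lambda>n. D x * box_bump n l u x) \<longlonglongrightarrow> D x * indicator (box l u) x"
      by (intro AE_I2 tendsto_intros box_bump_tendsto)
    show "AE x in lborel. norm (D x * box_bump n l u x) \<le> norm (indicator (cbox l u) x *\<^sub>R D x)" for n
    proof (rule AE_I2)
      fix x
      have "x \<in> cbox l u" if "x \<in> box l u" using that box_subset_cbox by blast
      then show "norm (D x * box_bump n l u x) \<le> norm (indicator (cbox l u) x *\<^sub>R D x)"
        using box_bump_bound[of n l u x] box_bump_outside[of x l u n]
        by (cases "x \<in> box l u") (auto simp: abs_mult mult_left_le)
    qed
  qed auto
  then have "(LINT x|lborel. D x * indicator (box l u) x) = 0"
    unfolding zero using LIMSEQ_unique tendsto_const by blast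
  then show "(LINT x:box l u|lborel. D x) = 0"
    unfolding set_lebesgue_integral_def by (simp add: mult.commute)
qed fact

lemma locally_integrable_cbox:
  "locally_integrable f \<Longrightarrow> set_integrable lborel (cbox l u) f"
  by (auto simp: locally_integrable_def)

lemma locally_integrable_component:
  fixes G :: "real^3 \<Rightarrow> real^3"
  assumes "locally_integrable G"
  shows "locally_integrable (\<lambda>x. G x $ i)"
  unfolding locally_integrable_def
proof (intro conjI allI impI)
  show "(\<lambda>x. G x $ i) \<in> borel_measurable lborel"
    using assms measurable_compose[OF _ borel_measurable_nth] by (auto simp: locally_integrable_def)
  fix K :: "(real^3) set" assume "compact K"
  then have "integrable lborel (\<lambda>x. indicator K x *\<^sub>R G x)"
    using assms by (auto simp: locally_integrable_def set_integrable_def)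
  from integrable_bounded_linear[OF bounded_linear_vec_nth[of i] this]
  show "set_integrable lborel K (\<lambda>x. G x $ i)" by (simp add: set_integrable_def)
qed

text \<open>Hence the choice made in \<open>wgrad\<close> is immaterial, and \<open>grad_norm\<close> may be computed from any weak
  gradient.\<close>

lemma weak_gradient_unique:
  assumes G: "weak_gradient u G" and H: "weak_gradient u H"
  shows "AE x in lborel. G x = H x"
proof -
  have "AE x in lborel. G x $ i - H x $ i = 0" for i
  proof (rule fundamental_lemma)
    have lG: "locally_integrable (\<lambda>x. G x $ i)" and lH: "locally_integrable (\<lambda>x. H x $ i)"
      using G H by (auto simp: weak_gradient_def intro: locally_integrable_component)
    then show "(\<lambda>x. G x $ i - H x $ i) \<in> borel_measurable borel"
      by (auto simp: locally_integrable_def)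
    show "set_integrable lborel (cbox l u) (\<lambda>x. G x $ i - H x $ i)" for l u
      using lG lH by (intro set_integral_diff locally_integrable_cbox)
    fix n l and v :: "real^3"
    let ?\<phi> = "box_bump n l v"
    have "integrable lborel (\<lambda>x. G x $ i * ?\<phi> x)" "integrable lborel (\<lambda>x. H x $ i * ?\<phi> x)"
      using lG lH
      by (auto intro!: loc_integrable_test_fun test_fun_box_bump locally_integrable_cbox simp: locally_integrable_def)
    then have "(LINT x|lborel. (G x $ i - H x $ i) * ?\<phi> x) =
       (LINT x|lborel. G x $ i * ?\<phi> x) - (LINT x|lborel. H x $ i * ?\<phi> x)"
      by (simp add: left_diff_distrib)
    also have "\<dots> = 0"
    proof -
      have "(LINT x|lborel. u x * partial_deriv i ?\<phi> x) = - (LINT x|lborel. G x $ i * ?\<phi> x)"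
        "(LINT x|lborel. u x * partial_deriv i ?\<phi> x) = - (LINT x|lborel. H x $ i * ?\<phi> x)"
        using G H test_fun_box_bump[of n l v] unfolding weak_gradient_def by blast+
      then show ?thesis by linarith
    qed
    finally show "(LINT x|lborel. (G x $ i - H x $ i) * ?\<phi> x) = 0" .
  qed
  then have "AE x in lborel. \<forall>i. G x $ i - H x $ i = 0"
    by (subst AE_all_countable) auto
  then show ?thesis by eventually_elim (auto simp: vec_eq_iff)
qed

lemma weak_gradient_wgrad: "weak_gradient u G \<Longrightarrow> weak_gradient u (wgrad u)"
  unfolding wgrad_def by (rule someI[of "weak_gradient u"])

lemma wgrad_AE_eq: "weak_gradient u G \<Longrightarrow> AE x in lborel. wgrad u x = G x"
  using weak_gradient_unique weak_gradient_wgrad by blast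

lemma weak_gradient_measurable:
  assumes "weak_gradient u G"
  shows "u \<in> borel_measurable borel" "G \<in> borel_measurable borel"
  using assms by (auto simp: weak_gradient_def locally_integrable_def)

lemma integral_abs_powr_2: "(LINT x|lborel. \<bar>f x\<bar> powr 2) = (LINT x|lborel. (f x)\<^sup>2)" for f :: fn3
  by (intro Bochner_Integration.integral_cong) auto

lemma L_norm_2_square: "(L_norm 2 f)\<^sup>2 = (LINT x|lborel. (f x)\<^sup>2)" for f :: fn3
proof -
  have "(LINT x|lborel. (f x)\<^sup>2) \<ge> 0" by simp
  then show ?thesis unfolding L_norm_def integral_abs_powr_2 by (simp add: powr_half_sqrt)
qed

lemma L_norm_nonneg: "L_norm r f \<ge> 0"
  by (simp add: L_norm_def)

lemma L_norm_powr:
  assumes "r > 0"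
  shows "L_norm r f powr r = (LINT x|lborel. \<bar>f x\<bar> powr r)"
  using assms by (simp add: L_norm_def powr_powr)

lemma in_L_2_iff: "in_L 2 f \<longleftrightarrow> f \<in> borel_measurable borel \<and> integrable lborel (\<lambda>x. (f x)\<^sup>2)"
  by (simp add: in_L_def)

lemma grad_norm_square:
  assumes "weak_gradient u G"
  shows "(grad_norm u)\<^sup>2 = (LINT x|lborel. (norm (G x))\<^sup>2)"
proof -
  have "(LINT x|lborel. (norm (wgrad u x))\<^sup>2) = (LINT x|lborel. (norm (G x))\<^sup>2)"
    using weak_gradient_measurable[OF assms] weak_gradient_measurable[OF weak_gradient_wgrad[OF assms]] wgrad_AE_eq[OF assms]
    by (intro integral_cong_AE) auto
  then show ?thesis unfolding grad_norm_def L_norm_2_square .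
qed

lemma H1_wgrad:
  assumes "u \<in> H1"
  shows "weak_gradient u (wgrad u)" "integrable lborel (\<lambda>x. (norm (wgrad u x))\<^sup>2)"
    "u \<in> borel_measurable borel" "integrable lborel (\<lambda>x. (u x)\<^sup>2)"
proof -
  obtain G where G: "weak_gradient u G" "integrable lborel (\<lambda>x. (norm (G x))\<^sup>2)"
    using assms by (auto simp: H1_def in_L_2_iff)
  show w: "weak_gradient u (wgrad u)" using G weak_gradient_wgrad by blast
  show "integrable lborel (\<lambda>x. (norm (wgrad u x))\<^sup>2)"
    by (rule integrable_cong_AE_imp[OF G(2)])
       (use wgrad_AE_eq[OF G(1)] weak_gradient_measurable[OF w] in auto)
  show "u \<in> borel_measurable borel" "integrable lborel (\<lambda>x. (u x)\<^sup>2)"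
    using assms by (auto simp: H1_def in_L_2_iff)
qed

lemma H1_I:
  assumes "weak_gradient u G" "integrable lborel (\<lambda>x. (u x)\<^sup>2)" "integrable lborel (\<lambda>x. (norm (G x))\<^sup>2)"
  shows "u \<in> H1"
  using assms weak_gradient_measurable[OF assms(1)] by (auto simp: H1_def in_L_2_iff)

section \<open>Scaling and the fibre maps\<close>

lemma lborel_scale_density:
  "r > 0 \<Longrightarrow> (lborel :: (real^3) measure) =
     density (distr lborel borel (\<lambda>x. r *\<^sub>R x)) (\<lambda>_. ennreal (r ^ 3))"
  using lborel_affine[of r "0 :: real^3"] by simp

lemma integral_scale:
  fixes f :: "real^3 \<Rightarrow> 'b::{banach, second_countable_topology}"
  assumes [measurable]: "f \<in> borel_measurable borel" and r: "r > 0"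
  shows "(LINT x|lborel. f (r *\<^sub>R x)) = (1 / r ^ 3) *\<^sub>R (LINT x|lborel. f x)"
    and "integrable lborel (\<lambda>x. f (r *\<^sub>R x)) \<longleftrightarrow> integrable lborel f"
proof -
  have "(LINT x|lborel. f x) =
     (LINT x|density (distr lborel borel (\<lambda>x. r *\<^sub>R x)) (\<lambda>_. ennreal (r ^ 3)). f x)"
    using lborel_scale_density[OF r] by simp
  also have "\<dots> = r ^ 3 *\<^sub>R (LINT x|lborel. f (r *\<^sub>R x))"
    using r by (subst integral_density) (auto simp: integral_distr)
  finally show "(LINT x|lborel. f (r *\<^sub>R x)) = (1 / r ^ 3) *\<^sub>R (LINT x|lborel. f x)"
    using r by simp
  have "integrable lborel f \<longleftrightarrow>
     integrable (density (distr lborel borel (\<lambda>x. r *\<^sub>R x)) (\<lambda>_. ennreal (r ^ 3))) f"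
    using lborel_scale_density[OF r] by simp
  also have "\<dots> \<longleftrightarrow> integrable lborel (\<lambda>x. f (r *\<^sub>R x))"
  proof -
    have "integrable lborel (\<lambda>x. r ^ 3 *\<^sub>R f (r *\<^sub>R x)) \<longleftrightarrow> integrable lborel (\<lambda>x. f (r *\<^sub>R x))"
      using r integrable_scaleR_right[of "1 / r ^ 3" lborel "\<lambda>x. r ^ 3 *\<^sub>R f (r *\<^sub>R x)"]
      by auto
    then show ?thesis using r by (subst integrable_density) (auto simp: integrable_distr_eq)
  qed
  finally show "integrable lborel (\<lambda>x. f (r *\<^sub>R x)) \<longleftrightarrow> integrable lborel f" ..
qed

lemma locally_integrable_scale:
  fixes f :: "real^3 \<Rightarrow> 'b::{banach, second_countable_topology}"
  assumes "locally_integrable f" "r > 0"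
  shows "locally_integrable (\<lambda>x. k *\<^sub>R f (r *\<^sub>R x))"
  unfolding locally_integrable_def
proof (intro conjI allI impI)
  have [measurable]: "f \<in> borel_measurable borel" using assms by (simp add: locally_integrable_def)
  show "(\<lambda>x. k *\<^sub>R f (r *\<^sub>R x)) \<in> borel_measurable lborel" by measurable
  fix K :: "(real^3) set" assume K: "compact K"
  let ?K = "(\<lambda>x. r *\<^sub>R x) ` K"
  have "compact ?K" using K by (rule compact_scaling)
  then have [measurable]: "?K \<in> sets borel" by (simp add: borel_closed compact_imp_closed)
  have "integrable lborel (\<lambda>x. indicator ?K x *\<^sub>R f x)"
    using assms \<open>compact ?K\<close> by (auto simp: locally_integrable_def set_integrable_def)
  then have "integrable lborel (\<lambda>x. indicator ?K (r *\<^sub>R x) *\<^sub>R f (r *\<^sub>R x))"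
    using integral_scale(2)[of "\<lambda>x. indicator ?K x *\<^sub>R f x" r] assms by simp
  moreover have "indicator ?K (r *\<^sub>R x) = (indicator K x :: real)" for x
    using assms by (auto simp: indicator_def)
  ultimately have "integrable lborel (\<lambda>x. k *\<^sub>R (indicator K x *\<^sub>R f (r *\<^sub>R x)))"
    by (intro integrable_scaleR_right) simp
  then show "set_integrable lborel K (\<lambda>x. k *\<^sub>R f (r *\<^sub>R x))"
    by (simp add: set_integrable_def mult.commute)
qed

lemma weak_gradient_scale:
  assumes wg: "weak_gradient u G" and r: "r > 0"
  shows "weak_gradient (\<lambda>x. k * u (r *\<^sub>R x)) (\<lambda>x. (k * r) *\<^sub>R G (r *\<^sub>R x))"
  unfolding weak_gradient_def
proof (intro conjI allI impI)
  show "locally_integrable (\<lambda>x. k * u (r *\<^sub>R x))"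
    using locally_integrable_scale[of u r k] wg r by (simp add: weak_gradient_def)
  show "locally_integrable (\<lambda>x. (k * r) *\<^sub>R G (r *\<^sub>R x))"
    using wg r by (intro locally_integrable_scale) (simp add: weak_gradient_def)
  fix \<phi> i assume \<phi>: "test_fun \<phi>"
  define \<psi> where "\<psi> = (\<lambda>x. 1 * \<phi> ((1 / r) *\<^sub>R x))"
  have \<psi>: "test_fun \<psi>" unfolding \<psi>_def using \<phi> r by (intro test_fun_scale) auto
  have d\<psi>: "partial_deriv i \<psi> = (\<lambda>x. 1 * (1 / r) * partial_deriv i \<phi> ((1 / r) *\<^sub>R x))"
    unfolding \<psi>_def using \<phi> by (intro partial_deriv_scale smooth_differentiable) (simp add: test_fun_def)
  note [measurable] = weak_gradient_measurable[OF wg]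
  have [measurable]: "\<psi> \<in> borel_measurable borel" "partial_deriv i \<psi> \<in> borel_measurable borel"
    using \<psi> by (auto simp: test_fun_def intro!: smooth_measurable smooth_partial_deriv)
  have "(LINT x|lborel. k * u (r *\<^sub>R x) * partial_deriv i \<phi> x) =
     (LINT x|lborel. (\<lambda>y. (k * r) * (u y * partial_deriv i \<psi> y)) (r *\<^sub>R x))"
    using r by (intro Bochner_Integration.integral_cong) (auto simp: d\<psi>)
  also have "\<dots> = 1 / r ^ 3 * ((k * r) * (LINT x|lborel. u x * partial_deriv i \<psi> x))"
    using r by (subst integral_scale) auto
  also have "(LINT x|lborel. u x * partial_deriv i \<psi> x) = - (LINT x|lborel. G x $ i * \<psi> x)"
    using wg \<psi> by (simp add: weak_gradient_def)
  also have "1 / r ^ 3 * ((k * r) * - (LINT x|lborel. G x $ i * \<psi> x)) =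
     - (1 / r ^ 3 * (LINT x|lborel. (k * r) * (G x $ i * \<psi> x)))"
    by simp
  also have "1 / r ^ 3 * (LINT x|lborel. (k * r) * (G x $ i * \<psi> x)) =
     (LINT x|lborel. (\<lambda>y. (k * r) * (G y $ i * \<psi> y)) (r *\<^sub>R x))"
    using r measurable_compose[OF weak_gradient_measurable(2)[OF wg] borel_measurable_nth]
    by (subst integral_scale) auto
  also have "\<dots> = (LINT x|lborel. ((k * r) *\<^sub>R G (r *\<^sub>R x)) $ i * \<phi> x)"
    using r by (intro Bochner_Integration.integral_cong) (auto simp: \<psi>_def)
  finally show "(LINT x|lborel. k * u (r *\<^sub>R x) * partial_deriv i \<phi> x) =
     - (LINT x|lborel. ((k * r) *\<^sub>R G (r *\<^sub>R x)) $ i * \<phi> x)" .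
qed

text \<open>The logarithmic term \<open>\<integral>u\<^sup>2 ln u\<^sup>2\<close>.\<close>

definition log_int :: "fn3 \<Rightarrow> real" where
  "log_int u = (LINT x|lborel. (u x)\<^sup>2 * ln ((u x)\<^sup>2))"

lemma W_iff:
  "u \<in> W \<longleftrightarrow> u \<in> H1 \<and> integrable lborel (\<lambda>x. (u x)\<^sup>2 * ln ((u x)\<^sup>2))"
proof -
  have "integrable lborel (\<lambda>x. (u x)\<^sup>2 * \<bar>ln ((u x)\<^sup>2)\<bar>) \<longleftrightarrow> integrable lborel (\<lambda>x. (u x)\<^sup>2 * ln ((u x)\<^sup>2))"
    if "u \<in> H1"
  proof -
    have [measurable]: "u \<in> borel_measurable borel" using H1_wgrad[OF that] by simp
    have "(\<lambda>x. (u x)\<^sup>2 * \<bar>ln ((u x)\<^sup>2)\<bar>) = (\<lambda>x. \<bar>(u x)\<^sup>2 * ln ((u x)\<^sup>2)\<bar>)"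
      by (auto simp: abs_mult)
    then show ?thesis by (simp add: integrable_abs_iff)
  qed
  then show ?thesis by (auto simp: W_def)
qed

lemma H1_scale:
  fixes u :: fn3 and k r q :: real
  assumes u: "u \<in> H1" and r: "r > 0"
  defines "v \<equiv> (\<lambda>x. k * u (r *\<^sub>R x))"
  shows "v \<in> H1" "(grad_norm v)\<^sup>2 = k\<^sup>2 / r * (grad_norm u)\<^sup>2"
    "(L_norm 2 v)\<^sup>2 = k\<^sup>2 / r ^ 3 * (L_norm 2 u)\<^sup>2"
    "q > 0 \<Longrightarrow> L_norm q v powr q = \<bar>k\<bar> powr q / r ^ 3 * L_norm q u powr q"
proof -
  note w = H1_wgrad[OF u]
  note [measurable] = w(3) weak_gradient_measurable(2)[OF w(1)]
  note wv = weak_gradient_scale[OF w(1) r, of k, folded v_def]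
  show "v \<in> H1"
  proof (rule H1_I[OF wv])
    have "integrable lborel (\<lambda>x. k\<^sup>2 * (u (r *\<^sub>R x))\<^sup>2)"
      using integral_scale(2)[of "\<lambda>x. (u x)\<^sup>2" r] w r by simp
    then show "integrable lborel (\<lambda>x. (v x)\<^sup>2)" by (simp add: v_def power_mult_distrib)
    have "integrable lborel (\<lambda>x. (k * r)\<^sup>2 * (norm (wgrad u (r *\<^sub>R x)))\<^sup>2)"
      using integral_scale(2)[of "\<lambda>x. (norm (wgrad u x))\<^sup>2" r] w r by simp
    then show "integrable lborel (\<lambda>x. (norm ((k * r) *\<^sub>R wgrad u (r *\<^sub>R x)))\<^sup>2)"
      by (simp add: power_mult_distrib)
  qed
  have "(grad_norm v)\<^sup>2 = (LINT x|lborel. (k * r)\<^sup>2 * (norm (wgrad u (r *\<^sub>R x)))\<^sup>2)"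
    unfolding grad_norm_square[OF wv] by (simp add: power_mult_distrib)
  also have "\<dots> = (k * r)\<^sup>2 * (1 / r ^ 3 * (grad_norm u)\<^sup>2)"
    using integral_scale(1)[of "\<lambda>x. (norm (wgrad u x))\<^sup>2" r] r grad_norm_square[OF w(1)] by simp
  also have "\<dots> = k\<^sup>2 / r * (grad_norm u)\<^sup>2"
    using r by (simp add: power2_eq_square power3_eq_cube)
  finally show "(grad_norm v)\<^sup>2 = k\<^sup>2 / r * (grad_norm u)\<^sup>2" .
  have "(L_norm 2 v)\<^sup>2 = (LINT x|lborel. k\<^sup>2 * (u (r *\<^sub>R x))\<^sup>2)"
    unfolding L_norm_2_square by (simp add: v_def power_mult_distrib)
  also have "\<dots> = k\<^sup>2 / r ^ 3 * (L_norm 2 u)\<^sup>2"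
    using integral_scale(1)[of "\<lambda>x. (u x)\<^sup>2" r] r by (simp add: L_norm_2_square)
  finally show "(L_norm 2 v)\<^sup>2 = k\<^sup>2 / r ^ 3 * (L_norm 2 u)\<^sup>2" .
  assume "q > 0"
  have "(LINT x|lborel. \<bar>v x\<bar> powr q) = (LINT x|lborel. \<bar>k\<bar> powr q * \<bar>u (r *\<^sub>R x)\<bar> powr q)"
    by (simp add: v_def abs_mult powr_mult)
  also have "\<dots> = \<bar>k\<bar> powr q / r ^ 3 * (LINT x|lborel. \<bar>u x\<bar> powr q)"
    using integral_scale(1)[of "\<lambda>x. \<bar>u x\<bar> powr q" r] r by simp
  finally show "L_norm q v powr q = \<bar>k\<bar> powr q / r ^ 3 * L_norm q u powr q"
    using \<open>q > 0\<close> by (simp add: L_norm_powr)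
qed

lemma W_scale:
  fixes u :: fn3 and k r :: real
  assumes u: "u \<in> W" and r: "r > 0" and k: "k > 0"
  defines "v \<equiv> (\<lambda>x. k * u (r *\<^sub>R x))"
  shows "v \<in> W" "log_int v = k\<^sup>2 / r ^ 3 * (ln (k\<^sup>2) * (L_norm 2 u)\<^sup>2 + log_int u)"
proof -
  have uH: "u \<in> H1" and l: "integrable lborel (\<lambda>x. (u x)\<^sup>2 * ln ((u x)\<^sup>2))" using u by (auto simp: W_iff)
  note w = H1_wgrad[OF uH]
  note [measurable] = w(3)
  have eq: "(v x)\<^sup>2 * ln ((v x)\<^sup>2) =
     (\<lambda>y. k\<^sup>2 * (ln (k\<^sup>2) * (u y)\<^sup>2 + (u y)\<^sup>2 * ln ((u y)\<^sup>2))) (r *\<^sub>R x)" for x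
    using k by (cases "u (r *\<^sub>R x) = 0") (auto simp: v_def power_mult_distrib ln_mult algebra_simps)
  have i: "integrable lborel (\<lambda>y. k\<^sup>2 * (ln (k\<^sup>2) * (u y)\<^sup>2 + (u y)\<^sup>2 * ln ((u y)\<^sup>2)))"
    using l w by (intro integrable_mult_right Bochner_Integration.integrable_add)
  have "integrable lborel (\<lambda>x. (v x)\<^sup>2 * ln ((v x)\<^sup>2))"
    unfolding eq using i r by (subst integral_scale(2)) auto
  then show "v \<in> W" using H1_scale(1)[OF uH r] by (auto simp: W_iff v_def)
  show "log_int v = k\<^sup>2 / r ^ 3 * (ln (k\<^sup>2) * (L_norm 2 u)\<^sup>2 + log_int u)"
    unfolding log_int_def eq using r l w
    by (subst integral_scale(1)) (auto simp: L_norm_2_square)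
qed

lemma S_iff: "c > 0 \<Longrightarrow> u \<in> S c \<longleftrightarrow> u \<in> W \<and> (L_norm 2 u)\<^sup>2 = c\<^sup>2"
  by (auto simp: S_def L_norm_nonneg)

lemma energy_eq:
  "energy a b p c u = a / 2 * (grad_norm u)\<^sup>2 + b / 4 * ((grad_norm u)\<^sup>2)\<^sup>2
     - 1 / p * L_norm p u powr p + c\<^sup>2 / 2 - log_int u / 2"
  by (simp add: energy_def log_int_def)

text \<open>The dilation \<open>dilate s\<close> preserves the mass and multiplies the remaining terms of the energy by
  exponentials, so the fibre map is an explicit function of \<open>s\<close>.\<close>

lemma fiber_eq:
  assumes u: "u \<in> S c" and p: "p > 0" and c: "c > 0"
  shows "fiber a b p c u s = a / 2 * (exp (2 * s) * (grad_norm u)\<^sup>2)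
     + b / 4 * (exp (4 * s) * ((grad_norm u)\<^sup>2)\<^sup>2)
     - 1 / p * (exp (3 * (p - 2) / 2 * s) * L_norm p u powr p) + c\<^sup>2 / 2 - (3 * s * c\<^sup>2 + log_int u) / 2"
    and "dilate s u \<in> S c"
    and "(grad_norm (dilate s u))\<^sup>2 = exp (2 * s) * (grad_norm u)\<^sup>2"
    and "L_norm p (dilate s u) powr p = exp (3 * (p - 2) / 2 * s) * L_norm p u powr p"
    and "log_int (dilate s u) = 3 * s * c\<^sup>2 + log_int u"
proof -
  have uW: "u \<in> W" and mass: "(L_norm 2 u)\<^sup>2 = c\<^sup>2" using u c by (auto simp: S_iff)
  then have uH: "u \<in> H1" by (simp add: W_iff)
  define k where "k = exp (3 * s / 2)"
  define r where "r = exp s"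
  have kr: "k > 0" "r > 0" by (auto simp: k_def r_def)
  have d: "dilate s u = (\<lambda>x. k * u (r *\<^sub>R x))" by (auto simp: dilate_def k_def r_def)
  have k2: "k\<^sup>2 = exp (3 * s)" by (simp add: k_def flip: exp_double)
  have r3: "r ^ 3 = exp (3 * s)" by (simp add: r_def flip: exp_of_nat_mult)
  have "k\<^sup>2 / r = exp (2 * s)" unfolding k2 r_def by (simp flip: exp_diff)
  then show g: "(grad_norm (dilate s u))\<^sup>2 = exp (2 * s) * (grad_norm u)\<^sup>2"
    unfolding d using H1_scale(2)[OF uH kr(2), of k] by simp
  have "\<bar>k\<bar> powr p / r ^ 3 = exp (3 * (p - 2) / 2 * s)"
    unfolding r3 using kr by (simp add: powr_def k_def field_simps flip: exp_diff)
  then show l: "L_norm p (dilate s u) powr p = exp (3 * (p - 2) / 2 * s) * L_norm p u powr p"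
    unfolding d using H1_scale(4)[OF uH kr(2) p, of k] by simp
  show g2: "log_int (dilate s u) = 3 * s * c\<^sup>2 + log_int u"
    unfolding d W_scale(2)[OF uW kr(2,1)] unfolding r3 k2 mass by simp
  show "dilate s u \<in> S c"
    using H1_scale(3)[OF uH kr(2), of k] W_scale(1)[OF uW kr(2,1)] c
    unfolding d r3 k2 mass by (simp add: S_iff)
  have "exp (4 * s) = (exp (2 * s))\<^sup>2" by (simp flip: exp_double)
  then show "fiber a b p c u s = a / 2 * (exp (2 * s) * (grad_norm u)\<^sup>2)
     + b / 4 * (exp (4 * s) * ((grad_norm u)\<^sup>2)\<^sup>2)
     - 1 / p * (exp (3 * (p - 2) / 2 * s) * L_norm p u powr p) + c\<^sup>2 / 2 - (3 * s * c\<^sup>2 + log_int u) / 2"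
    unfolding fiber_def energy_eq g l g2 by (simp add: power_mult_distrib)
qed

lemma fiber_derivs:
  assumes u: "u \<in> S c" and p: "p > 0" and c: "c > 0"
  defines "A \<equiv> (grad_norm u)\<^sup>2" and "B \<equiv> L_norm p u powr p" and "q \<equiv> 3 * (p - 2) / 2"
  shows "(fiber a b p c u has_real_derivative a * (exp (2 * s) * A) + b * (exp (4 * s) * A\<^sup>2)
     - q / p * (exp (q * s) * B) - 3 / 2 * c\<^sup>2) (at s)"
    and "(deriv (fiber a b p c u) has_real_derivative 2 * a * (exp (2 * s) * A) + 4 * b * (exp (4 * s) * A\<^sup>2)
     - q\<^sup>2 / p * (exp (q * s) * B)) (at s)"
proof -
  have f: "fiber a b p c u = (\<lambda>s. a / 2 * (exp (2 * s) * A) + b / 4 * (exp (4 * s) * A\<^sup>2)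
     - 1 / p * (exp (q * s) * B) + c\<^sup>2 / 2 - (3 * s * c\<^sup>2 + log_int u) / 2)"
    unfolding A_def B_def q_def by (rule ext) (rule fiber_eq(1)[OF u p c])
  have 1: "(fiber a b p c u has_real_derivative a * (exp (2 * s) * A) + b * (exp (4 * s) * A\<^sup>2)
     - q / p * (exp (q * s) * B) - 3 / 2 * c\<^sup>2) (at s)" for s
    unfolding f using p by (auto intro!: derivative_eq_intros simp: field_simps)
  then show "(fiber a b p c u has_real_derivative a * (exp (2 * s) * A) + b * (exp (4 * s) * A\<^sup>2)
     - q / p * (exp (q * s) * B) - 3 / 2 * c\<^sup>2) (at s)" .
  have d: "deriv (fiber a b p c u) = (\<lambda>s. a * (exp (2 * s) * A) + b * (exp (4 * s) * A\<^sup>2)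
     - q / p * (exp (q * s) * B) - 3 / 2 * c\<^sup>2)"
    using 1 by (auto intro: DERIV_imp_deriv)
  show "(deriv (fiber a b p c u) has_real_derivative 2 * a * (exp (2 * s) * A) + 4 * b * (exp (4 * s) * A\<^sup>2)
     - q\<^sup>2 / p * (exp (q * s) * B)) (at s)"
    unfolding d using p by (auto intro!: derivative_eq_intros simp: field_simps power2_eq_square)
qed

text \<open>Membership in \<open>\<Lambda>\<close> and \<open>\<Lambda>\<^sup>\<plusminus>\<close> in terms of the norms; here \<open>q = p \<gamma>\<^sub>p\<close>.\<close>

lemma Lambda_iff:
  assumes p: "p > 0" and c: "c > 0"
  defines "q \<equiv> 3 * (p - 2) / 2"
  shows "u \<in> Lambda a b p c \<longleftrightarrow> u \<in> S c \<and>
     a * (grad_norm u)\<^sup>2 + b * ((grad_norm u)\<^sup>2)\<^sup>2 - q / p * L_norm p u powr p - 3 / 2 * c\<^sup>2 = 0"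
    and "u \<in> Lambda_plus a b p c \<longleftrightarrow> u \<in> Lambda a b p c \<and>
     2 * a * (grad_norm u)\<^sup>2 + 4 * b * ((grad_norm u)\<^sup>2)\<^sup>2 - q\<^sup>2 / p * L_norm p u powr p > 0"
    and "u \<in> Lambda_minus a b p c \<longleftrightarrow> u \<in> Lambda a b p c \<and>
     2 * a * (grad_norm u)\<^sup>2 + 4 * b * ((grad_norm u)\<^sup>2)\<^sup>2 - q\<^sup>2 / p * L_norm p u powr p < 0"
proof -
  have *: "(fiber a b p c u has_real_derivative a * (grad_norm u)\<^sup>2 + b * ((grad_norm u)\<^sup>2)\<^sup>2
      - q / p * L_norm p u powr p - 3 / 2 * c\<^sup>2) (at 0)"
    "(deriv (fiber a b p c u) has_real_derivative 2 * a * (grad_norm u)\<^sup>2 + 4 * b * ((grad_norm u)\<^sup>2)\<^sup>2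
      - q\<^sup>2 / p * L_norm p u powr p) (at 0)" if "u \<in> S c"
    using fiber_derivs[OF that p c, where s=0 and a=a and b=b] by (simp_all add: q_def)
  show Lam: "u \<in> Lambda a b p c \<longleftrightarrow> u \<in> S c \<and>
     a * (grad_norm u)\<^sup>2 + b * ((grad_norm u)\<^sup>2)\<^sup>2 - q / p * L_norm p u powr p - 3 / 2 * c\<^sup>2 = 0"
  proof (intro iffI conjI)
    assume u: "u \<in> Lambda a b p c"
    then show "u \<in> S c" by (simp add: Lambda_def)
    from u have "(fiber a b p c u has_real_derivative 0) (at 0)" by (simp add: Lambda_def)
    from DERIV_unique[OF *(1)[OF \<open>u \<in> S c\<close>] this]
    show "a * (grad_norm u)\<^sup>2 + b * ((grad_norm u)\<^sup>2)\<^sup>2 - q / p * L_norm p u powr p - 3 / 2 * c\<^sup>2 = 0" .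
  next
    assume "u \<in> S c \<and> a * (grad_norm u)\<^sup>2 + b * ((grad_norm u)\<^sup>2)\<^sup>2 - q / p * L_norm p u powr p - 3 / 2 * c\<^sup>2 = 0"
    then show "u \<in> Lambda a b p c" using *(1) by (simp only: Lambda_def mem_Collect_eq)
  qed
  show "u \<in> Lambda_plus a b p c \<longleftrightarrow> u \<in> Lambda a b p c \<and>
     2 * a * (grad_norm u)\<^sup>2 + 4 * b * ((grad_norm u)\<^sup>2)\<^sup>2 - q\<^sup>2 / p * L_norm p u powr p > 0"
    "u \<in> Lambda_minus a b p c \<longleftrightarrow> u \<in> Lambda a b p c \<and>
     2 * a * (grad_norm u)\<^sup>2 + 4 * b * ((grad_norm u)\<^sup>2)\<^sup>2 - q\<^sup>2 / p * L_norm p u powr p < 0"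
    using Lam DERIV_imp_deriv[OF *(2)] by (auto simp only: Lambda_plus_def Lambda_minus_def mem_Collect_eq)
qed

section \<open>Integration in coordinates\<close>

text \<open>The point with \<open>i\<close>-th coordinate \<open>t\<close>, \<open>j\<close>-th coordinate \<open>y\<close> and third remaining coordinate \<open>z\<close>; for
  distinct \<open>i\<close>, \<open>j\<close>, \<open>k\<close> this identifies a product of three lines with the space, in any order of
  integration.\<close>

definition coords :: "3 \<Rightarrow> 3 \<Rightarrow> 3 \<Rightarrow> real \<times> real \<times> real \<Rightarrow> real^3" where
  "coords i j k = (\<lambda>(t, y, z). \<chi> l. if l = i then t else if l = j then y else z)"

lemma distinct_3_UNIV:
  assumes "distinct [i, j, k :: 3]"
  shows "UNIV = {i, j, k}"
  using assms exhaust_3 by (auto simp: UNIV_3) metis+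

lemma prod_3: "(\<Prod>i\<in>UNIV. g i) = g 1 * (g 2 * g (3 :: 3))" for g :: "3 \<Rightarrow> 'a::comm_monoid_mult"
  unfolding UNIV_3 by simp

lemma measurable_coords[measurable]: "coords i j k \<in> borel_measurable borel"
  unfolding coords_def case_prod_beta
proof (intro borel_measurable_continuous_onI continuous_on_vec_lambda)
  fix l
  show "continuous_on UNIV (\<lambda>p :: real \<times> real \<times> real. if l = i then fst p else if l = j then fst (snd p) else snd (snd p))"
    by (cases "l = i"; cases "l = j") (auto intro!: continuous_intros)
qed

lemma measurable_coords_comp[measurable (raw)]:
  assumes "f \<in> borel_measurable M" "g \<in> borel_measurable M" "h \<in> borel_measurable M"
  shows "(\<lambda>w. coords i j k (f w, g w, h w)) \<in> borel_measurable M"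
proof -
  have "(\<lambda>w. (f w, g w, h w)) \<in> borel_measurable M"
    using assms by (auto simp flip: borel_prod)
  from measurable_compose[OF this measurable_coords] show ?thesis .
qed

lemma measurable_fst_borel[measurable]: "fst \<in> borel_measurable (borel :: ('a::topological_space \<times> 'b::topological_space) measure)"
  and measurable_snd_borel[measurable]: "snd \<in> borel_measurable (borel :: ('a \<times> 'b) measure)"
  by (intro borel_measurable_continuous_onI continuous_intros)+

lemma lborel_coords:
  assumes ijk: "distinct [i, j, k]"
  shows "(lborel :: (real^3) measure) = distr lborel borel (coords i j k)"
proof (rule lborel_eqI)
  fix l u :: "real^3" assume lu: "\<And>b. b \<in> Basis \<Longrightarrow> l \<bullet> b \<le> u \<bullet> b"
  have le: "l $ m \<le> u $ m" for m
    using lu[of "axis m 1"] by (auto simp: inner_axis Basis_vec_def)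
  have vim: "coords i j k -` box l u = {l $ i<..<u $ i} \<times> {l $ j<..<u $ j} \<times> {l $ k<..<u $ k}"
  proof -
    have "(\<forall>m. Q m) \<longleftrightarrow> Q i \<and> Q j \<and> Q k" for Q
      using distinct_3_UNIV[OF ijk] by (metis UNIV_I empty_iff insert_iff)
    note this[of "\<lambda>m. l $ m < coords i j k x $ m \<and> coords i j k x $ m < u $ m" for x]
    then have "coords i j k x \<in> box l u \<longleftrightarrow> (\<forall>m\<in>{i, j, k}. l $ m < coords i j k x $ m \<and> coords i j k x $ m < u $ m)" for x
      unfolding mem_box_cart by blast
    then show ?thesis using ijk by (auto simp: coords_def)
  qed
  have "emeasure (distr lborel borel (coords i j k)) (box l u) =
     emeasure lborel ({l $ i<..<u $ i} \<times> {l $ j<..<u $ j} \<times> {l $ k<..<u $ k})"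
    by (subst emeasure_distr) (auto simp: vim)
  also have "\<dots> = ennreal ((u $ i - l $ i) * ((u $ j - l $ j) * (u $ k - l $ k)))"
  proof -
    have times: "emeasure lborel (A \<times> B) = emeasure lborel A * emeasure lborel B"
      if "A \<in> sets borel" "B \<in> sets borel" for A :: "'b::euclidean_space set" and B :: "'c::euclidean_space set"
      using lborel.emeasure_pair_measure_Times[of A lborel B] that by (simp add: lborel_prod)
    have "{l $ j<..<u $ j} \<times> {l $ k<..<u $ k} \<in> sets borel"
      by (intro borel_open open_Times) auto
    then show ?thesis using le by (simp add: times ennreal_mult)
  qed
  also have "(u $ i - l $ i) * ((u $ j - l $ j) * (u $ k - l $ k)) = (\<Prod>m\<in>UNIV. u $ m - l $ m)"
    using ijk unfolding distinct_3_UNIV[OF ijk] by simp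
  also have "\<dots> = (\<Prod>b\<in>Basis. (u - l) \<bullet> b)"
  proof -
    have B: "(Basis :: (real^3) set) = (\<lambda>m. axis m 1) ` UNIV" by (auto simp: Basis_vec_def)
    show ?thesis unfolding B
      by (subst prod.reindex) (auto simp: inj_on_def axis_eq_axis inner_axis inner_diff_left)
  qed
  finally show "emeasure (distr lborel borel (coords i j k)) (box l u) = (\<Prod>b\<in>Basis. (u - l) \<bullet> b)" .
qed simp

lemma nn_integral_coords:
  fixes f :: "real^3 \<Rightarrow> ennreal"
  assumes ijk: "distinct [i, j, k]" and [measurable]: "f \<in> borel_measurable borel"
  shows "(\<integral>\<^sup>+x. f x \<partial>lborel) = (\<integral>\<^sup>+t. \<integral>\<^sup>+y. \<integral>\<^sup>+z. f (coords i j k (t, y, z)) \<partial>lborel \<partial>lborel \<partial>lborel)"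
proof -
  have "(\<integral>\<^sup>+x. f x \<partial>lborel) = (\<integral>\<^sup>+x. f x \<partial>distr lborel borel (coords i j k))"
    using lborel_coords[OF ijk] by simp
  also have "\<dots> = (\<integral>\<^sup>+p. f (coords i j k p) \<partial>(lborel \<Otimes>\<^sub>M lborel))"
    by (simp add: nn_integral_distr lborel_prod)
  also have "\<dots> = (\<integral>\<^sup>+t. \<integral>\<^sup>+q. f (coords i j k (t, q)) \<partial>lborel \<partial>lborel)"
    by (rule lborel.nn_integral_fst[symmetric]) (simp add: lborel_prod)
  also have "\<dots> = (\<integral>\<^sup>+t. \<integral>\<^sup>+q. f (coords i j k (t, q)) \<partial>(lborel \<Otimes>\<^sub>M lborel) \<partial>lborel)"
    by (simp add: lborel_prod)
  also have "\<dots> = (\<integral>\<^sup>+t. \<integral>\<^sup>+y. \<integral>\<^sup>+z. f (coords i j k (t, y, z)) \<partial>lborel \<partial>lborel \<partial>lborel)"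
    by (rule nn_integral_cong, rule lborel.nn_integral_fst[symmetric]) (simp add: lborel_prod)
  finally show ?thesis .
qed

lemma integral_coords:
  fixes f :: "real^3 \<Rightarrow> real"
  assumes ijk: "distinct [i, j, k]" and f: "integrable lborel f"
  shows "(LINT x|lborel. f x) = (LINT q|lborel. LINT t|lborel. f (coords i j k (t, q)))"
    and "AE q in lborel. integrable lborel (\<lambda>t. f (coords i j k (t, q)))"
    and "integrable lborel (\<lambda>q. LINT t|lborel. f (coords i j k (t, q)))"
proof -
  have [measurable]: "f \<in> borel_measurable borel" using f by simp
  have "integrable (distr lborel borel (coords i j k)) f" using lborel_coords[OF ijk] f by simp
  then have "integrable lborel (\<lambda>p. f (coords i j k p))"
    by (subst (asm) integrable_distr_eq) simp_all
  then have int: "integrable (lborel \<Otimes>\<^sub>M lborel) (\<lambda>(t, q). f (coords i j k (t, q)))"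
    unfolding lborel_prod case_prod_unfold prod.collapse .
  have "(LINT x|lborel. f x) = (LINT x|distr lborel borel (coords i j k). f x)"
    using lborel_coords[OF ijk] by simp
  also have "\<dots> = (LINT p|(lborel \<Otimes>\<^sub>M lborel). f (coords i j k p))"
    by (subst integral_distr) (auto simp: lborel_prod)
  also have "\<dots> = (LINT q|lborel. LINT t|lborel. f (coords i j k (t, q)))"
    using lborel_pair.integral_snd[OF int] by (simp add: case_prod_unfold)
  finally show "(LINT x|lborel. f x) = (LINT q|lborel. LINT t|lborel. f (coords i j k (t, q)))" .
  show "AE q in lborel. integrable lborel (\<lambda>t. f (coords i j k (t, q)))"
    using lborel_pair.AE_integrable_snd[OF int] .
  show "integrable lborel (\<lambda>q. LINT t|lborel. f (coords i j k (t, q)))"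
    using lborel_pair.integrable_snd[OF int] .
qed

section \<open>The Loomis-Whitney inequality\<close>

text \<open>The Loomis-Whitney inequality for functions of two of the three variables, by two applications of the
  Cauchy-Schwarz inequality.\<close>

lemma loomis_whitney_aux:
  fixes p q r :: "real \<times> real \<Rightarrow> ennreal"
  assumes [measurable]: "p \<in> borel_measurable borel" "q \<in> borel_measurable borel" "r \<in> borel_measurable borel"
  shows "(\<integral>\<^sup>+y. \<integral>\<^sup>+z. \<integral>\<^sup>+x. p (y, z) * (q (x, z) * r (x, y)) \<partial>lborel \<partial>lborel \<partial>lborel)\<^sup>2 \<le>
    (\<integral>\<^sup>+y. \<integral>\<^sup>+z. (p (y, z))\<^sup>2 \<partial>lborel \<partial>lborel) *
    ((\<integral>\<^sup>+z. \<integral>\<^sup>+x. (q (x, z))\<^sup>2 \<partial>lborel \<partial>lborel) * (\<integral>\<^sup>+y. \<integral>\<^sup>+x. (r (x, y))\<^sup>2 \<partial>lborel \<partial>lborel))"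
proof -
  define T where "T = (\<lambda>(y, z). \<integral>\<^sup>+x. q (x, z) * r (x, y) \<partial>lborel)"
  define Q where "Q = (\<lambda>z. \<integral>\<^sup>+x. (q (x, z))\<^sup>2 \<partial>lborel)"
  define R where "R = (\<lambda>y. \<integral>\<^sup>+x. (r (x, y))\<^sup>2 \<partial>lborel)"
  have [measurable]: "T \<in> borel_measurable borel" "Q \<in> borel_measurable borel" "R \<in> borel_measurable borel"
    unfolding T_def Q_def R_def by (simp_all flip: borel_prod) measurable
  have "(\<integral>\<^sup>+y. \<integral>\<^sup>+z. \<integral>\<^sup>+x. p (y, z) * (q (x, z) * r (x, y)) \<partial>lborel \<partial>lborel \<partial>lborel) =
     (\<integral>\<^sup>+y. \<integral>\<^sup>+z. p (y, z) * T (y, z) \<partial>lborel \<partial>lborel)"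
    unfolding T_def by (simp add: nn_integral_cmult)
  also have "\<dots> = (\<integral>\<^sup>+w. p w * T w \<partial>(lborel \<Otimes>\<^sub>M lborel))"
    by (subst lborel.nn_integral_fst[symmetric]) (simp_all add: lborel_prod)
  also have "\<dots>\<^sup>2 \<le> (\<integral>\<^sup>+w. (p w)\<^sup>2 \<partial>(lborel \<Otimes>\<^sub>M lborel)) * (\<integral>\<^sup>+w. (T w)\<^sup>2 \<partial>(lborel \<Otimes>\<^sub>M lborel))"
    by (rule Cauchy_Schwarz_nn_integral) (simp_all add: lborel_prod)
  also have "(\<integral>\<^sup>+w. (p w)\<^sup>2 \<partial>(lborel \<Otimes>\<^sub>M lborel)) = (\<integral>\<^sup>+y. \<integral>\<^sup>+z. (p (y, z))\<^sup>2 \<partial>lborel \<partial>lborel)"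
    by (subst lborel.nn_integral_fst[symmetric]) (simp_all add: lborel_prod)
  also have "(\<integral>\<^sup>+w. (T w)\<^sup>2 \<partial>(lborel \<Otimes>\<^sub>M lborel)) = (\<integral>\<^sup>+y. \<integral>\<^sup>+z. (T (y, z))\<^sup>2 \<partial>lborel \<partial>lborel)"
    by (subst lborel.nn_integral_fst[symmetric]) (simp_all add: lborel_prod)
  also have "\<dots> \<le> (\<integral>\<^sup>+y. \<integral>\<^sup>+z. Q z * R y \<partial>lborel \<partial>lborel)"
    unfolding T_def Q_def R_def prod.case
    by (intro nn_integral_mono Cauchy_Schwarz_nn_integral) simp_all
  also have "\<dots> = (\<integral>\<^sup>+z. Q z \<partial>lborel) * (\<integral>\<^sup>+y. R y \<partial>lborel)"
    by (simp add: nn_integral_multc nn_integral_cmult)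
  finally show ?thesis unfolding Q_def R_def by (simp add: mult_left_mono)
qed

text \<open>A square root on the extended nonnegative reals.\<close>

definition ennsqrt :: "ennreal \<Rightarrow> ennreal" where
  "ennsqrt x = (if x = \<infinity> then \<infinity> else ennreal (sqrt (enn2real x)))"

lemma ennsqrt_square: "(ennsqrt x)\<^sup>2 = x"
  by (cases x) (auto simp: ennsqrt_def ennreal_power top_power_ennreal)

lemma ennsqrt_measurable[measurable]: "ennsqrt \<in> borel_measurable borel"
  unfolding ennsqrt_def by measurable

lemma le_ennsqrt: "x \<ge> 0 \<Longrightarrow> ennreal (x\<^sup>2) \<le> y \<Longrightarrow> ennreal x \<le> ennsqrt y"
  by (cases y) (auto simp: ennsqrt_def real_le_rsqrt)

text \<open>The point \<open>x\<close> with its \<open>i\<close>-th coordinate replaced by \<open>t\<close>.\<close>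

definition upd :: "real^3 \<Rightarrow> 3 \<Rightarrow> real \<Rightarrow> real^3" where
  "upd x i t = (\<chi> l. if l = i then t else x $ l)"

lemma measurable_upd[measurable (raw)]:
  assumes "f \<in> borel_measurable M" "g \<in> borel_measurable M"
  shows "(\<lambda>w. upd (f w) i (g w)) \<in> borel_measurable M"
proof -
  have "(\<lambda>(x, t). upd x i t) \<in> borel_measurable borel"
    unfolding upd_def case_prod_beta
  proof (intro borel_measurable_continuous_onI continuous_on_vec_lambda)
    fix l
    show "continuous_on UNIV (\<lambda>p :: (real^3) \<times> real. if l = i then snd p else fst p $ l)"
      by (cases "l = i") (auto intro!: continuous_intros)
  qed
  then have "(\<lambda>(x, t). upd x i t) \<in> borel_measurable (borel \<Otimes>\<^sub>M borel)" by (simp add: borel_prod)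
  from measurable_compose[OF measurable_Pair[OF assms] this] show ?thesis by simp
qed

text \<open>The form in which the Loomis-Whitney inequality enters: the bound for \<open>\<theta>\<close> in direction \<open>i\<close>
  does not depend on the \<open>i\<close>-th coordinate.\<close>

lemma loomis_whitney:
  fixes \<theta> :: "real^3 \<Rightarrow> real" and f :: "3 \<Rightarrow> real^3 \<Rightarrow> ennreal"
  assumes [measurable]: "\<theta> \<in> borel_measurable borel" "\<And>i. f i \<in> borel_measurable borel"
    and nonneg: "\<And>x. \<theta> x \<ge> 0"
    and bound: "\<And>i. AE x in lborel. ennreal ((\<theta> x)\<^sup>2) \<le> (\<integral>\<^sup>+t. f i (upd x i t) \<partial>lborel)"
  shows "(\<integral>\<^sup>+x. ennreal (\<theta> x ^ 3) \<partial>lborel)\<^sup>2 \<le> (\<Prod>i\<in>UNIV. \<integral>\<^sup>+x. f i x \<partial>lborel)"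
proof -
  define P where "P i x = ennsqrt (\<integral>\<^sup>+t. f i (upd x i t) \<partial>lborel)" for i x
  have [measurable]: "P i \<in> borel_measurable borel" for i unfolding P_def by measurable
  define p where "p = (\<lambda>(y, z). P 1 (coords 2 3 1 (y, z, 0)))"
  define q where "q = (\<lambda>(x, z). P 2 (coords 2 3 1 (0, z, x)))"
  define r where "r = (\<lambda>(x, y). P 3 (coords 2 3 1 (y, 0, x)))"
  have pqr[measurable]: "p \<in> borel_measurable borel" "q \<in> borel_measurable borel" "r \<in> borel_measurable borel"
    unfolding p_def q_def r_def case_prod_beta by measurable
  have upd_eq: "upd (coords 2 3 1 (y, z, x)) 1 t = coords 2 3 1 (y, z, t)"
     "upd (coords 2 3 1 (y, z, x)) 2 t = coords 3 1 2 (z, x, t)"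
     "upd (coords 2 3 1 (y, z, x)) 3 t = coords 2 1 3 (y, x, t)" for x y z t
    by (auto simp: upd_def coords_def vec_eq_iff forall_3)
  have P_eq: "P 1 (coords 2 3 1 (y, z, x)) = p (y, z)" "P 2 (coords 2 3 1 (y, z, x)) = q (x, z)"
     "P 3 (coords 2 3 1 (y, z, x)) = r (x, y)" for x y z
    by (simp_all add: P_def p_def q_def r_def upd_eq)
  have "AE x in lborel. \<forall>i. ennreal ((\<theta> x)\<^sup>2) \<le> (\<integral>\<^sup>+t. f i (upd x i t) \<partial>lborel)"
    using bound by (subst AE_all_countable) auto
  then have le: "AE x in lborel. ennreal (\<theta> x ^ 3) \<le> P 1 x * (P 2 x * P 3 x)"
  proof eventually_elim
    case (elim x)
    then have "ennreal (\<theta> x) \<le> P i x" for i unfolding P_def by (intro le_ennsqrt nonneg) blast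
    then have "ennreal (\<theta> x) * (ennreal (\<theta> x) * ennreal (\<theta> x)) \<le> P 1 x * (P 2 x * P 3 x)"
      by (intro mult_mono) auto
    then show ?case using nonneg by (simp add: power3_eq_cube mult.assoc flip: ennreal_mult)
  qed
  have "(\<integral>\<^sup>+x. ennreal (\<theta> x ^ 3) \<partial>lborel) \<le> (\<integral>\<^sup>+x. P 1 x * (P 2 x * P 3 x) \<partial>lborel)"
    by (rule nn_integral_mono_AE[OF le])
  also have "\<dots> = (\<integral>\<^sup>+y. \<integral>\<^sup>+z. \<integral>\<^sup>+x. p (y, z) * (q (x, z) * r (x, y)) \<partial>lborel \<partial>lborel \<partial>lborel)"
    by (subst nn_integral_coords[of 2 3 1]) (simp_all add: P_eq)
  finally have "(\<integral>\<^sup>+x. ennreal (\<theta> x ^ 3) \<partial>lborel)\<^sup>2 \<le>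
     (\<integral>\<^sup>+y. \<integral>\<^sup>+z. \<integral>\<^sup>+x. p (y, z) * (q (x, z) * r (x, y)) \<partial>lborel \<partial>lborel \<partial>lborel)\<^sup>2"
    by (intro power_mono) auto
  also note loomis_whitney_aux[OF pqr]
  also have "(\<integral>\<^sup>+y. \<integral>\<^sup>+z. (p (y, z))\<^sup>2 \<partial>lborel \<partial>lborel) = (\<integral>\<^sup>+x. f 1 x \<partial>lborel)"
    by (subst nn_integral_coords[of 2 3 1]) (simp_all add: p_def P_def ennsqrt_square upd_eq)
  also have "(\<integral>\<^sup>+z. \<integral>\<^sup>+x. (q (x, z))\<^sup>2 \<partial>lborel \<partial>lborel) = (\<integral>\<^sup>+z. \<integral>\<^sup>+x. \<integral>\<^sup>+t. f 2 (coords 3 1 2 (z, x, t)) \<partial>lborel \<partial>lborel \<partial>lborel)"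
    by (intro nn_integral_cong) (simp add: q_def P_def ennsqrt_square upd_eq)
  also have "\<dots> = (\<integral>\<^sup>+x. f 2 x \<partial>lborel)"
    by (subst nn_integral_coords[of 3 1 2]) simp_all
  also have "(\<integral>\<^sup>+y. \<integral>\<^sup>+x. (r (x, y))\<^sup>2 \<partial>lborel \<partial>lborel) = (\<integral>\<^sup>+y. \<integral>\<^sup>+x. \<integral>\<^sup>+t. f 3 (coords 2 1 3 (y, x, t)) \<partial>lborel \<partial>lborel \<partial>lborel)"
    by (intro nn_integral_cong) (simp add: r_def P_def ennsqrt_square upd_eq)
  also have "\<dots> = (\<integral>\<^sup>+x. f 3 x \<partial>lborel)"
    by (subst nn_integral_coords[of 2 1 3]) simp_all
  finally show ?thesis by (simp only: prod_3)
qed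

section \<open>A chain rule inequality on the line\<close>

text \<open>The primitive of \<open>g\<close> that vanishes at \<open>-\<infinity>\<close>.\<close>

definition prim1 :: "(real \<Rightarrow> real) \<Rightarrow> real \<Rightarrow> real" where
  "prim1 g t = (LINT s|lborel. indicator {..<t} s * g s)"

lemma prim1_integrable:
  fixes g :: "real \<Rightarrow> real"
  assumes "integrable lborel g"
  shows "integrable lborel (\<lambda>s. indicator {..<t} s * g s)"
  using integrable_mult_indicator[of "{..<t}" lborel g] assms by simp

lemma prim1_diff:
  assumes g: "integrable lborel g" and "x \<le> y"
  shows "prim1 g y - prim1 g x = (LINT s|lborel. indicator {x..<y} s * g s)"
  unfolding prim1_def using assms
  by (subst Bochner_Integration.integral_diff[symmetric])
     (auto intro!: prim1_integrable Bochner_Integration.integral_cong split: split_indicator)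

lemma prim1_isCont:
  assumes g: "integrable lborel g"
  shows "isCont (prim1 g) t"
  unfolding continuous_at_sequentially comp_def
proof (intro allI impI)
  fix X assume X: "X \<longlonglongrightarrow> t"
  have [measurable]: "g \<in> borel_measurable borel" using g by simp
  show "(\<lambda>n. prim1 g (X n)) \<longlonglongrightarrow> prim1 g t"
    unfolding prim1_def
  proof (rule integral_dominated_convergence[where w="\<lambda>s. norm (g s)"])
    show "AE s in lborel. (\<lambda>n. indicator {..<X n} s * g s) \<longlonglongrightarrow> indicator {..<t} s * g s"
      using AE_lborel_singleton[of t]
    proof eventually_elim
      case (elim s)
      have "\<forall>\<^sub>F n in sequentially. indicator {..<X n} s = (indicator {..<t} s :: real)"
      proof (cases "s < t")
        case True
        then have "\<forall>\<^sub>F n in sequentially. s < X n" using X by (intro order_tendstoD)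
        then show ?thesis by eventually_elim (use True in auto)
      next
        case False
        then have "t < s" using elim by simp
        then have "\<forall>\<^sub>F n in sequentially. X n < s" using X by (intro order_tendstoD)
        then show ?thesis by eventually_elim (use False in auto)
      qed
      then have "(\<lambda>n. indicator {..<X n} s) \<longlonglongrightarrow> (indicator {..<t} s :: real)"
        by (rule tendsto_eventually)
      then show ?case by (intro tendsto_intros)
    qed
    show "AE s in lborel. norm (indicator {..<X n} s * g s) \<le> norm (g s)" for n
      by (auto intro!: AE_I2 split: split_indicator)
  qed (use g in auto)
qed

lemma prim1_at_bot:
  assumes g: "integrable lborel g"
  shows "(\<lambda>n. prim1 g (- real n)) \<longlonglongrightarrow> 0"
proof -
  have [measurable]: "g \<in> borel_measurable borel" using g by simp
  have "(\<lambda>n. prim1 g (- real n)) \<longlonglongrightarrow> (LINT s|lborel. 0 * g s)"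
    unfolding prim1_def
  proof (rule integral_dominated_convergence[where w="\<lambda>s. norm (g s)"])
    show "AE s in lborel. (\<lambda>n. indicator {..<- real n} s * g s) \<longlonglongrightarrow> 0 * g s"
    proof (rule AE_I2)
      fix s :: real
      obtain N where N: "real N > - s" using reals_Archimedean2 by blast
      have "indicator {..<- real n} s * g s = 0" if "n \<ge> N" for n
      proof -
        have "real n \<ge> real N" using that by simp
        then have "\<not> s < - real n" using N by linarith
        then show ?thesis by simp
      qed
      then show "(\<lambda>n. indicator {..<- real n} s * g s) \<longlonglongrightarrow> 0 * g s"
        unfolding mult_zero_left by (intro tendsto_eventually eventually_sequentiallyI)
    qed
    show "AE s in lborel. norm (indicator {..<- real n} s * g s) \<le> norm (g s)" for n
      by (auto intro!: AE_I2 split: split_indicator)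
  qed (use g in auto)
  then show ?thesis by simp
qed

lemma prim1_measurable[measurable]: "integrable lborel g \<Longrightarrow> prim1 g \<in> borel_measurable borel"
  using prim1_isCont by (intro borel_measurable_continuous_onI) (simp add: continuous_at_imp_continuous_on)

text \<open>A chain rule inequality for the absolutely continuous function \<open>prim1 g\<close>. The estimate is additive over
  adjacent intervals, and near a point it follows from the mean value theorem and the continuity of
  \<open>h'\<close>; the \<open>\<epsilon>\<close> absorbs the oscillation of \<open>h'\<close>. Bisection turns this into the estimate on a whole
  interval.\<close>

lemma chain_bound_interval:
  fixes h h' :: "real \<Rightarrow> real"
  assumes g: "integrable lborel g" and h: "\<And>y. (h has_real_derivative h' y) (at y)"
    and h': "continuous_on UNIV h'" and "x \<le> y" and \<epsilon>: "\<epsilon> > 0"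
  shows "ennreal \<bar>h (prim1 g y) - h (prim1 g x)\<bar> \<le>
     (\<integral>\<^sup>+s. indicator {x..<y} s * ennreal ((\<bar>h' (prim1 g s)\<bar> + \<epsilon>) * \<bar>g s\<bar>) \<partial>lborel)"
  using \<open>x \<le> y\<close>
proof (induction rule: Bolzano)
  have [measurable]: "g \<in> borel_measurable borel" "h' \<in> borel_measurable borel"
    using g h' by (auto intro: borel_measurable_continuous_onI)
  have [measurable]: "prim1 g \<in> borel_measurable borel" using g by measurable
  case (trans a b c)
  have "ennreal \<bar>h (prim1 g c) - h (prim1 g a)\<bar> \<le>
     ennreal \<bar>h (prim1 g b) - h (prim1 g a)\<bar> + ennreal \<bar>h (prim1 g c) - h (prim1 g b)\<bar>"
    by (subst ennreal_plus[symmetric]; (intro ennreal_leI)?; linarith)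
  also have "\<dots> \<le> (\<integral>\<^sup>+s. indicator {a..<b} s * ennreal ((\<bar>h' (prim1 g s)\<bar> + \<epsilon>) * \<bar>g s\<bar>) \<partial>lborel) +
     (\<integral>\<^sup>+s. indicator {b..<c} s * ennreal ((\<bar>h' (prim1 g s)\<bar> + \<epsilon>) * \<bar>g s\<bar>) \<partial>lborel)"
    by (intro add_mono trans)
  also have "\<dots> = (\<integral>\<^sup>+s. indicator {a..<b} s * ennreal ((\<bar>h' (prim1 g s)\<bar> + \<epsilon>) * \<bar>g s\<bar>) +
     indicator {b..<c} s * ennreal ((\<bar>h' (prim1 g s)\<bar> + \<epsilon>) * \<bar>g s\<bar>) \<partial>lborel)"
    by (rule nn_integral_add[symmetric]) auto
  also have "\<dots> = (\<integral>\<^sup>+s. indicator {a..<c} s * ennreal ((\<bar>h' (prim1 g s)\<bar> + \<epsilon>) * \<bar>g s\<bar>) \<partial>lborel)"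
    using trans(3,4) by (intro nn_integral_cong) (auto split: split_indicator)
  finally show ?case .
next
  case (local x)
  have [measurable]: "g \<in> borel_measurable borel" "h' \<in> borel_measurable borel"
    using g h' by (auto intro: borel_measurable_continuous_onI)
  have [measurable]: "prim1 g \<in> borel_measurable borel" using g by measurable
  let ?F = "prim1 g"
  have "isCont h' (?F x)" using h' by (simp add: continuous_on_eq_continuous_at)
  then obtain e where e: "e > 0" "\<And>z. \<bar>z - ?F x\<bar> < e \<Longrightarrow> \<bar>h' z - h' (?F x)\<bar> < \<epsilon> / 2"
    using \<epsilon> unfolding continuous_at_eps_delta dist_real_def by (meson half_gt_zero)
  obtain d where d: "d > 0" "\<And>s. \<bar>s - x\<bar> < d \<Longrightarrow> \<bar>?F s - ?F x\<bar> < e"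
    using prim1_isCont[OF g, of x] e(1) unfolding continuous_at_eps_delta dist_real_def by meson
  define C where "C = \<bar>h' (?F x)\<bar> + \<epsilon> / 2"
  have C: "C \<ge> 0" using \<epsilon> by (simp add: C_def)
  show ?case
  proof (intro exI[of _ d] conjI allI impI d(1))
    fix a b assume ab: "a \<le> x \<and> x \<le> b \<and> b - a < d"
    then have near: "\<bar>?F s - ?F x\<bar> < e" if "s \<in> {a..b}" for s
      using that by (intro d(2)) auto
    have "norm (h (?F b) - h (?F a)) \<le> C * norm (?F b - ?F a)"
    proof (rule field_differentiable_bound[of "ball (?F x) e" h h'])
      show "(h has_field_derivative h' z) (at z within ball (?F x) e)" for z
        using h by (rule has_field_derivative_at_within)
      show "norm (h' z) \<le> C" if "z \<in> ball (?F x) e" for z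
      proof -
        have "\<bar>z - ?F x\<bar> < e" using that by (simp add: dist_real_def abs_minus_commute)
        from e(2)[OF this] show ?thesis
          using abs_triangle_ineq2[of "h' z" "h' (?F x)"] unfolding C_def real_norm_def by linarith
      qed
      show "?F b \<in> ball (?F x) e" "?F a \<in> ball (?F x) e"
        using near[of a] near[of b] ab by (auto simp: dist_real_def abs_minus_commute)
    qed simp
    also have "norm (?F b - ?F a) \<le> (LINT s|lborel. norm (indicator {a..<b} s * g s))"
      using ab prim1_diff[OF g, of a b] by (metis integral_norm_bound order_trans)
    finally have "ennreal \<bar>h (?F b) - h (?F a)\<bar> \<le> ennreal (C * (LINT s|lborel. norm (indicator {a..<b} s * g s)))"
      using C by (intro ennreal_leI) (auto simp: mult_left_mono)
    also have "\<dots> = ennreal C * (\<integral>\<^sup>+s. ennreal (norm (indicator {a..<b} s * g s)) \<partial>lborel)"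
    proof -
      have "integrable lborel (\<lambda>s. norm (indicator {a..<b} s * g s))"
        using integrable_mult_indicator[of "{a..<b}" lborel g] g by (intro integrable_norm) simp
      then show ?thesis using C by (subst nn_integral_eq_integral) (auto simp: ennreal_mult)
    qed
    also have "\<dots> = (\<integral>\<^sup>+s. ennreal C * ennreal (norm (indicator {a..<b} s * g s)) \<partial>lborel)"
      by (rule nn_integral_cmult[symmetric]) simp
    also have "\<dots> \<le> (\<integral>\<^sup>+s. indicator {a..<b} s * ennreal ((\<bar>h' (?F s)\<bar> + \<epsilon>) * \<bar>g s\<bar>) \<partial>lborel)"
    proof (intro nn_integral_mono)
      fix s
      show "ennreal C * ennreal (norm (indicator {a..<b} s * g s)) \<le>
        indicator {a..<b} s * ennreal ((\<bar>h' (?F s)\<bar> + \<epsilon>) * \<bar>g s\<bar>)"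
      proof (cases "s \<in> {a..<b}")
        case True
        then have "\<bar>h' (?F s) - h' (?F x)\<bar> < \<epsilon> / 2" by (intro e(2) near) auto
        then have "C \<le> \<bar>h' (?F s)\<bar> + \<epsilon>" unfolding C_def by linarith
        then have "C * \<bar>g s\<bar> \<le> (\<bar>h' (?F s)\<bar> + \<epsilon>) * \<bar>g s\<bar>" by (rule mult_right_mono) simp
        then show ?thesis using True C by (simp add: ennreal_leI flip: ennreal_mult)
      qed simp
    qed
    finally show "ennreal \<bar>h (?F b) - h (?F a)\<bar> \<le>
      (\<integral>\<^sup>+s. indicator {a..<b} s * ennreal ((\<bar>h' (?F s)\<bar> + \<epsilon>) * \<bar>g s\<bar>) \<partial>lborel)" .
  qed
qed

lemma chain_bound:
  fixes h h' :: "real \<Rightarrow> real"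
  assumes g: "integrable lborel g" and h: "\<And>y. (h has_real_derivative h' y) (at y)"
    and h': "continuous_on UNIV h'" and h0: "h 0 = 0"
  shows "ennreal \<bar>h (prim1 g t)\<bar> \<le> (\<integral>\<^sup>+s. ennreal (\<bar>h' (prim1 g s)\<bar> * \<bar>g s\<bar>) \<partial>lborel)"
    (is "_ \<le> ?I")
proof -
  have [measurable]: "g \<in> borel_measurable borel" "h' \<in> borel_measurable borel"
    using g h' by (auto intro: borel_measurable_continuous_onI)
  have [measurable]: "prim1 g \<in> borel_measurable borel" using g by measurable
  define N where "N = (LINT s|lborel. \<bar>g s\<bar>)"
  have N: "(\<integral>\<^sup>+s. ennreal \<bar>g s\<bar> \<partial>lborel) = ennreal N" "N \<ge> 0"
    using g by (auto simp: N_def nn_integral_eq_integral)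
  have le: "ennreal \<bar>h (prim1 g t) - h (prim1 g x)\<bar> \<le> ?I + ennreal \<epsilon> * ennreal N" if "\<epsilon> > 0" "x \<le> t" for \<epsilon> x
  proof -
    have "ennreal \<bar>h (prim1 g t) - h (prim1 g x)\<bar> \<le>
      (\<integral>\<^sup>+s. indicator {x..<t} s * ennreal ((\<bar>h' (prim1 g s)\<bar> + \<epsilon>) * \<bar>g s\<bar>) \<partial>lborel)"
      using that by (intro chain_bound_interval[OF g h h']) auto
    also have "\<dots> \<le> (\<integral>\<^sup>+s. ennreal (\<bar>h' (prim1 g s)\<bar> * \<bar>g s\<bar>) + ennreal \<epsilon> * ennreal \<bar>g s\<bar> \<partial>lborel)"
      using that by (intro nn_integral_mono)
        (auto split: split_indicator simp: distrib_right simp flip: ennreal_plus ennreal_mult)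
    also have "\<dots> = ?I + ennreal \<epsilon> * ennreal N"
      by (simp add: nn_integral_add nn_integral_cmult N)
    finally show ?thesis .
  qed
  have "isCont h 0" using h by (rule DERIV_isCont)
  then have "(\<lambda>n. h (prim1 g (- real n))) \<longlonglongrightarrow> h 0"
    using prim1_at_bot[OF g] by (rule isCont_tendsto_compose)
  then have lim: "(\<lambda>n. ennreal \<bar>h (prim1 g t) - h (prim1 g (- real n))\<bar>) \<longlonglongrightarrow> ennreal \<bar>h (prim1 g t) - h 0\<bar>"
    by (intro tendsto_intros)
  have "ennreal \<bar>h (prim1 g t)\<bar> \<le> ?I + ennreal \<epsilon> * ennreal N" if "\<epsilon> > 0" for \<epsilon>
  proof -
    obtain n0 where n0: "real n0 \<ge> - t" using real_arch_simple by blast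
    have "ennreal \<bar>h (prim1 g t) - h 0\<bar> \<le> ?I + ennreal \<epsilon> * ennreal N"
    proof (rule LIMSEQ_le_const2[OF lim])
      show "\<exists>n0. \<forall>n\<ge>n0. ennreal \<bar>h (prim1 g t) - h (prim1 g (- real n))\<bar> \<le> ?I + ennreal \<epsilon> * ennreal N"
      proof (intro exI[of _ n0] allI impI le[OF that])
        fix n assume "n \<ge> n0"
        then have "real n \<ge> real n0" by simp
        then show "- real n \<le> t" using n0 by linarith
      qed
    qed
    then show ?thesis by (simp add: h0)
  qed
  note b = this
  show ?thesis
  proof (rule ennreal_le_epsilon)
    fix e :: real assume e: "e > 0"
    have "ennreal \<bar>h (prim1 g t)\<bar> \<le> ?I + ennreal (e / (N + 1)) * ennreal N"
      using e N by (intro b) auto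
    also have "ennreal (e / (N + 1)) * ennreal N = ennreal (e / (N + 1) * N)"
      using e N by (intro ennreal_mult[symmetric]) auto
    also have "e / (N + 1) * N \<le> e" using e N by (simp add: field_simps)
    finally show "ennreal \<bar>h (prim1 g t)\<bar> \<le> ?I + ennreal e" by (simp add: add_left_mono ennreal_leI)
  qed
qed

section \<open>Cut-off functions\<close>

text \<open>A smooth cut-off on the scale \<open>n + 1\<close>; the factor \<open>exp 2\<close> normalises its value at \<open>0\<close> to \<open>1\<close>. Its
  derivative is of order \<open>1/n\<close>.\<close>

definition cutoff :: "nat \<Rightarrow> real \<Rightarrow> real" where
  "cutoff n t = exp 2 * bump 1 (- 1) 1 (t / real (Suc n))"

lemma smooth1_cutoff: "smooth1 (cutoff n)"
proof -
  have "cutoff n = (\<lambda>t. exp 2 * bump 1 (- 1) 1 ((1 / real (Suc n)) * t + 0))"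
    by (auto simp: cutoff_def fun_eq_iff)
  then show ?thesis
    using smooth1_mult[OF smooth1_const smooth1_affine[OF smooth1_bump]] by metis
qed

lemma cutoff_bounds: "0 \<le> cutoff n t" "cutoff n t \<le> 1"
proof -
  show "0 \<le> cutoff n t" unfolding cutoff_def using bump_bounds by simp
  have "exp 2 * bump 1 (- 1) 1 r \<le> 1" for r :: real
  proof (cases "r \<in> {-1<..<1}")
    case True
    then have "bump 1 (- 1) 1 r = exp (- (1 / (r + 1))) * exp (- (1 / (1 - r)))"
      by (simp add: bump_def flat_def add.commute)
    then have "exp 2 * bump 1 (- 1) 1 r = exp (2 - 1 / (r + 1) - 1 / (1 - r))"
      by (simp flip: exp_add)
    moreover have "2 - 1 / (r + 1) - 1 / (1 - r) \<le> 0"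
    proof -
      have "(r + 1) * (1 - r) > 0" using True by simp
      moreover have "2 - 1 / (r + 1) - 1 / (1 - r) = - 2 * r\<^sup>2 / ((r + 1) * (1 - r))"
        using True by (simp add: field_simps power2_eq_square)
      ultimately show ?thesis by (simp add: divide_le_0_iff)
    qed
    ultimately show ?thesis by simp
  qed (simp add: bump_outside)
  then show "cutoff n t \<le> 1" by (simp add: cutoff_def)
qed

lemma cutoff_outside: "t \<notin> {- real (Suc n) .. real (Suc n)} \<Longrightarrow> cutoff n t = 0"
  unfolding cutoff_def by (subst bump_outside) (auto simp: field_simps)

lemma cutoff_tendsto: "(\<lambda>n. cutoff n t) \<longlonglongrightarrow> 1"
proof -
  have "isCont (bump 1 (- 1) 1) 0"
    using smooth1_DERIV[OF smooth1_bump] DERIV_isCont by blast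
  moreover have "(\<lambda>n. t / real (Suc n)) \<longlonglongrightarrow> 0"
    using LIMSEQ_Suc[OF lim_const_over_n[of t]] by simp
  ultimately have "(\<lambda>n. exp 2 * bump 1 (- 1) 1 (t / real (Suc n))) \<longlonglongrightarrow> exp 2 * bump 1 (- 1) 1 0"
    using tendsto_mult[OF tendsto_const isCont_tendsto_compose] by blast
  also have "exp 2 * bump 1 (- 1) 1 0 = (1 :: real)"
    by (simp add: bump_def flat_def flip: exp_add)
  finally show ?thesis by (simp add: cutoff_def)
qed

lemma cutoff_deriv_bound: obtains C where "C \<ge> 0" "\<And>n t. \<bar>deriv (cutoff n) t\<bar> \<le> C / real (Suc n)"
proof -
  let ?b = "bump 1 (- 1) 1"
  note b = smooth1_deriv[OF smooth1_bump[of 1 "-1" 1]]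
  have "compact (deriv ?b ` {-1..1})"
    by (intro compact_continuous_image smooth1_continuous b(2)) auto
  then obtain K where K: "\<And>t. t \<in> {-1..1} \<Longrightarrow> \<bar>deriv ?b t\<bar> \<le> K"
    using compact_imp_bounded by (fastforce simp: bounded_iff)
  have zero: "deriv ?b t = 0" if "t \<notin> {-1..1}" for t
  proof (rule DERIV_imp_deriv)
    have "((\<lambda>t. 0) has_real_derivative 0) (at t)" by simp
    then show "(?b has_real_derivative 0) (at t)"
      by (rule has_field_derivative_transform_within_open[where S="- {-1..1}"])
         (use that in \<open>auto simp: bump_outside open_Compl\<close>)
  qed
  have "\<bar>deriv ?b t\<bar> \<le> max K 0" for t using K[of t] zero[of t] by (cases "t \<in> {-1..1}") auto
  note bd = this
  have d: "deriv (cutoff n) t = exp 2 * deriv ?b (t / real (Suc n)) / real (Suc n)" for n t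
  proof (rule DERIV_imp_deriv)
    have "((\<lambda>t. ?b ((1 / real (Suc n)) * t)) has_real_derivative deriv ?b ((1 / real (Suc n)) * t) * (1 / real (Suc n))) (at t)"
      by (rule DERIV_chain2[OF b(1)]) (auto intro!: derivative_eq_intros)
    from DERIV_cmult[OF this, of "exp 2"]
    show "(cutoff n has_real_derivative exp 2 * deriv ?b (t / real (Suc n)) / real (Suc n)) (at t)"
      unfolding cutoff_def by simp
  qed
  show ?thesis
  proof (rule that[of "exp 2 * max K 0"])
    fix n t
    have "\<bar>deriv (cutoff n) t\<bar> = exp 2 * \<bar>deriv ?b (t / real (Suc n))\<bar> / real (Suc n)"
      unfolding d by (simp add: abs_mult)
    also have "\<dots> \<le> exp 2 * max K 0 / real (Suc n)"
      by (intro divide_right_mono mult_left_mono bd) auto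
    finally show "\<bar>deriv (cutoff n) t\<bar> \<le> exp 2 * max K 0 / real (Suc n)" .
  qed auto
qed

lemma over_Suc_tendsto_0: "(\<lambda>n. C / real (Suc n)) \<longlonglongrightarrow> 0"
  using LIMSEQ_Suc[OF lim_const_over_n[of C]] by simp

section \<open>Weak derivatives along lines\<close>

text \<open>The primitive of \<open>-\<beta>\<close> that vanishes at \<open>+\<infinity>\<close>. It is dual to \<open>prim1\<close>, see \<open>prim1_fubini\<close> below.\<close>

definition tail1 :: "(real \<Rightarrow> real) \<Rightarrow> real \<Rightarrow> real" where
  "tail1 \<beta> s = (LINT t|lborel. indicator {s<..} t * \<beta> t)"

lemma tail1_bound:
  assumes "integrable lborel \<beta>"
  shows "\<bar>tail1 \<beta> s\<bar> \<le> (LINT t|lborel. \<bar>\<beta> t\<bar>)"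
proof -
  have "integrable lborel (\<lambda>t. indicator {s<..} t * \<beta> t)"
    using integrable_mult_indicator[of "{s<..}" lborel \<beta>] assms by simp
  then have "(LINT t|lborel. \<bar>indicator {s<..} t * \<beta> t\<bar>) \<le> (LINT t|lborel. \<bar>\<beta> t\<bar>)"
    using assms by (intro integral_mono) (auto split: split_indicator)
  then show ?thesis unfolding tail1_def by (rule order_trans[OF integral_abs_bound])
qed

lemma tail1_DERIV:
  fixes \<beta> :: "real \<Rightarrow> real"
  assumes int: "integrable lborel \<beta>" and cont: "continuous_on UNIV \<beta>"
  shows "(tail1 \<beta> has_real_derivative - \<beta> x) (at x)"
proof -
  let ?a = "x - 1" and ?b = "x + 1"
  have i: "integrable lborel (\<lambda>t. indicator A t * \<beta> t)" if "A \<in> sets borel" for A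
    using integrable_mult_indicator[of A lborel \<beta>] int that by simp
  have eq: "tail1 \<beta> s = tail1 \<beta> ?a - integral {?a..s} \<beta>" if "s \<in> {?a..?b}" for s
  proof -
    have "tail1 \<beta> ?a - tail1 \<beta> s = (LINT t|lborel. indicator {?a<..} t * \<beta> t - indicator {s<..} t * \<beta> t)"
      unfolding tail1_def by (intro Bochner_Integration.integral_diff[symmetric] i) auto
    also have "\<dots> = (LINT t:{?a..s}|lborel. \<beta> t)"
      unfolding set_lebesgue_integral_def
    proof (rule integral_cong_AE)
      show "AE t in lborel. indicator {?a<..} t * \<beta> t - indicator {s<..} t * \<beta> t = indicator {?a..s} t *\<^sub>R \<beta> t"
        using AE_lborel_singleton[of ?a] by eventually_elim (use that in \<open>auto split: split_indicator\<close>)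
    qed (use int in auto)
    also have "\<dots> = integral {?a..s} \<beta>"
      using i[of "{?a..s}"] by (intro set_borel_integral_eq_integral) (simp add: set_integrable_def)
    finally show ?thesis by simp
  qed
  have "((\<lambda>s. integral {?a..s} \<beta>) has_real_derivative \<beta> x) (at x within {?a..?b})"
    by (rule integral_has_real_derivative) (auto intro: continuous_on_subset[OF cont])
  then have "((\<lambda>s. tail1 \<beta> ?a - integral {?a..s} \<beta>) has_real_derivative - \<beta> x) (at x within {?a..?b})"
    by (auto intro!: derivative_eq_intros)
  then have "(tail1 \<beta> has_real_derivative - \<beta> x) (at x within {?a..?b})"
  proof (rule has_field_derivative_transform_within[where d=1])
    show "tail1 \<beta> ?a - integral {?a..s} \<beta> = tail1 \<beta> s" if "s \<in> {?a..?b}" for s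
      by (rule eq[OF that, symmetric])
  qed auto
  moreover have "at x within {?a..?b} = at x"
    by (rule at_within_interior) (simp add: interior_atLeastAtMost_real)
  ultimately show ?thesis by simp
qed

lemma smooth1_tail1:
  assumes "integrable lborel \<beta>" "smooth1 \<beta>"
  shows "smooth1 (tail1 \<beta>)"
proof (rule smooth1_I)
  show "(tail1 \<beta> has_real_derivative (-1) * \<beta> x) (at x)" for x
    using tail1_DERIV[OF assms(1) smooth1_continuous[OF assms(2)]] by simp
  show "smooth1 (\<lambda>x. (-1) * \<beta> x)" by (intro smooth1_mult smooth1_const assms)
qed

lemma prim1_fubini:
  fixes g \<beta> :: "real \<Rightarrow> real"
  assumes g: "integrable lborel g" and \<beta>: "integrable lborel \<beta>"
  shows "(LINT t|lborel. prim1 g t * \<beta> t) = (LINT s|lborel. g s * tail1 \<beta> s)"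
proof -
  have [measurable]: "g \<in> borel_measurable borel" "\<beta> \<in> borel_measurable borel" using g \<beta> by auto
  let ?f = "\<lambda>s t. (if s < t then 1 else 0) * (g s * \<beta> t)"
  have "integrable (lborel \<Otimes>\<^sub>M lborel) (\<lambda>(s, t). g s * \<beta> t)"
  proof (rule lborel_pair.Fubini_integrable)
    show "integrable lborel (\<lambda>s. LINT t|lborel. norm (case (s, t) of (s, t) \<Rightarrow> g s * \<beta> t))"
      using g by (simp add: abs_mult)
    show "AE s in lborel. integrable lborel (\<lambda>t. case (s, t) of (s, t) \<Rightarrow> g s * \<beta> t)"
      using \<beta> by simp
  qed simp
  then have "integrable (lborel \<Otimes>\<^sub>M lborel) (case_prod ?f)"
    by (rule Bochner_Integration.integrable_bound) (auto intro!: AE_I2)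
  from lborel_pair.Fubini_integral[OF this]
  have "(LINT t|lborel. LINT s|lborel. ?f s t) = (LINT s|lborel. LINT t|lborel. ?f s t)" .
  moreover have "(LINT s|lborel. ?f s t) = prim1 g t * \<beta> t" for t
  proof -
    have "(LINT s|lborel. ?f s t) = (LINT s|lborel. (indicator {..<t} s * g s) * \<beta> t)"
      by (intro Bochner_Integration.integral_cong) auto
    then show ?thesis by (simp add: prim1_def)
  qed
  moreover have "(LINT t|lborel. ?f s t) = g s * tail1 \<beta> s" for s
  proof -
    have "(LINT t|lborel. ?f s t) = (LINT t|lborel. g s * (indicator {s<..} t * \<beta> t))"
      by (intro Bochner_Integration.integral_cong) auto
    then show ?thesis by (simp add: tail1_def)
  qed
  ultimately show ?thesis by simp
qed

lemma tens_upd: "tens (F(i := f)) x = f (x $ i) * (\<Prod>k\<in>UNIV - {i}. F k (x $ k))"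
  unfolding tens_def by (subst prod.remove[of UNIV i]) auto

lemma box_bump_measurable[measurable]: "box_bump n l v \<in> borel_measurable borel"
  using test_fun_box_bump[of n l v] by (intro smooth_measurable) (simp add: test_fun_def)

text \<open>\<open>g\<close> is the weak partial derivative of \<open>w\<close> in direction \<open>i\<close>. Integrability is assumed separately.\<close>

definition weak_partial :: "3 \<Rightarrow> fn3 \<Rightarrow> fn3 \<Rightarrow> bool" where
  "weak_partial i w g \<longleftrightarrow> (\<forall>\<phi>. test_fun \<phi> \<longrightarrow>
     (LINT x|lborel. w x * partial_deriv i \<phi> x) = - (LINT x|lborel. g x * \<phi> x))"

text \<open>The factor \<open>\<beta>\<^sub>i\<close> of the test function is minus the derivative of \<open>tail1 \<beta>\<^sub>i\<close>, which is bounded but not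
  compactly supported; it is admissible after a cut-off in the \<open>i\<close>-th variable that is then removed by
  dominated convergence.\<close>

lemma weak_partial_tail:
  assumes w: "integrable lborel w" and g: "integrable lborel g" and wp: "weak_partial i w g"
  defines "\<beta> \<equiv> \<lambda>n l v k. bump n (l $ k) (v $ k)"
  shows "(LINT x|lborel. w x * box_bump n l v x) =
     (LINT x|lborel. g x * tens ((\<beta> n l v)(i := tail1 (\<beta> n l v i))) x)"
proof -
  define b where "b = \<beta> n l v"
  have b: "smooth1 (b k)" "0 \<le> b k t" "b k t \<le> 1" for k t
    using bump_bounds by (auto simp: b_def \<beta>_def smooth1_bump)
  have b_out: "b k t = 0" if "t \<notin> {l $ k .. v $ k}" for k t
    unfolding b_def \<beta>_def using that by (intro bump_outside) auto
  have bb: "box_bump n l v = tens b" by (simp add: box_bump_def b_def \<beta>_def)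
  have bint: "integrable lborel (b i)" by (simp add: b_def \<beta>_def integrable_bump)
  define B where "B = tail1 (b i)"
  have sB: "smooth1 B" unfolding B_def by (rule smooth1_tail1[OF bint b(1)])
  define K where "K = (LINT t|lborel. \<bar>b i t\<bar>)"
  have K: "\<bar>B t\<bar> \<le> K" for t unfolding B_def K_def by (rule tail1_bound[OF bint])
  have K0: "K \<ge> 0" by (simp add: K_def)
  define R where "R x = (\<Prod>k\<in>UNIV - {i}. b k (x $ k))" for x :: "real^3"
  have R: "0 \<le> R x" "R x \<le> 1" for x
    unfolding R_def using b by (auto intro!: prod_nonneg prod_le_1)
  define \<phi> where "\<phi> N = tens (b(i := (\<lambda>t. cutoff N t * B t)))" for N
  have s\<phi>: "smooth1 ((b(i := (\<lambda>t. cutoff N t * B t))) k)" for N k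
    using smooth1_mult[OF smooth1_cutoff sB] b by simp
  have t\<phi>: "test_fun (\<phi> N)" for N
  proof -
    have "test_fun (tens (b(i := (\<lambda>t. cutoff N t * B t))))"
    proof (rule test_fun_tens[OF s\<phi>])
      fix k t assume "t \<notin> {(\<chi> k. if k = i then - real (Suc N) else l $ k) $ k .. (\<chi> k. if k = i then real (Suc N) else v $ k) $ k}"
      then show "(b(i := (\<lambda>t. cutoff N t * B t))) k t = 0"
        by (cases "k = i") (auto simp: cutoff_outside b_out)
    qed
    then show ?thesis by (simp add: \<phi>_def)
  qed
  have dB: "deriv (\<lambda>t. cutoff N t * B t) t = deriv (cutoff N) t * B t - cutoff N t * b i t" for N t
  proof (rule DERIV_imp_deriv)
    have "(B has_real_derivative - b i t) (at t)"
      unfolding B_def by (rule tail1_DERIV[OF bint smooth1_continuous[OF b(1)]])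
    from DERIV_mult[OF smooth1_DERIV[OF smooth1_cutoff] this]
    show "((\<lambda>t. cutoff N t * B t) has_real_derivative deriv (cutoff N) t * B t - cutoff N t * b i t) (at t)"
      by (simp add: algebra_simps)
  qed
  have pd: "partial_deriv i (\<phi> N) x = (deriv (cutoff N) (x $ i) * B (x $ i) - cutoff N (x $ i) * b i (x $ i)) * R x" for N x
    unfolding \<phi>_def partial_deriv_tens[OF s\<phi>] by (simp add: tens_upd dB R_def)
  have \<phi>eq: "\<phi> N x = cutoff N (x $ i) * B (x $ i) * R x" for N x
    by (simp add: \<phi>_def tens_upd R_def)
  obtain C where C: "C \<ge> 0" "\<And>n t. \<bar>deriv (cutoff n) t\<bar> \<le> C / real (Suc n)" by (rule cutoff_deriv_bound) blast
  have C': "\<bar>deriv (cutoff n) t\<bar> \<le> C" for n t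
  proof -
    have "C / real (Suc n) \<le> C" using C(1) by (simp add: divide_le_eq algebra_simps)
    then show ?thesis using C(2)[of n t] by linarith
  qed
  have [measurable]: "w \<in> borel_measurable borel" "g \<in> borel_measurable borel" using w g by auto
  have m\<phi>[measurable]: "\<phi> N \<in> borel_measurable borel" "partial_deriv i (\<phi> N) \<in> borel_measurable borel" for N
    using t\<phi>[of N] by (auto simp: test_fun_def intro!: smooth_measurable smooth_partial_deriv)
  have "(\<lambda>N. LINT x|lborel. w x * partial_deriv i (\<phi> N) x) \<longlonglongrightarrow> (LINT x|lborel. w x * (- box_bump n l v x))"
  proof (rule integral_dominated_convergence[where w="\<lambda>x. (C * K + 1) * norm (w x)"])
    show "AE x in lborel. (\<lambda>N. w x * partial_deriv i (\<phi> N) x) \<longlonglongrightarrow> w x * - box_bump n l v x"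
    proof (rule AE_I2)
      fix x
      have "(\<lambda>N. deriv (cutoff N) (x $ i)) \<longlonglongrightarrow> 0"
        by (rule Lim_null_comparison[OF _ over_Suc_tendsto_0[of C]]) (use C(2) in auto)
      then have "(\<lambda>N. w x * ((deriv (cutoff N) (x $ i) * B (x $ i) - cutoff N (x $ i) * b i (x $ i)) * R x)) \<longlonglongrightarrow>
         w x * ((0 * B (x $ i) - 1 * b i (x $ i)) * R x)"
        by (intro tendsto_intros cutoff_tendsto)
      moreover have "tens b x = b i (x $ i) * R x"
        unfolding R_def tens_def by (subst prod.remove[of UNIV i]) auto
      ultimately show "(\<lambda>N. w x * partial_deriv i (\<phi> N) x) \<longlonglongrightarrow> w x * - box_bump n l v x"
        unfolding pd bb by simp
    qed
    show "AE x in lborel. norm (w x * partial_deriv i (\<phi> N) x) \<le> (C * K + 1) * norm (w x)" for N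
    proof (rule AE_I2)
      fix x
      have "\<bar>deriv (cutoff N) (x $ i) * B (x $ i)\<bar> \<le> C * K"
        unfolding abs_mult using C' K C by (intro mult_mono) auto
      moreover have "\<bar>cutoff N (x $ i) * b i (x $ i)\<bar> \<le> 1"
        using cutoff_bounds[of N "x $ i"] b(2,3)[of i "x $ i"] by (auto simp: abs_mult intro!: mult_le_one)
      ultimately have "\<bar>deriv (cutoff N) (x $ i) * B (x $ i) - cutoff N (x $ i) * b i (x $ i)\<bar> \<le> C * K + 1" by linarith
      then have "\<bar>partial_deriv i (\<phi> N) x\<bar> \<le> (C * K + 1) * 1"
        unfolding pd abs_mult using R[of x] C K0 by (intro mult_mono) auto
      then show "norm (w x * partial_deriv i (\<phi> N) x) \<le> (C * K + 1) * norm (w x)"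
        by (simp add: abs_mult mult.commute mult_left_mono)
    qed
    show "integrable lborel (\<lambda>x. (C * K + 1) * norm (w x))" using w by simp
  qed measurable
  moreover have "(\<lambda>N. LINT x|lborel. w x * partial_deriv i (\<phi> N) x) \<longlonglongrightarrow> - (LINT x|lborel. g x * tens (b(i := B)) x)"
  proof -
    have [measurable]: "tens (b(i := B)) \<in> borel_measurable borel"
      using sB b by (intro smooth_measurable smooth_tens) simp
    have "(\<lambda>N. LINT x|lborel. g x * \<phi> N x) \<longlonglongrightarrow> (LINT x|lborel. g x * tens (b(i := B)) x)"
    proof (rule integral_dominated_convergence[where w="\<lambda>x. K * norm (g x)"])
      show "AE x in lborel. (\<lambda>N. g x * \<phi> N x) \<longlonglongrightarrow> g x * tens (b(i := B)) x"
      proof (rule AE_I2)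
        fix x
        have "(\<lambda>N. g x * (cutoff N (x $ i) * B (x $ i) * R x)) \<longlonglongrightarrow> g x * (1 * B (x $ i) * R x)"
          by (intro tendsto_intros cutoff_tendsto)
        then show "(\<lambda>N. g x * \<phi> N x) \<longlonglongrightarrow> g x * tens (b(i := B)) x"
          unfolding \<phi>eq tens_upd R_def by simp
      qed
      show "AE x in lborel. norm (g x * \<phi> N x) \<le> K * norm (g x)" for N
      proof (rule AE_I2)
        fix x
        have "\<bar>cutoff N (x $ i) * B (x $ i)\<bar> \<le> 1 * K"
          unfolding abs_mult using cutoff_bounds[of N "x $ i"] K by (intro mult_mono) auto
        then have "\<bar>\<phi> N x\<bar> \<le> K * 1"
          unfolding \<phi>eq abs_mult[of _ "R x"] using R[of x] K0 by (intro mult_mono) auto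
        then show "norm (g x * \<phi> N x) \<le> K * norm (g x)"
          by (simp add: abs_mult mult.commute[of "\<bar>g x\<bar>"] mult_right_mono)
      qed
      show "integrable lborel (\<lambda>x. K * norm (g x))" using g by simp
    qed measurable
    then have "(\<lambda>N. - (LINT x|lborel. g x * \<phi> N x)) \<longlonglongrightarrow> - (LINT x|lborel. g x * tens (b(i := B)) x)"
      by (rule tendsto_minus)
    then show ?thesis using wp t\<phi> by (simp add: weak_partial_def)
  qed
  ultimately have "(LINT x|lborel. w x * (- box_bump n l v x)) = - (LINT x|lborel. g x * tens (b(i := B)) x)"
    by (rule LIMSEQ_unique)
  then show ?thesis by (simp add: B_def b_def)
qed

lemma other_directions:
  fixes i :: 3
  obtains j k where "distinct [i, j, k]"
proof -
  have "distinct [1, 2, 3 :: 3]" "distinct [2, 3, 1 :: 3]" "distinct [3, 1, 2 :: 3]" by simp_all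
  then show ?thesis using that exhaust_3[of i] by blast
qed

lemma measurable_vec_nth[measurable (raw)]:
  "f \<in> borel_measurable M \<Longrightarrow> (\<lambda>w. f w $ i) \<in> borel_measurable M" for f :: "_ \<Rightarrow> real^3"
  by (rule measurable_compose[OF _ borel_measurable_nth])

lemma upd_coords:
  assumes "distinct [j, k, i]"
  shows "upd (coords j k i (y, z, t)) i s = coords j k i (y, z, s)"
proof -
  have "l \<in> {j, k, i}" for l using distinct_3_UNIV[OF assms] by blast
  then show ?thesis using assms by (auto simp: upd_def coords_def vec_eq_iff)
qed

lemma upd_coords_first: "upd (coords i j k (t, q)) i s = coords i j k (s, q)"
  by (auto simp: upd_def coords_def vec_eq_iff split: prod.split)

lemma upd_upd: "upd (upd x i s) i t = upd x i t"
  by (auto simp: upd_def vec_eq_iff)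

lemma upd_nth: "upd x i t $ i = t"
  by (simp add: upd_def)

text \<open>An almost everywhere property holds almost everywhere on almost every line parallel to an axis.\<close>

lemma AE_line:
  fixes P :: "real^3 \<Rightarrow> bool"
  assumes [measurable]: "Measurable.pred borel P" and P: "AE x in lborel. P x"
  shows "AE x in lborel. AE s in lborel. P (upd x i s)"
proof -
  obtain j k where "distinct [i, j, k]" by (rule other_directions)
  then have d: "distinct [j, k, i]" by auto
  define f where "f x = (if P x then 0 else 1 :: ennreal)" for x
  have [measurable]: "f \<in> borel_measurable borel" unfolding f_def by measurable
  have "0 = (\<integral>\<^sup>+x. f x \<partial>lborel)"
    using P by (subst nn_integral_0_iff_AE[THEN iffD2]) (auto simp: f_def)
  also have "\<dots> = (\<integral>\<^sup>+y. \<integral>\<^sup>+z. \<integral>\<^sup>+s. f (coords j k i (y, z, s)) \<partial>lborel \<partial>lborel \<partial>lborel)"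
    by (rule nn_integral_coords[OF d]) simp
  finally have zero: "(\<integral>\<^sup>+y. \<integral>\<^sup>+z. \<integral>\<^sup>+s. f (coords j k i (y, z, s)) \<partial>lborel \<partial>lborel \<partial>lborel) = 0" ..
  have "(\<integral>\<^sup>+x. \<integral>\<^sup>+s. f (upd x i s) \<partial>lborel \<partial>lborel) =
     (\<integral>\<^sup>+y. \<integral>\<^sup>+z. \<integral>\<^sup>+t. \<integral>\<^sup>+s. f (coords j k i (y, z, s)) \<partial>lborel \<partial>(lborel :: real measure) \<partial>lborel \<partial>lborel)"
    by (subst nn_integral_coords[OF d]) (simp_all add: upd_coords[OF d])
  also have "\<dots> = (\<integral>\<^sup>+y. \<integral>\<^sup>+z. (\<integral>\<^sup>+s. f (coords j k i (y, z, s)) \<partial>lborel) * \<infinity> \<partial>lborel \<partial>lborel)"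
    by (simp add: nn_integral_const)
  also have "\<dots> = (\<integral>\<^sup>+y. \<integral>\<^sup>+z. \<integral>\<^sup>+s. f (coords j k i (y, z, s)) \<partial>lborel \<partial>lborel \<partial>lborel) * \<infinity>"
    by (simp add: nn_integral_multc)
  finally have "(\<integral>\<^sup>+x. \<integral>\<^sup>+s. f (upd x i s) \<partial>lborel \<partial>lborel) = 0" unfolding zero by simp
  then have "AE x in lborel. (\<integral>\<^sup>+s. f (upd x i s) \<partial>lborel) = 0"
    by (subst (asm) nn_integral_0_iff_AE) auto
  then show ?thesis
  proof eventually_elim
    case (elim x)
    then have "AE s in lborel. f (upd x i s) = 0"
      by (subst (asm) nn_integral_0_iff_AE) auto
    then show ?case by eventually_elim (auto simp: f_def split: if_splits)
  qed
qed

lemma AE_integrable_line: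
  fixes g :: fn3
  assumes g: "integrable lborel g"
  shows "AE x in lborel. integrable lborel (\<lambda>s. g (upd x i s))"
proof -
  obtain j k where d: "distinct [i, j, k]" by (rule other_directions)
  have "AE q in lborel. integrable lborel (\<lambda>t. g (coords i j k (t, q)))"
    by (rule integral_coords(2)[OF d g])
  \<comment> \<open>The exceptional set of lines is enlarged to a Borel null set \<open>N\<close>; the cylinder over \<open>N\<close> is null.\<close>
  then obtain N where N: "{q. \<not> integrable lborel (\<lambda>t. g (coords i j k (t, q)))} \<subseteq> N" "N \<in> null_sets lborel"
    unfolding eventually_ae_filter by auto
  then have [measurable]: "N \<in> sets borel" by (auto simp: null_sets_def)
  let ?M = "{x. (x $ j, x $ k) \<in> N} :: (real^3) set"
  have [measurable]: "?M \<in> sets borel"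
  proof -
    have "(\<lambda>x :: real^3. (x $ j, x $ k)) \<in> borel_measurable borel"
      by (intro borel_measurable_continuous_onI continuous_intros)
    from measurable_sets[OF this \<open>N \<in> sets borel\<close>] show ?thesis by (simp add: vimage_def)
  qed
  have "emeasure lborel ?M = emeasure (distr lborel borel (coords i j k)) ?M"
    using lborel_coords[OF d] by simp
  also have "\<dots> = emeasure lborel ((UNIV :: real set) \<times> N)"
  proof -
    have vim: "coords i j k -` ?M = UNIV \<times> N" using d by (auto simp: coords_def)
    have "emeasure (distr lborel borel (coords i j k)) ?M = emeasure lborel (coords i j k -` ?M \<inter> space lborel)"
      by (rule emeasure_distr, measurable)
    then show ?thesis unfolding vim space_lborel space_borel Int_UNIV_right .
  qed
  also have "\<dots> = emeasure lborel (UNIV :: real set) * emeasure lborel N"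
    using lborel.emeasure_pair_measure_Times[of "UNIV :: real set" lborel N] by (simp add: lborel_prod)
  also have "\<dots> = 0" using N(2) by (simp add: null_sets_def)
  finally have "?M \<in> null_sets lborel" by (simp add: null_sets_def)
  then have "AE x in lborel. x \<notin> ?M" by (rule AE_not_in)
  then show ?thesis
  proof eventually_elim
    case (elim x)
    have eq: "coords i j k (t, x $ j, x $ k) = upd x i t" for t
    proof -
      have "l \<in> {i, j, k}" for l using distinct_3_UNIV[OF d] by blast
      then show ?thesis using d by (auto simp: coords_def upd_def vec_eq_iff)
    qed
    have "integrable lborel (\<lambda>t. g (coords i j k (t, x $ j, x $ k)))" using elim N(1) by blast
    then show ?case unfolding eq .
  qed
qed

text \<open>The primitive of \<open>g\<close> along the lines parallel to the \<open>i\<close>-th axis.\<close>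

definition prim :: "3 \<Rightarrow> fn3 \<Rightarrow> fn3" where
  "prim i g x = prim1 (\<lambda>s. g (upd x i s)) (x $ i)"

lemma prim_measurable[measurable]:
  assumes [measurable]: "g \<in> borel_measurable borel"
  shows "prim i g \<in> borel_measurable borel"
proof -
  have "prim i g = (\<lambda>x. LINT s|lborel. (if s < x $ i then 1 else 0) * g (upd x i s))"
    by (auto simp: prim_def prim1_def fun_eq_iff indicator_def intro!: Bochner_Integration.integral_cong)
  moreover have "(\<lambda>x. LINT s|lborel. (if s < x $ i then 1 else 0) * g (upd x i s)) \<in> borel_measurable borel"
    by measurable
  ultimately show ?thesis by simp
qed

lemma prim_loc_integrable:
  assumes g: "integrable lborel g"
  shows "set_integrable lborel (cbox l u) (prim i g)"
proof -
  have [measurable]: "g \<in> borel_measurable borel" using g by simp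
  obtain j k where "distinct [i, j, k]" by (rule other_directions)
  then have d: "distinct [j, k, i]" by auto
  have "(\<integral>\<^sup>+x. ennreal (norm (indicator (cbox l u) x *\<^sub>R prim i g x)) \<partial>lborel) \<le>
     (\<integral>\<^sup>+x. indicator {l $ i .. u $ i} (x $ i) * (\<integral>\<^sup>+s. ennreal (norm (g (upd x i s))) \<partial>lborel) \<partial>lborel)"
  proof (rule nn_integral_mono)
    fix x :: "real^3"
    have "ennreal (norm (prim i g x)) \<le> (\<integral>\<^sup>+s. ennreal (norm (indicator {..<x $ i} s * g (upd x i s))) \<partial>lborel)"
      unfolding prim_def prim1_def
    proof (cases "integrable lborel (\<lambda>s. indicator {..<x $ i} s * g (upd x i s))")
      case True
      then show "ennreal (norm (LINT s|lborel. indicator {..<x $ i} s * g (upd x i s))) \<le>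
        (\<integral>\<^sup>+s. ennreal (norm (indicator {..<x $ i} s * g (upd x i s))) \<partial>lborel)"
        by (rule integral_norm_bound_ennreal)
    next
      case False
      then show "ennreal (norm (LINT s|lborel. indicator {..<x $ i} s * g (upd x i s))) \<le>
        (\<integral>\<^sup>+s. ennreal (norm (indicator {..<x $ i} s * g (upd x i s))) \<partial>lborel)"
        by (simp add: not_integrable_integral_eq)
    qed
    also have "\<dots> \<le> (\<integral>\<^sup>+s. ennreal (norm (g (upd x i s))) \<partial>lborel)"
      by (intro nn_integral_mono) (auto split: split_indicator)
    finally show "ennreal (norm (indicator (cbox l u) x *\<^sub>R prim i g x)) \<le>
      indicator {l $ i .. u $ i} (x $ i) * (\<integral>\<^sup>+s. ennreal (norm (g (upd x i s))) \<partial>lborel)"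
      by (auto simp: mem_box_cart split: split_indicator)
  qed
  also have "\<dots> = (\<integral>\<^sup>+y. \<integral>\<^sup>+z. \<integral>\<^sup>+t. indicator {l $ i .. u $ i} t *
      (\<integral>\<^sup>+s. ennreal (norm (g (coords j k i (y, z, s)))) \<partial>lborel) \<partial>lborel \<partial>lborel \<partial>lborel)"
  proof -
    have "coords j k i (y, z, t) $ i = t" for y z t using d by (auto simp: coords_def)
    then show ?thesis by (subst nn_integral_coords[OF d]) (simp_all add: upd_coords[OF d])
  qed
  also have "\<dots> = (\<integral>\<^sup>+y. \<integral>\<^sup>+z. emeasure lborel {l $ i .. u $ i} *
      (\<integral>\<^sup>+s. ennreal (norm (g (coords j k i (y, z, s)))) \<partial>lborel) \<partial>lborel \<partial>lborel)"
    by (simp add: nn_integral_multc)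
  also have "\<dots> = emeasure lborel {l $ i .. u $ i} * (\<integral>\<^sup>+x. ennreal (norm (g x)) \<partial>lborel)"
    by (subst nn_integral_coords[OF d]) (simp_all add: nn_integral_cmult)
  also have "\<dots> < \<infinity>"
    using g by (auto simp: integrable_iff_bounded ennreal_mult_less_top emeasure_lborel_Icc_eq)
  finally show ?thesis
    unfolding set_integrable_def by (intro integrableI_bounded) auto
qed

text \<open>A function with an integrable weak derivative in direction \<open>x\<^sub>i\<close> is, almost everywhere, the
  primitive of that derivative along the lines parallel to the \<open>i\<close>-th axis.\<close>

lemma weak_partial_prim:
  assumes w: "integrable lborel w" and g: "integrable lborel g" and wp: "weak_partial i w g"
  shows "AE x in lborel. w x = prim i g x"
proof -
  obtain j k where d: "distinct [i, j, k]" by (rule other_directions)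
  have [measurable]: "w \<in> borel_measurable borel" "g \<in> borel_measurable borel" using w g by auto
  have wl: "set_integrable lborel (cbox l u) w" for l u
    unfolding set_integrable_def by (rule integrable_mult_indicator[OF _ w]) simp
  have "AE x in lborel. w x - prim i g x = 0"
  proof (rule fundamental_lemma)
    show "(\<lambda>x. w x - prim i g x) \<in> borel_measurable borel" by measurable
    show "set_integrable lborel (cbox l u) (\<lambda>x. w x - prim i g x)" for l u
      by (intro set_integral_diff wl prim_loc_integrable g)
    fix n and l v :: "real^3"
    define b where "b = (\<lambda>k. bump n (l $ k) (v $ k))"
    define \<phi> where "\<phi> = box_bump n l v"
    have \<phi>: "\<phi> = tens b" by (simp add: \<phi>_def box_bump_def b_def)
    have tphi: "test_fun \<phi>" unfolding \<phi>_def by (rule test_fun_box_bump)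
    have [measurable]: "\<phi> \<in> borel_measurable borel"
      using tphi by (auto simp: test_fun_def intro: smooth_measurable)
    have sb: "smooth1 (b k)" for k by (simp add: b_def smooth1_bump)
    have bint: "integrable lborel (b i)" by (simp add: b_def integrable_bump)
    define B where "B = tail1 (b i)"
    have sB: "smooth1 B" unfolding B_def by (rule smooth1_tail1[OF bint sb])
    define \<psi> where "\<psi> = tens (b(i := B))"
    have [measurable]: "\<psi> \<in> borel_measurable borel"
      unfolding \<psi>_def using sB sb by (intro smooth_measurable smooth_tens) simp
    define R where "R q = b j (fst q) * b k (snd q)" for q :: "real \<times> real"
    have U: "UNIV - {i} = {j, k}" using distinct_3_UNIV[OF d] d by auto
    have \<phi>q: "\<phi> (coords i j k (t, q)) = b i t * R q" for t q
      using d unfolding \<phi> R_def tens_def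
      by (subst prod.remove[of UNIV i]) (auto simp: U coords_def split: prod.split)
    have \<psi>q: "\<psi> (coords i j k (t, q)) = B t * R q" for t q
      using d unfolding \<psi>_def tens_upd R_def by (auto simp: U coords_def split: prod.split)
    have wi: "integrable lborel (\<lambda>x. w x * \<phi> x)"
      by (rule loc_integrable_test_fun[OF _ wl tphi]) simp
    have pint: "integrable lborel (\<lambda>x. prim i g x * \<phi> x)"
      by (rule loc_integrable_test_fun[OF _ prim_loc_integrable[OF g] tphi]) simp
    have gint: "integrable lborel (\<lambda>x. g x * \<psi> x)"
    proof (rule Bochner_Integration.integrable_bound)
      show "integrable lborel (\<lambda>x. (LINT t|lborel. \<bar>b i t\<bar>) * g x)" using g by simp
      have "\<bar>\<psi> x\<bar> \<le> (LINT t|lborel. \<bar>b i t\<bar>) * 1" for x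
        unfolding \<psi>_def tens_upd abs_mult B_def
        using bump_bounds by (intro mult_mono tail1_bound[OF bint])
          (auto simp: abs_prod b_def intro!: prod_le_1 prod_nonneg)
      then have "\<bar>\<psi> x\<bar> * \<bar>g x\<bar> \<le> (LINT t|lborel. \<bar>b i t\<bar>) * \<bar>g x\<bar>" for x
        by (intro mult_right_mono) auto
      then show "AE x in lborel. norm (g x * \<psi> x) \<le> norm ((LINT t|lborel. \<bar>b i t\<bar>) * g x)"
        by (intro AE_I2) (simp add: abs_mult mult.commute)
    qed simp
    have "(LINT x|lborel. prim i g x * \<phi> x) =
       (LINT q|lborel. LINT t|lborel. prim i g (coords i j k (t, q)) * \<phi> (coords i j k (t, q)))"
      by (rule integral_coords(1)[OF d pint])
    also have "\<dots> = (LINT q|lborel. LINT t|lborel. g (coords i j k (t, q)) * \<psi> (coords i j k (t, q)))"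
    proof (rule integral_cong_AE)
      show "(\<lambda>q. LINT t|lborel. prim i g (coords i j k (t, q)) * \<phi> (coords i j k (t, q))) \<in> borel_measurable lborel"
        using integral_coords(3)[OF d pint] by simp
      show "(\<lambda>q. LINT t|lborel. g (coords i j k (t, q)) * \<psi> (coords i j k (t, q))) \<in> borel_measurable lborel"
        using integral_coords(3)[OF d gint] by simp
      show "AE q in lborel. (LINT t|lborel. prim i g (coords i j k (t, q)) * \<phi> (coords i j k (t, q))) =
         (LINT t|lborel. g (coords i j k (t, q)) * \<psi> (coords i j k (t, q)))"
        using integral_coords(2)[OF d g]
      proof eventually_elim
        case (elim q)
        let ?g = "\<lambda>s. g (coords i j k (s, q))"
        have pq: "prim i g (coords i j k (t, q)) = prim1 ?g t" for t
          unfolding prim_def upd_coords_first by (simp add: coords_def split: prod.split)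
        have "(LINT t|lborel. prim i g (coords i j k (t, q)) * \<phi> (coords i j k (t, q))) =
           (LINT t|lborel. prim1 ?g t * b i t * R q)"
          unfolding pq \<phi>q by (simp add: mult.assoc)
        also have "\<dots> = (LINT t|lborel. prim1 ?g t * b i t) * R q" by simp
        also have "\<dots> = (LINT s|lborel. ?g s * B s) * R q"
          unfolding B_def prim1_fubini[OF elim bint] ..
        also have "\<dots> = (LINT s|lborel. ?g s * B s * R q)" by simp
        finally show ?case unfolding \<psi>q by (simp add: mult.assoc)
      qed
    qed
    also have "\<dots> = (LINT x|lborel. g x * \<psi> x)"
      by (rule integral_coords(1)[OF d gint, symmetric])
    also have "\<dots> = (LINT x|lborel. w x * \<phi> x)"
      unfolding \<psi>_def \<phi>_def B_def b_def using weak_partial_tail[OF w g wp, of n l v] by simp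
    finally show "(LINT x|lborel. (w x - prim i g x) * box_bump n l v x) = 0"
      using wi pint unfolding \<phi>_def by (simp add: left_diff_distrib)
  qed
  then show ?thesis by eventually_elim simp
qed

lemma weak_partial_chain_bound:
  fixes h h' :: "real \<Rightarrow> real"
  assumes w: "integrable lborel w" and g: "integrable lborel g" and wp: "weak_partial i w g"
    and h: "\<And>y. (h has_real_derivative h' y) (at y)"
    and h': "continuous_on UNIV h'" and h0: "h 0 = 0"
  shows "AE x in lborel. ennreal \<bar>h (w x)\<bar> \<le> (\<integral>\<^sup>+s. ennreal (\<bar>h' (w (upd x i s))\<bar> * \<bar>g (upd x i s)\<bar>) \<partial>lborel)"
proof -
  have [measurable]: "w \<in> borel_measurable borel" "g \<in> borel_measurable borel" using w g by auto
  note p = weak_partial_prim[OF w g wp]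
  have "AE x in lborel. AE s in lborel. w (upd x i s) = prim i g (upd x i s)"
    by (rule AE_line[OF _ p]) simp
  with p AE_integrable_line[OF g, of i] show ?thesis
  proof eventually_elim
    case (elim x)
    let ?g = "\<lambda>s. g (upd x i s)"
    have pr: "prim i g (upd x i s) = prim1 ?g s" for s
      by (simp add: prim_def upd_upd upd_nth)
    have "ennreal \<bar>h (w x)\<bar> = ennreal \<bar>h (prim1 ?g (x $ i))\<bar>"
      using elim(1) by (simp add: prim_def)
    also have "\<dots> \<le> (\<integral>\<^sup>+s. ennreal (\<bar>h' (prim1 ?g s)\<bar> * \<bar>?g s\<bar>) \<partial>lborel)"
      by (rule chain_bound[OF elim(2) h h' h0])
    also have "\<dots> = (\<integral>\<^sup>+s. ennreal (\<bar>h' (w (upd x i s))\<bar> * \<bar>g (upd x i s)\<bar>) \<partial>lborel)"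
      using elim(3) by (intro nn_integral_cong_AE) (auto simp: pr)
    finally show ?case .
  qed
qed

lemma nn_integral_Fatou_bound:
  assumes [measurable]: "\<And>n. f n \<in> borel_measurable M" and lim: "\<And>x. (\<lambda>n. f n x) \<longlonglongrightarrow> F x"
    and bound: "\<And>n. (\<integral>\<^sup>+x. ennreal (f n x) \<partial>M) \<le> ennreal (B n)" and B: "B \<longlonglongrightarrow> L"
  shows "(\<integral>\<^sup>+x. ennreal (F x) \<partial>M) \<le> ennreal L"
proof -
  have "(\<integral>\<^sup>+x. ennreal (F x) \<partial>M) = (\<integral>\<^sup>+x. liminf (\<lambda>n. ennreal (f n x)) \<partial>M)"
    by (intro nn_integral_cong lim_imp_Liminf[symmetric] tendsto_ennrealI lim) simp
  also have "\<dots> \<le> liminf (\<lambda>n. \<integral>\<^sup>+x. ennreal (f n x) \<partial>M)"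
    by (rule nn_integral_liminf) simp
  also have "\<dots> \<le> liminf (\<lambda>n. ennreal (B n))"
    by (intro Liminf_mono always_eventually allI bound)
  also have "\<dots> = ennreal L"
    by (intro lim_imp_Liminf tendsto_ennrealI B) simp
  finally show ?thesis .
qed

section \<open>The Sobolev inequality for integrable functions\<close>

text \<open>A regularisation of \<open>y\<^sup>2\<close>. It is chosen so that \<open>h = (reg6 \<epsilon>)\<^sup>2\<close>, a bounded version of \<open>y\<^sup>4\<close>, satisfies
  \<open>(h')\<^sup>2 \<le> 16 (reg6 \<epsilon>)\<^sup>3\<close>, while \<open>(reg6 \<epsilon>)\<^sup>3 \<le> (y/\<epsilon>)\<^sup>2\<close> is integrable for square integrable arguments.\<close>

definition reg6 :: "real \<Rightarrow> real \<Rightarrow> real" where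
  "reg6 \<epsilon> y = y\<^sup>2 / (1 + \<epsilon> * y\<^sup>2)"

lemma reg6_DERIV:
  assumes "\<epsilon> > 0"
  shows "((\<lambda>y. (reg6 \<epsilon> y)\<^sup>2) has_real_derivative 4 * y ^ 3 / (1 + \<epsilon> * y\<^sup>2) ^ 3) (at y)"
proof -
  have nz: "1 + \<epsilon> * y\<^sup>2 > 0" using assms by (simp add: add_pos_nonneg)
  have "(reg6 \<epsilon> has_real_derivative (2 * y * (1 + \<epsilon> * y\<^sup>2) - y\<^sup>2 * (\<epsilon> * (2 * y))) / (1 + \<epsilon> * y\<^sup>2)\<^sup>2) (at y)"
    unfolding reg6_def[abs_def] using nz
    by (auto intro!: derivative_eq_intros simp: power2_eq_square)
  also have "(2 * y * (1 + \<epsilon> * y\<^sup>2) - y\<^sup>2 * (\<epsilon> * (2 * y))) = 2 * y" by (simp add: algebra_simps)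
  finally have "(reg6 \<epsilon> has_real_derivative 2 * y / (1 + \<epsilon> * y\<^sup>2)\<^sup>2) (at y)" .
  from DERIV_power[OF this, of 2]
  have "((\<lambda>y. (reg6 \<epsilon> y)\<^sup>2) has_real_derivative 2 * (2 * y / (1 + \<epsilon> * y\<^sup>2)\<^sup>2 * reg6 \<epsilon> y)) (at y)"
    by simp
  also have "2 * (2 * y / (1 + \<epsilon> * y\<^sup>2)\<^sup>2 * reg6 \<epsilon> y) = 4 * y ^ 3 / (1 + \<epsilon> * y\<^sup>2) ^ 3"
    using nz by (simp add: reg6_def power2_eq_square power3_eq_cube)
  finally show ?thesis .
qed

text \<open>With \<open>N = \<integral> reg6 \<epsilon> (w)\<^sup>3\<close>, the chain rule bound for \<open>h(w) = reg6 \<epsilon> (w)\<^sup>2\<close> on lines, the Loomis-Whitney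
  inequality and the Cauchy-Schwarz inequality give \<open>N\<^sup>4 \<le> 16\<^sup>3 N\<^sup>3 \<Prod>\<^sub>i \<integral>g\<^sub>i\<^sup>2\<close>. As \<open>N\<close> is finite it can be
  cancelled; then \<open>\<epsilon> \<rightarrow> 0\<close>.\<close>

lemma sobolev_integrable:
  fixes w :: fn3 and g :: "3 \<Rightarrow> fn3"
  assumes w: "integrable lborel w" "integrable lborel (\<lambda>x. (w x)\<^sup>2)"
    and g: "\<And>i. integrable lborel (g i)" "\<And>i. integrable lborel (\<lambda>x. (g i x)\<^sup>2)"
    and wp: "\<And>i. weak_partial i w (g i)"
  shows "(\<integral>\<^sup>+x. ennreal (w x ^ 6) \<partial>lborel) \<le> ennreal (4096 * (\<Prod>i\<in>UNIV. LINT x|lborel. (g i x)\<^sup>2))"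
proof -
  have [measurable]: "w \<in> borel_measurable borel" "\<And>i. g i \<in> borel_measurable borel" using w g by auto
  define \<Gamma> where "\<Gamma> = (\<Prod>i\<in>UNIV. LINT x|lborel. (g i x)\<^sup>2)"
  have \<Gamma>: "\<Gamma> \<ge> 0" unfolding \<Gamma>_def by (intro prod_nonneg) simp
  have main: "(\<integral>\<^sup>+x. ennreal (reg6 \<epsilon> (w x) ^ 3) \<partial>lborel) \<le> ennreal (4096 * \<Gamma>)" if \<epsilon>: "\<epsilon> > 0" for \<epsilon>
  proof -
    define h' where "h' y = 4 * y ^ 3 / (1 + \<epsilon> * y\<^sup>2) ^ 3" for y :: real
    have pos: "1 + \<epsilon> * y\<^sup>2 > 0" for y :: real using \<epsilon> by (simp add: add_pos_nonneg)
    have h'c: "continuous_on UNIV h'"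
      unfolding h'_def using pos by (intro continuous_intros) (metis less_numeral_extra(3) power_eq_0_iff)
    have [measurable]: "reg6 \<epsilon> \<in> borel_measurable borel" unfolding reg6_def[abs_def] by measurable
    have [measurable]: "h' \<in> borel_measurable borel" using h'c by (rule borel_measurable_continuous_onI)
    have r0: "reg6 \<epsilon> y \<ge> 0" for y using pos[of y] by (simp add: reg6_def)
    have h'sq: "(h' y)\<^sup>2 \<le> 16 * reg6 \<epsilon> y ^ 3" for y
    proof -
      let ?d = "1 + \<epsilon> * y\<^sup>2"
      have "?d ^ 3 \<le> ?d ^ 6" using \<epsilon> by (intro power_increasing) auto
      then have "16 * y ^ 6 / ?d ^ 6 \<le> 16 * y ^ 6 / ?d ^ 3"
        using pos[of y] by (intro divide_left_mono) auto
      then show ?thesis by (simp add: h'_def reg6_def power_divide power_mult_distrib flip: power_mult)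
    qed
    define f where "f i x = ennreal (\<bar>h' (w x)\<bar> * \<bar>g i x\<bar>)" for i x
    have [measurable]: "f i \<in> borel_measurable borel" for i unfolding f_def by measurable
    define N where "N = (LINT x|lborel. reg6 \<epsilon> (w x) ^ 3)"
    have "reg6 \<epsilon> y ^ 3 \<le> (1 / \<epsilon>)\<^sup>2 * y\<^sup>2" for y
    proof -
      have 1: "reg6 \<epsilon> y \<le> y\<^sup>2"
        using pos[of y] \<epsilon> unfolding reg6_def by (simp add: divide_le_eq mult_le_cancel_left1)
      have 2: "reg6 \<epsilon> y \<le> 1 / \<epsilon>"
        using pos[of y] \<epsilon> unfolding reg6_def by (simp add: field_simps)
      have "(reg6 \<epsilon> y)\<^sup>2 * reg6 \<epsilon> y \<le> (1 / \<epsilon>)\<^sup>2 * y\<^sup>2"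
        using 1 2 r0[of y] by (intro mult_mono power_mono) auto
      then show ?thesis by (simp add: power3_eq_cube power2_eq_square mult.assoc)
    qed
    then have Nint: "integrable lborel (\<lambda>x. reg6 \<epsilon> (w x) ^ 3)"
      using r0 by (intro Bochner_Integration.integrable_bound[OF integrable_mult_right[OF w(2), of "(1 / \<epsilon>)\<^sup>2"]])
        (auto intro!: AE_I2)
    then have N: "(\<integral>\<^sup>+x. ennreal (reg6 \<epsilon> (w x) ^ 3) \<partial>lborel) = ennreal N"
      unfolding N_def using r0 by (intro nn_integral_eq_integral) auto
    have N0: "N \<ge> 0" unfolding N_def using r0 by simp
    have "(\<integral>\<^sup>+x. ennreal (reg6 \<epsilon> (w x) ^ 3) \<partial>lborel)\<^sup>2 \<le> (\<Prod>i\<in>UNIV. \<integral>\<^sup>+x. f i x \<partial>lborel)"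
    proof (rule loomis_whitney)
      show "AE x in lborel. ennreal ((reg6 \<epsilon> (w x))\<^sup>2) \<le> (\<integral>\<^sup>+t. f i (upd x i t) \<partial>lborel)" for i
        using weak_partial_chain_bound[OF w(1) g(1) wp reg6_DERIV[OF \<epsilon>, folded h'_def] h'c, of i]
        by (simp add: f_def reg6_def)
    qed (use r0 in auto)
    then have "(ennreal N ^ 2)\<^sup>2 \<le> (\<Prod>i\<in>UNIV. \<integral>\<^sup>+x. f i x \<partial>lborel)\<^sup>2"
      unfolding N by (rule power_mono) simp
    also have "\<dots> = (\<Prod>i\<in>UNIV. (\<integral>\<^sup>+x. f i x \<partial>lborel)\<^sup>2)" by (rule prod_power_distrib)
    also have "\<dots> \<le> (\<Prod>i\<in>UNIV. ennreal (16 * N * (LINT x|lborel. (g i x)\<^sup>2)))"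
    proof (rule prod_mono_ennreal)
      fix i :: 3
      have "(\<integral>\<^sup>+x. f i x \<partial>lborel)\<^sup>2 = (\<integral>\<^sup>+x. ennreal \<bar>h' (w x)\<bar> * ennreal \<bar>g i x\<bar> \<partial>lborel)\<^sup>2"
        by (simp add: f_def ennreal_mult)
      also have "\<dots> \<le> (\<integral>\<^sup>+x. (ennreal \<bar>h' (w x)\<bar>)\<^sup>2 \<partial>lborel) * (\<integral>\<^sup>+x. (ennreal \<bar>g i x\<bar>)\<^sup>2 \<partial>lborel)"
        by (rule Cauchy_Schwarz_nn_integral) auto
      also have "(\<integral>\<^sup>+x. (ennreal \<bar>h' (w x)\<bar>)\<^sup>2 \<partial>lborel) \<le> (\<integral>\<^sup>+x. ennreal (16 * reg6 \<epsilon> (w x) ^ 3) \<partial>lborel)"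
        by (intro nn_integral_mono) (simp add: ennreal_power ennreal_leI h'sq)
      also have "\<dots> = ennreal (16 * N)"
        using Nint r0 by (subst nn_integral_eq_integral) (auto simp: N_def)
      also have "(\<integral>\<^sup>+x. (ennreal \<bar>g i x\<bar>)\<^sup>2 \<partial>lborel) = ennreal (LINT x|lborel. (g i x)\<^sup>2)"
        using g(2) by (simp add: ennreal_power nn_integral_eq_integral)
      also have "ennreal (16 * N) * ennreal (LINT x|lborel. (g i x)\<^sup>2) = ennreal (16 * N * (LINT x|lborel. (g i x)\<^sup>2))"
        using N0 by (simp add: ennreal_mult)
      finally show "(\<integral>\<^sup>+x. f i x \<partial>lborel)\<^sup>2 \<le> ennreal (16 * N * (LINT x|lborel. (g i x)\<^sup>2))"
        by (simp add: mult_right_mono)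
    qed
    also have "\<dots> = ennreal (\<Prod>i\<in>UNIV. 16 * N * (LINT x|lborel. (g i x)\<^sup>2))"
      using N0 by (intro prod_ennreal) auto
    also have "(\<Prod>i\<in>UNIV. 16 * N * (LINT x|lborel. (g i x)\<^sup>2)) = 4096 * N ^ 3 * \<Gamma>"
      unfolding \<Gamma>_def by (simp add: prod.distrib power_mult_distrib)
    finally have "ennreal (N ^ 4) \<le> ennreal (4096 * N ^ 3 * \<Gamma>)"
      using N0 by (simp add: ennreal_power flip: power_mult)
    then have le: "N ^ 4 \<le> 4096 * N ^ 3 * \<Gamma>"
      using N0 \<Gamma> by (simp add: ennreal_le_iff)
    have "N \<le> 4096 * \<Gamma>"
    proof (cases "N = 0")
      case False
      then have "N ^ 3 > 0" using N0 by simp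
      moreover have "N ^ 3 * N \<le> N ^ 3 * (4096 * \<Gamma>)" using le by (simp add: power4_eq_xxxx power3_eq_cube mult_ac)
      ultimately show ?thesis by (simp only: mult_le_cancel_left_pos)
    qed (use \<Gamma> in simp)
    then show ?thesis unfolding N by (rule ennreal_leI)
  qed
  show ?thesis unfolding \<Gamma>_def[symmetric]
  proof (rule nn_integral_Fatou_bound[where f="\<lambda>n x. reg6 (1 / real (Suc n)) (w x) ^ 3" and B="\<lambda>_. 4096 * \<Gamma>"])
    show "(\<lambda>x. reg6 (1 / real (Suc n)) (w x) ^ 3) \<in> borel_measurable lborel" for n
      unfolding reg6_def by measurable
    show "(\<lambda>n. reg6 (1 / real (Suc n)) (w x) ^ 3) \<longlonglongrightarrow> w x ^ 6" for x
    proof -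
      have "(\<lambda>n. ((w x)\<^sup>2 / (1 + 1 / real (Suc n) * (w x)\<^sup>2)) ^ 3) \<longlonglongrightarrow> ((w x)\<^sup>2 / (1 + 0 * (w x)\<^sup>2)) ^ 3"
        by (intro tendsto_intros over_Suc_tendsto_0) simp
      then show ?thesis by (simp add: reg6_def flip: power_mult)
    qed
  qed (auto intro!: main)
qed

section \<open>Cutting off functions in \<open>H1\<close>\<close>

text \<open>The cut-off function on the space.\<close>

definition box_cutoff :: "nat \<Rightarrow> fn3" where
  "box_cutoff n = tens (\<lambda>_. cutoff n)"

lemma test_fun_box_cutoff: "test_fun (box_cutoff n)"
  unfolding box_cutoff_def
  by (intro test_fun_tens[where l="\<chi> i. - real (Suc n)" and u="\<chi> i. real (Suc n)"] smooth1_cutoff cutoff_outside) auto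

lemma smooth_box_cutoff: "smooth (box_cutoff n)"
  using test_fun_box_cutoff by (simp add: test_fun_def)

lemma box_cutoff_bounds: "0 \<le> box_cutoff n x" "box_cutoff n x \<le> 1"
  unfolding box_cutoff_def tens_def using cutoff_bounds by (auto intro!: prod_nonneg prod_le_1)

lemma box_cutoff_tendsto: "(\<lambda>n. box_cutoff n x) \<longlonglongrightarrow> 1"
proof -
  have "(\<lambda>n. \<Prod>i\<in>(UNIV :: 3 set). cutoff n (x $ i)) \<longlonglongrightarrow> (\<Prod>i\<in>(UNIV :: 3 set). 1)"
    by (intro tendsto_prod cutoff_tendsto)
  then show ?thesis by (simp add: box_cutoff_def tens_def)
qed

text \<open>The gradient of the cut-off function.\<close>

definition grad_cutoff :: "nat \<Rightarrow> real^3 \<Rightarrow> real^3" where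
  "grad_cutoff n x = (\<chi> i. partial_deriv i (box_cutoff n) x)"

lemma grad_cutoff_bound:
  obtains C where "C \<ge> 0" "\<And>n x. norm (grad_cutoff n x) \<le> C / real (Suc n)"
proof -
  obtain C where C: "C \<ge> 0" "\<And>n t. \<bar>deriv (cutoff n) t\<bar> \<le> C / real (Suc n)"
    by (rule cutoff_deriv_bound) blast
  have "\<bar>partial_deriv i (box_cutoff n) x\<bar> \<le> C / real (Suc n) * 1" for i n x
    unfolding box_cutoff_def partial_deriv_tens[OF smooth1_cutoff] tens_upd abs_mult
    using C cutoff_bounds by (intro mult_mono) (auto simp: abs_prod intro!: prod_le_1 prod_nonneg)
  then have "norm (grad_cutoff n x) \<le> (\<Sum>i\<in>(UNIV :: 3 set). C / real (Suc n))" for n x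
    by (intro order_trans[OF norm_le_l1_cart] sum_mono) (simp add: grad_cutoff_def)
  then show ?thesis using C by (intro that[of "3 * C"]) auto
qed

lemma borel_measurable_vec_lambda:
  fixes f :: "3 \<Rightarrow> 'a \<Rightarrow> real"
  assumes "\<And>i. f i \<in> borel_measurable M"
  shows "(\<lambda>x. \<chi> i. f i x) \<in> borel_measurable M"
proof -
  have "(\<lambda>x. (\<chi> i. f i x) \<bullet> b) \<in> borel_measurable M" if b: "b \<in> Basis" for b
  proof -
    obtain i where "b = axis i 1" using b by (auto simp: Basis_vec_def)
    then show ?thesis using assms by (simp add: inner_axis)
  qed
  then show ?thesis by (subst borel_measurable_euclidean_space) blast
qed

lemma grad_cutoff_measurable[measurable]: "grad_cutoff n \<in> borel_measurable borel"
  unfolding grad_cutoff_def[abs_def]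
  by (intro borel_measurable_vec_lambda smooth_measurable smooth_partial_deriv smooth_box_cutoff)

lemma box_cutoff_measurable[measurable]: "box_cutoff n \<in> borel_measurable borel"
  by (intro smooth_measurable smooth_box_cutoff)

lemma locally_integrable_bounded_mult:
  fixes f :: "real^3 \<Rightarrow> 'b::{banach, second_countable_topology}"
    and F :: "real^3 \<Rightarrow> 'c::{banach, second_countable_topology}"
  assumes f: "locally_integrable f" and F[measurable]: "F \<in> borel_measurable borel"
    and le: "\<And>x. norm (F x) \<le> K * norm (f x)"
  shows "locally_integrable F"
  unfolding locally_integrable_def
proof (intro conjI allI impI)
  fix A :: "(real^3) set" assume A: "compact A"
  then have [measurable]: "A \<in> sets borel" by (simp add: borel_closed compact_imp_closed)
  have "integrable lborel (\<lambda>x. indicator A x *\<^sub>R f x)"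
    using f A by (simp add: locally_integrable_def set_integrable_def)
  then have "integrable lborel (\<lambda>x. K * norm (indicator A x *\<^sub>R f x))"
    by (intro integrable_mult_right integrable_norm)
  then show "set_integrable lborel A F"
    unfolding set_integrable_def
  proof (rule Bochner_Integration.integrable_bound)
    show "AE x in lborel. norm (indicator A x *\<^sub>R F x) \<le> norm (K * norm (indicator A x *\<^sub>R f x))"
      using le by (intro AE_I2) (auto split: split_indicator intro: order_trans[OF _ abs_ge_self])
  qed measurable
qed simp

lemma locally_integrable_add:
  assumes "locally_integrable f" "locally_integrable g"
  shows "locally_integrable (\<lambda>x. f x + g x)"
  using assms by (auto simp: locally_integrable_def intro!: set_integral_add)

lemma weak_gradient_cutoff:
  assumes wg: "weak_gradient u G"
  shows "weak_gradient (\<lambda>x. box_cutoff n x * u x) (\<lambda>x. box_cutoff n x *\<^sub>R G x + u x *\<^sub>R grad_cutoff n x)"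
  unfolding weak_gradient_def
proof (intro conjI allI impI)
  note [measurable] = weak_gradient_measurable[OF wg]
  obtain C where C: "C \<ge> 0" "\<And>n x. norm (grad_cutoff n x) \<le> C / real (Suc n)"
    by (rule grad_cutoff_bound) blast
  have lu: "locally_integrable u" and lG: "locally_integrable G" using wg by (auto simp: weak_gradient_def)
  show "locally_integrable (\<lambda>x. box_cutoff n x * u x)"
    by (rule locally_integrable_bounded_mult[OF lu, of _ 1])
       (use box_cutoff_bounds in \<open>auto simp: abs_mult intro!: mult_left_le_one_le\<close>)
  have "locally_integrable (\<lambda>x. box_cutoff n x *\<^sub>R G x)"
    by (rule locally_integrable_bounded_mult[OF lG, of _ 1])
       (use box_cutoff_bounds in \<open>auto intro!: mult_left_le_one_le\<close>)
  moreover have "locally_integrable (\<lambda>x. u x *\<^sub>R grad_cutoff n x)"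
  proof (rule locally_integrable_bounded_mult[OF lu])
    have "norm (grad_cutoff n x) * \<bar>u x\<bar> \<le> C / real (Suc n) * \<bar>u x\<bar>" for x
      by (intro mult_right_mono C(2)) simp
    then show "norm (u x *\<^sub>R grad_cutoff n x) \<le> C / real (Suc n) * norm (u x)" for x
      by (simp add: mult.commute)
  qed measurable
  ultimately show "locally_integrable (\<lambda>x. box_cutoff n x *\<^sub>R G x + u x *\<^sub>R grad_cutoff n x)"
    by (rule locally_integrable_add)
  fix \<phi> i assume \<phi>: "test_fun \<phi>"
  then have s: "smooth \<phi>" by (simp add: test_fun_def)
  have t1: "test_fun (\<lambda>x. box_cutoff n x * \<phi> x)" by (rule test_fun_mult(1)[OF smooth_box_cutoff \<phi>])
  have t2: "test_fun (\<lambda>x. partial_deriv i (box_cutoff n) x * \<phi> x)"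
    by (rule test_fun_mult(1)[OF smooth_partial_deriv[OF smooth_box_cutoff] \<phi>])
  have pd: "partial_deriv i (\<lambda>x. box_cutoff n x * \<phi> x) =
     (\<lambda>x. box_cutoff n x * partial_deriv i \<phi> x + partial_deriv i (box_cutoff n) x * \<phi> x)"
    by (intro partial_deriv_mult smooth_differentiable smooth_box_cutoff s)
  note ul = loc_integrable_test_fun[OF weak_gradient_measurable(1)[OF wg] locally_integrable_cbox[OF lu]]
  note lGi = locally_integrable_component[OF lG, of i]
  have mGi: "(\<lambda>x. G x $ i) \<in> borel_measurable borel" by measurable
  note Gl = loc_integrable_test_fun[OF mGi locally_integrable_cbox[OF lGi]]
  have "(LINT x|lborel. box_cutoff n x * u x * partial_deriv i \<phi> x) =
     (LINT x|lborel. u x * partial_deriv i (\<lambda>x. box_cutoff n x * \<phi> x) x -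
        u x * (partial_deriv i (box_cutoff n) x * \<phi> x))"
    unfolding pd by (intro Bochner_Integration.integral_cong) (auto simp: algebra_simps)
  also have "\<dots> = (LINT x|lborel. u x * partial_deriv i (\<lambda>x. box_cutoff n x * \<phi> x) x) -
        (LINT x|lborel. u x * (partial_deriv i (box_cutoff n) x * \<phi> x))"
    by (intro Bochner_Integration.integral_diff ul t2 test_fun_partial_deriv t1)
  also have "(LINT x|lborel. u x * partial_deriv i (\<lambda>x. box_cutoff n x * \<phi> x) x) =
       - (LINT x|lborel. G x $ i * (box_cutoff n x * \<phi> x))"
    using wg t1 by (simp add: weak_gradient_def)
  also have "- (LINT x|lborel. G x $ i * (box_cutoff n x * \<phi> x)) -
        (LINT x|lborel. u x * (partial_deriv i (box_cutoff n) x * \<phi> x)) =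
      - ((LINT x|lborel. G x $ i * (box_cutoff n x * \<phi> x)) +
        (LINT x|lborel. u x * (partial_deriv i (box_cutoff n) x * \<phi> x)))" by simp
  also have "\<dots> = - (LINT x|lborel. G x $ i * (box_cutoff n x * \<phi> x) +
        u x * (partial_deriv i (box_cutoff n) x * \<phi> x))"
    by (subst Bochner_Integration.integral_add) (auto intro!: ul Gl t1 t2)
  also have "\<dots> = - (LINT x|lborel. (box_cutoff n x *\<^sub>R G x + u x *\<^sub>R grad_cutoff n x) $ i * \<phi> x)"
    by (simp add: grad_cutoff_def algebra_simps)
  finally show "(LINT x|lborel. box_cutoff n x * u x * partial_deriv i \<phi> x) =
     - (LINT x|lborel. (box_cutoff n x *\<^sub>R G x + u x *\<^sub>R grad_cutoff n x) $ i * \<phi> x)" .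
qed

section \<open>The Sobolev inequality on \<open>H1\<close>\<close>

lemma grad_component_square_le: "(v $ i)\<^sup>2 \<le> (norm v)\<^sup>2" for v :: "real^3"
  using component_le_norm_cart[of v i] by (metis abs_ge_zero power2_abs power_mono)

text \<open>The Sobolev inequality holds for the truncations of \<open>u\<close>, and their gradient norms converge to that
  of \<open>u\<close>.\<close>

lemma cutoff_H1:
  assumes u: "u \<in> H1"
  defines "v \<equiv> \<lambda>n x. box_cutoff n x * u x"
  shows "v n \<in> H1" "integrable lborel (v n)"
    and "(\<lambda>n. (grad_norm (v n))\<^sup>2) \<longlonglongrightarrow> (grad_norm u)\<^sup>2"
    and "(\<integral>\<^sup>+x. ennreal (v n x ^ 6) \<partial>lborel) \<le> ennreal (4096 * ((grad_norm (v n))\<^sup>2) ^ 3)"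
proof -
  note w = H1_wgrad[OF u]
  note [measurable] = w(3) weak_gradient_measurable(2)[OF w(1)]
  define G where "G n x = box_cutoff n x *\<^sub>R wgrad u x + u x *\<^sub>R grad_cutoff n x" for n x
  have [measurable]: "G n \<in> borel_measurable borel" "v n \<in> borel_measurable borel" for n
    unfolding G_def v_def by measurable
  have wg: "weak_gradient (v n) (G n)" for n
    unfolding v_def G_def by (rule weak_gradient_cutoff[OF w(1)])
  obtain C where C: "C \<ge> 0" "\<And>n x. norm (grad_cutoff n x) \<le> C / real (Suc n)"
    by (rule grad_cutoff_bound) blast
  have C': "norm (grad_cutoff n x) \<le> C" for n x
  proof -
    have "C / real (Suc n) \<le> C" using C(1) by (simp add: divide_le_eq algebra_simps)
    then show ?thesis using C(2)[of n x] by linarith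
  qed
  define D where "D x = 2 * (norm (wgrad u x))\<^sup>2 + 2 * C\<^sup>2 * (u x)\<^sup>2" for x
  have D: "integrable lborel D" unfolding D_def using w by auto
  have GD: "(norm (G n x))\<^sup>2 \<le> D x" for n x
  proof -
    have "norm (G n x) \<le> 1 * norm (wgrad u x) + \<bar>u x\<bar> * C"
      unfolding G_def using box_cutoff_bounds[of n x] C'[of n x]
      by (intro norm_triangle_le add_mono) (auto intro!: mult_mono mult_left_le_one_le)
    then have "(norm (G n x))\<^sup>2 \<le> (norm (wgrad u x) + \<bar>u x\<bar> * C)\<^sup>2"
      by (intro power_mono) auto
    also have "\<dots> \<le> 2 * (norm (wgrad u x))\<^sup>2 + 2 * (\<bar>u x\<bar> * C)\<^sup>2"
      using sum_squares_bound[of "norm (wgrad u x)" "\<bar>u x\<bar> * C"] by (simp add: power2_sum)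
    finally show ?thesis by (simp add: D_def power_mult_distrib mult_ac)
  qed
  have Gint: "integrable lborel (\<lambda>x. (norm (G n x))\<^sup>2)" for n
    by (rule Bochner_Integration.integrable_bound[OF D]) (use GD in \<open>auto intro!: AE_I2 intro: order_trans[OF _ abs_ge_self]\<close>)
  have vsq: "integrable lborel (\<lambda>x. (v n x)\<^sup>2)" for n
  proof (rule Bochner_Integration.integrable_bound[OF w(4)])
    show "AE x in lborel. norm ((v n x)\<^sup>2) \<le> norm ((u x)\<^sup>2)"
    proof (rule AE_I2)
      fix x
      have "\<bar>v n x\<bar> \<le> \<bar>u x\<bar>" unfolding v_def abs_mult
        using box_cutoff_bounds[of n x] by (auto intro!: mult_left_le_one_le)
      then show "norm ((v n x)\<^sup>2) \<le> norm ((u x)\<^sup>2)" by (simp add: abs_le_square_iff)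
    qed
  qed simp
  show "v n \<in> H1" for n by (rule H1_I[OF wg vsq Gint])
  have lu: "set_integrable lborel (cbox l m) u" for l m
    using w(1) by (intro locally_integrable_cbox) (simp add: weak_gradient_def)
  have lG: "set_integrable lborel (cbox l m) (\<lambda>x. wgrad u x $ i)" for l m i
    using w(1) by (intro locally_integrable_cbox locally_integrable_component) (simp add: weak_gradient_def)
  show vint: "integrable lborel (v n)" for n
    unfolding v_def using loc_integrable_test_fun[OF w(3) lu test_fun_box_cutoff] by (simp add: mult.commute)
  have gn: "(grad_norm (v n))\<^sup>2 = (LINT x|lborel. (norm (G n x))\<^sup>2)" for n
    by (rule grad_norm_square[OF wg])
  show "(\<lambda>n. (grad_norm (v n))\<^sup>2) \<longlonglongrightarrow> (grad_norm u)\<^sup>2"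
    unfolding gn grad_norm_square[OF w(1)]
  proof (rule integral_dominated_convergence[OF _ _ D])
    show "AE x in lborel. (\<lambda>n. (norm (G n x))\<^sup>2) \<longlonglongrightarrow> (norm (wgrad u x))\<^sup>2"
    proof (rule AE_I2)
      fix x
      have "(\<lambda>n. norm (grad_cutoff n x)) \<longlonglongrightarrow> 0"
        by (rule Lim_null_comparison[OF _ over_Suc_tendsto_0[of C]]) (use C(2) in auto)
      then have "(\<lambda>n. grad_cutoff n x) \<longlonglongrightarrow> 0" by (rule tendsto_norm_zero_cancel)
      then have "(\<lambda>n. (norm (box_cutoff n x *\<^sub>R wgrad u x + u x *\<^sub>R grad_cutoff n x))\<^sup>2) \<longlonglongrightarrow>
         (norm (1 *\<^sub>R wgrad u x + u x *\<^sub>R 0))\<^sup>2"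
        by (intro tendsto_intros box_cutoff_tendsto)
      then show "(\<lambda>n. (norm (G n x))\<^sup>2) \<longlonglongrightarrow> (norm (wgrad u x))\<^sup>2" by (simp add: G_def)
    qed
    show "AE x in lborel. norm ((norm (G n x))\<^sup>2) \<le> D x" for n using GD by auto
  qed measurable
  have gint: "integrable lborel (\<lambda>x. G n x $ i)" for n i
  proof -
    have "integrable lborel (\<lambda>x. wgrad u x $ i * box_cutoff n x + u x * partial_deriv i (box_cutoff n) x)"
      by (intro Bochner_Integration.integrable_add loc_integrable_test_fun lu lG test_fun_box_cutoff
            test_fun_partial_deriv) measurable
    then show ?thesis by (simp add: G_def grad_cutoff_def mult.commute)
  qed
  have gsq: "integrable lborel (\<lambda>x. (G n x $ i)\<^sup>2)" for n i
    by (rule Bochner_Integration.integrable_bound[OF Gint[of n]])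
       (use grad_component_square_le in \<open>auto intro!: AE_I2\<close>)
  have "(\<integral>\<^sup>+x. ennreal (v n x ^ 6) \<partial>lborel) \<le>
     ennreal (4096 * (\<Prod>i\<in>UNIV. LINT x|lborel. (G n x $ i)\<^sup>2))"
    using wg by (intro sobolev_integrable vint vsq gint gsq) (auto simp: weak_partial_def weak_gradient_def)
  also have "\<dots> \<le> ennreal (4096 * (\<Prod>i\<in>(UNIV :: 3 set). (grad_norm (v n))\<^sup>2))"
    unfolding gn using gsq Gint grad_component_square_le
    by (intro ennreal_leI mult_left_mono prod_mono conjI integral_mono) auto
  finally show "(\<integral>\<^sup>+x. ennreal (v n x ^ 6) \<partial>lborel) \<le> ennreal (4096 * ((grad_norm (v n))\<^sup>2) ^ 3)"
    by simp
qed

lemma abs_powr_6: "\<bar>x\<bar> powr 6 = x ^ 6" for x :: real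
  by (simp flip: power_abs add: power_even_abs)

lemma sobolev_H1:
  assumes u: "u \<in> H1"
  shows "integrable lborel (\<lambda>x. u x ^ 6)" "(LINT x|lborel. u x ^ 6) \<le> 4096 * ((grad_norm u)\<^sup>2) ^ 3"
proof -
  have [measurable]: "u \<in> borel_measurable borel" using H1_wgrad[OF u] by simp
  note c = cutoff_H1[OF u]
  have "(\<integral>\<^sup>+x. ennreal (u x ^ 6) \<partial>lborel) \<le> ennreal (4096 * ((grad_norm u)\<^sup>2) ^ 3)"
  proof (rule nn_integral_Fatou_bound[OF _ _ c(4)])
    show "(\<lambda>n. (box_cutoff n x * u x) ^ 6) \<longlonglongrightarrow> u x ^ 6" for x
    proof -
      have "(\<lambda>n. (box_cutoff n x * u x) ^ 6) \<longlonglongrightarrow> (1 * u x) ^ 6"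
        by (intro tendsto_intros box_cutoff_tendsto)
      then show ?thesis by simp
    qed
    show "(\<lambda>n. 4096 * ((grad_norm (\<lambda>x. box_cutoff n x * u x))\<^sup>2) ^ 3) \<longlonglongrightarrow> 4096 * ((grad_norm u)\<^sup>2) ^ 3"
      by (intro tendsto_intros c(3))
  qed measurable
  note le = this
  show int: "integrable lborel (\<lambda>x. u x ^ 6)"
  proof (rule integrableI_nonneg)
    show "(\<integral>\<^sup>+x. ennreal (u x ^ 6) \<partial>lborel) < \<infinity>"
      using le by (rule le_less_trans) simp
  qed auto
  have "ennreal (LINT x|lborel. u x ^ 6) \<le> ennreal (4096 * ((grad_norm u)\<^sup>2) ^ 3)"
    using le int by (simp add: nn_integral_eq_integral)
  then show "(LINT x|lborel. u x ^ 6) \<le> 4096 * ((grad_norm u)\<^sup>2) ^ 3"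
    by (simp add: ennreal_le_iff)
qed

lemma sobolev_in_L6:
  assumes "u \<in> H1"
  shows "in_L 6 u" "L_norm 6 u ^ 6 = (LINT x|lborel. u x ^ 6)"
proof -
  show "in_L 6 u" unfolding in_L_def abs_powr_6
    using sobolev_H1[OF assms] H1_wgrad[OF assms] by simp
  have "L_norm 6 u ^ 6 = L_norm 6 u powr 6" by (simp add: L_norm_nonneg)
  also have "\<dots> = (LINT x|lborel. u x ^ 6)" by (simp add: L_norm_powr abs_powr_6)
  finally show "L_norm 6 u ^ 6 = (LINT x|lborel. u x ^ 6)" .
qed

lemma sobolev_L6:
  assumes "u \<in> H1"
  shows "1 / 16 * (L_norm 6 u)\<^sup>2 \<le> (grad_norm u)\<^sup>2"
proof -
  have "((L_norm 6 u)\<^sup>2) ^ 3 \<le> (16 * (grad_norm u)\<^sup>2) ^ 3"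
    using sobolev_H1(2)[OF assms] sobolev_in_L6(2)[OF assms] by (simp add: power_mult_distrib flip: power_mult)
  then have "(L_norm 6 u)\<^sup>2 \<le> 16 * (grad_norm u)\<^sup>2"
    by (rule power_le_imp_le_base[of _ 2, simplified]) simp
  then show ?thesis by simp
qed

section \<open>Compactly supported elements of \<open>W\<close>\<close>

lemma log_square_bound: "\<bar>t\<^sup>2 * ln (t\<^sup>2)\<bar> \<le> 1 + t ^ 6" for t :: real
proof (cases "t = 0")
  case False
  define s where "s = t\<^sup>2"
  have s: "s > 0" "t ^ 6 = s ^ 3" using False by (simp_all add: s_def flip: power_mult)
  have "ln s \<le> s - 1" using s ln_le_minus_one by blast
  moreover have "- ln s \<le> 1 / s - 1" using s ln_le_minus_one[of "1 / s"] by (simp add: ln_div)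
  ultimately have "s * ln s \<le> s * (s - 1)" "s * (- ln s) \<le> s * (1 / s - 1)"
    using s by (intro mult_left_mono; simp)+
  then have b: "s * ln s \<le> s\<^sup>2 - s" "- (s * ln s) \<le> 1 - s" using s by (auto simp: algebra_simps power2_eq_square)
  have "s\<^sup>2 \<le> 1 + s ^ 3 + s"
  proof (cases "s \<le> 1")
    case True
    then have "s\<^sup>2 \<le> 1" using s by (simp add: power_le_one)
    then show ?thesis using s by (simp add: add_nonneg_nonneg add_increasing2)
  next
    case False
    then have "s\<^sup>2 \<le> s ^ 3" by (intro power_increasing) auto
    then show ?thesis using s by simp
  qed
  moreover have "s ^ 3 > 0" using s by simp
  ultimately show ?thesis using b s unfolding s_def[symmetric] s(2) by linarith
qed simp

lemma integrable_indicator_compact: "compact K \<Longrightarrow> integrable lborel (indicator K :: 'a::euclidean_space \<Rightarrow> real)"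
  by (intro integrable_real_indicator) (use emeasure_compact_finite[of K] in \<open>auto simp: borel_compact\<close>)

text \<open>Elements of \<open>H1\<close> need not lie in \<open>W\<close>, because \<open>u\<^sup>2 ln u\<^sup>2\<close> can fail to be integrable where \<open>u\<close> is small.
  Truncation to a bounded set removes the obstruction.\<close>

lemma cutoff_W:
  assumes "u \<in> H1"
  shows "(\<lambda>x. box_cutoff n x * u x) \<in> W"
proof -
  let ?v = "\<lambda>x. box_cutoff n x * u x"
  have v: "?v \<in> H1" by (rule cutoff_H1(1)[OF assms])
  have [measurable]: "u \<in> borel_measurable borel" using H1_wgrad[OF assms] by simp
  obtain l r where lr: "\<And>x. x \<notin> cbox l r \<Longrightarrow> box_cutoff n x = 0"
    using test_fun_support[OF test_fun_box_cutoff] by metis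
  have "integrable lborel (\<lambda>x. (?v x)\<^sup>2 * ln ((?v x)\<^sup>2))"
  proof (rule Bochner_Integration.integrable_bound)
    have "integrable lborel (indicator (cbox l r) :: _ \<Rightarrow> real)"
      by (intro integrable_indicator_compact compact_cbox)
    then show "integrable lborel (\<lambda>x. indicator (cbox l r) x + ?v x ^ 6)"
      using sobolev_H1(1)[OF v] by (rule Bochner_Integration.integrable_add)
    show "AE x in lborel. norm ((?v x)\<^sup>2 * ln ((?v x)\<^sup>2)) \<le> norm (indicator (cbox l r) x + ?v x ^ 6)"
    proof (rule AE_I2)
      fix x
      show "norm ((?v x)\<^sup>2 * ln ((?v x)\<^sup>2)) \<le> norm (indicator (cbox l r) x + ?v x ^ 6)"
        using log_square_bound[of "?v x"] lr[of x] by (cases "x \<in> cbox l r") (auto simp del: abs_mult)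
    qed
  qed measurable
  then show ?thesis using v by (simp add: W_iff)
qed

lemma integral_partial_deriv_test_fun:
  assumes \<phi>: "test_fun \<phi>"
  shows "(LINT x|lborel. partial_deriv i \<phi> x) = 0"
proof -
  obtain j k where d: "distinct [i, j, k]" by (rule other_directions)
  let ?d = "partial_deriv i \<phi>"
  have td: "test_fun ?d" by (rule test_fun_partial_deriv[OF \<phi>])
  obtain l r where lr: "\<And>x. x \<notin> cbox l r \<Longrightarrow> \<phi> x = 0" "\<And>x. x \<notin> cbox l r \<Longrightarrow> ?d x = 0"
    using test_fun_support[OF \<phi>] by metis
  have "integrable lborel (\<lambda>x. 1 * ?d x)"
  proof (rule loc_integrable_test_fun[OF _ _ td])
    show "set_integrable lborel (cbox l m) (\<lambda>x. 1)" for l and m :: "real^3"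
      unfolding set_integrable_def
      using integrable_indicator_compact[of "cbox l m"] by simp
  qed simp
  then have int: "integrable lborel ?d" by simp
  have z: "(LINT t|lborel. ?d (coords i j k (t, q))) = 0" for q
  proof -
    let ?a = "min (l $ i) (r $ i) - 1" and ?b = "max (l $ i) (r $ i) + 1"
    let ?c = "\<lambda>t. coords i j k (t, q)"
    have c: "?c t $ i = t" for t by (simp add: coords_def split: prod.split)
    have out: "?c t \<notin> cbox l r" if "t \<notin> {l $ i .. r $ i}" for t
      using that c[of t] by (auto simp: mem_box_cart) metis+
    have ceq: "?c t = ?c 0 + t *\<^sub>R axis i 1" for t
      using d by (auto simp: coords_def vec_eq_iff axis_def split: prod.split)
    have "((\<lambda>t. \<phi> (?c t)) has_real_derivative ?d (?c t)) (at t)" for t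
    proof -
      have "(\<phi> has_derivative frechet_derivative \<phi> (at (?c t))) (at (?c t))"
        using \<phi> smooth_differentiable frechet_derivative_works by (auto simp: test_fun_def)
      moreover have "(?c has_derivative (\<lambda>h. h *\<^sub>R axis i 1)) (at t)"
        by (subst ceq) (auto intro!: derivative_eq_intros)
      ultimately have "((\<lambda>t. \<phi> (?c t)) has_derivative (\<lambda>h. frechet_derivative \<phi> (at (?c t)) (h *\<^sub>R axis i 1))) (at t)"
        by (intro has_derivative_compose[of ?c _ t UNIV \<phi>])
      moreover have "frechet_derivative \<phi> (at (?c t)) (h *\<^sub>R axis i 1) = ?d (?c t) * h" for h
        using linear_frechet_derivative[of \<phi> "at (?c t)"] \<phi>
        by (auto simp: partial_deriv_def linear_cmul test_fun_def smooth_differentiable)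
      ultimately show ?thesis by (simp add: has_field_derivative_def)
    qed
    moreover have "isCont (\<lambda>t. ?d (?c t)) t" for t
    proof -
      have "continuous_on UNIV ?d" using td by (intro smooth_continuous) (simp add: test_fun_def)
      moreover have "continuous_on UNIV ?c"
        by (subst ceq) (intro continuous_intros)
      ultimately have "continuous_on UNIV (\<lambda>t. ?d (?c t))"
        using continuous_on_compose2 by blast
      then show ?thesis by (simp add: continuous_on_eq_continuous_at)
    qed
    ultimately have "has_bochner_integral lborel (\<lambda>t. ?d (?c t) * indicator {?a .. ?b} t) (\<phi> (?c ?b) - \<phi> (?c ?a))"
      by (intro has_bochner_integral_FTC_Icc_real) auto
    moreover have "?d (?c t) * indicator {?a .. ?b} t = ?d (?c t)" for t
      proof (cases "t \<in> {l $ i .. r $ i}")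
        case True
        then have "t \<in> {?a .. ?b}" by auto
        then show ?thesis by simp
      qed (simp add: lr(2)[OF out])
    moreover have "\<phi> (?c ?b) = 0" "\<phi> (?c ?a) = 0" by (rule lr(1)[OF out]; auto)+
    ultimately show ?thesis by (simp add: has_bochner_integral_integral_eq)
  qed
  show ?thesis unfolding integral_coords(1)[OF d int] z by simp
qed

lemma box_cutoff_H1: "box_cutoff n \<in> H1"
proof -
  have one: "locally_integrable (\<lambda>x :: real^3. 1 :: real)"
    unfolding locally_integrable_def
  proof (intro conjI allI impI)
    fix K :: "(real^3) set" assume "compact K"
    then show "set_integrable lborel K (\<lambda>x. 1 :: real)"
      unfolding set_integrable_def
      using integrable_indicator_compact[of K] by simp
  qed simp
  have lin: "\<And>l m. set_integrable lborel (cbox l m) (\<lambda>x :: real^3. 1 :: real)"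
    using one by (rule locally_integrable_cbox)
  have "weak_gradient (\<lambda>x. 1) (\<lambda>x. 0)"
    using one integral_partial_deriv_test_fun
    by (auto simp: weak_gradient_def locally_integrable_def set_integrable_def)
  from weak_gradient_cutoff[OF this, of n]
  have wg: "weak_gradient (box_cutoff n) (grad_cutoff n)" by simp
  have i1: "integrable lborel (\<lambda>x. box_cutoff n x * box_cutoff n x)"
    using loc_integrable_test_fun[OF _ lin test_fun_mult(1)[OF smooth_box_cutoff test_fun_box_cutoff]] by simp
  have i2: "integrable lborel (\<lambda>x. partial_deriv i (box_cutoff n) x * partial_deriv i (box_cutoff n) x)" for i
    using loc_integrable_test_fun[OF _ lin test_fun_mult(1)[OF smooth_partial_deriv[OF smooth_box_cutoff]
      test_fun_partial_deriv[OF test_fun_box_cutoff]]] by simp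
  show ?thesis
  proof (rule H1_I[OF wg])
    show "integrable lborel (\<lambda>x. (box_cutoff n x)\<^sup>2)" using i1 by (simp add: power2_eq_square)
    have "integrable lborel (\<lambda>x. \<Sum>i\<in>UNIV. partial_deriv i (box_cutoff n) x * partial_deriv i (box_cutoff n) x)"
      by (intro Bochner_Integration.integrable_sum i2)
    then show "integrable lborel (\<lambda>x. (norm (grad_cutoff n x))\<^sup>2)"
      by (simp add: power2_norm_eq_inner inner_vec_def grad_cutoff_def)
  qed
qed

lemma L_norm_zero_AE:
  assumes u: "u \<in> H1" and "L_norm 2 u = 0 \<or> L_norm 6 u = 0"
  shows "AE x in lborel. u x = 0"
  using assms(2)
proof
  assume "L_norm 2 u = 0"
  then have "(LINT x|lborel. (u x)\<^sup>2) = 0" using L_norm_2_square[of u] by simp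
  then have "AE x in lborel. (u x)\<^sup>2 = 0"
    using H1_wgrad(4)[OF u] by (subst (asm) integral_nonneg_eq_0_iff_AE) auto
  then show ?thesis by eventually_elim simp
next
  assume "L_norm 6 u = 0"
  then have "(LINT x|lborel. u x ^ 6) = 0" using sobolev_in_L6(2)[OF u] by simp
  then have "AE x in lborel. u x ^ 6 = 0"
    using sobolev_H1(1)[OF u] by (subst (asm) integral_nonneg_eq_0_iff_AE) auto
  then show ?thesis by eventually_elim simp
qed

lemma exists_nonzero_W:
  obtains v where "v \<in> W" "L_norm 2 v > 0" "L_norm 6 v > 0"
proof -
  let ?v = "\<lambda>x. box_cutoff 0 x * box_cutoff 0 x"
  have v: "?v \<in> W" by (rule cutoff_W[OF box_cutoff_H1])
  then have vH: "?v \<in> H1" by (simp add: W_def)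
  let ?B = "box (\<chi> i. -1) (\<chi> i. 1) :: (real^3) set"
  have pos: "?v x \<noteq> 0" if "x \<in> ?B" for x
  proof -
    have "cutoff 0 (x $ i) > 0" for i
    proof -
      have "-1 < x $ i" "x $ i < 1" using that by (auto simp: mem_box_cart)
      then show ?thesis by (simp add: cutoff_def bump_def flat_def)
    qed
    then have "box_cutoff 0 x > 0" unfolding box_cutoff_def tens_def by (intro prod_pos) auto
    then show ?thesis by simp
  qed
  have "\<not> (AE x in lborel. ?v x = 0)"
  proof
    assume "AE x in lborel. ?v x = 0"
    then have "AE x in lborel. x \<notin> ?B" by eventually_elim (use pos in blast)
    then have "?B \<in> null_sets lborel" by (subst AE_iff_null_sets) auto
    then have "negligible ?B" using negligible_iff_null_sets null_sets_completionI by blast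
    then have "?B = {}" using open_not_negligible open_box by blast
    then show False using mem_box_cart(1)[of "0 :: real^3" "\<chi> i. -1" "\<chi> i. 1"] by auto
  qed
  then have "L_norm 2 ?v \<noteq> 0" "L_norm 6 ?v \<noteq> 0" using L_norm_zero_AE[OF vH] by blast+
  then show ?thesis using that[OF v] L_norm_nonneg[of 2 ?v] L_norm_nonneg[of 6 ?v] by linarith
qed

section \<open>The optimal constant\<close>

text \<open>The supremum defining \<open>sobolev_const\<close> is over a nonempty bounded set, it is itself an
  admissible constant in the inequality, and almost optimal functions can be found in \<open>W\<close>.\<close>

lemma sobolev_const:
  shows sobolev_const_ge: "sobolev_const \<ge> 1 / 16"
    and sobolev_const_le: "u \<in> H1 \<Longrightarrow> sobolev_const * (L_norm 6 u)\<^sup>2 \<le> (grad_norm u)\<^sup>2"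
    and sobolev_const_optimal: "\<delta> > 0 \<Longrightarrow> \<exists>u\<in>W. L_norm 2 u > 0 \<and> L_norm 6 u > 0 \<and>
      (grad_norm u)\<^sup>2 < (sobolev_const + \<delta>) * (L_norm 6 u)\<^sup>2"
proof -
  let ?C = "{s. \<forall>u\<in>H1. in_L 6 u \<and> s * (L_norm 6 u)\<^sup>2 \<le> (grad_norm u)\<^sup>2}"
  obtain v where v: "v \<in> W" "L_norm 6 v > 0" by (rule exists_nonzero_W) blast
  have mem: "1 / 16 \<in> ?C" using sobolev_in_L6(1) sobolev_L6 by blast
  have le: "s \<le> (grad_norm u)\<^sup>2 / (L_norm 6 u)\<^sup>2" if "s \<in> ?C" "u \<in> H1" "L_norm 6 u > 0" for s u
    using that by (auto simp: pos_le_divide_eq)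
  have "v \<in> H1" using v(1) by (simp add: W_def)
  have bdd: "bdd_above ?C"
    by (rule bdd_aboveI) (rule le[OF _ \<open>v \<in> H1\<close> v(2)])
  show "sobolev_const \<ge> 1 / 16" unfolding sobolev_const_def by (rule cSup_upper[OF mem bdd])
  show "sobolev_const * (L_norm 6 u)\<^sup>2 \<le> (grad_norm u)\<^sup>2" if u: "u \<in> H1" for u
  proof (cases "L_norm 6 u > 0")
    case True
    have "sobolev_const \<le> (grad_norm u)\<^sup>2 / (L_norm 6 u)\<^sup>2"
      unfolding sobolev_const_def
    proof (rule cSup_least)
      show "?C \<noteq> {}" using mem by blast
    qed (rule le[OF _ u True])
    then show ?thesis using True by (simp add: pos_le_divide_eq)
  next
    case False
    then show ?thesis using L_norm_nonneg[of 6 u] by simp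
  qed
  assume \<delta>: "\<delta> > 0"
  have "sobolev_const + \<delta> \<notin> ?C"
    using cSup_upper[OF _ bdd, of "sobolev_const + \<delta>"] \<delta> unfolding sobolev_const_def by auto
  then obtain u where u: "u \<in> H1" "(grad_norm u)\<^sup>2 < (sobolev_const + \<delta>) * (L_norm 6 u)\<^sup>2"
    using sobolev_in_L6(1) by force
  define w where "w n = (\<lambda>x. box_cutoff n x * u x)" for n
  note c = cutoff_H1[OF u(1), folded w_def]
  have L6: "(\<lambda>n. (LINT x|lborel. w n x ^ 6)) \<longlonglongrightarrow> (LINT x|lborel. u x ^ 6)"
  proof (rule integral_dominated_convergence[OF _ _ sobolev_H1(1)[OF u(1)]])
    have [measurable]: "u \<in> borel_measurable borel" using H1_wgrad[OF u(1)] by simp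
    show "(\<lambda>x. u x ^ 6) \<in> borel_measurable lborel" "(\<lambda>x. w n x ^ 6) \<in> borel_measurable lborel" for n
      unfolding w_def by measurable
    show "AE x in lborel. (\<lambda>n. w n x ^ 6) \<longlonglongrightarrow> u x ^ 6"
    proof (rule AE_I2)
      fix x
      have "(\<lambda>n. (box_cutoff n x * u x) ^ 6) \<longlonglongrightarrow> (1 * u x) ^ 6"
        by (intro tendsto_intros box_cutoff_tendsto)
      then show "(\<lambda>n. w n x ^ 6) \<longlonglongrightarrow> u x ^ 6" by (simp add: w_def)
    qed
    show "AE x in lborel. norm (w n x ^ 6) \<le> u x ^ 6" for n
    proof (rule AE_I2)
      fix x
      have "box_cutoff n x ^ 6 \<le> 1" using box_cutoff_bounds by (intro power_le_one) auto
      then show "norm (w n x ^ 6) \<le> u x ^ 6"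
        using box_cutoff_bounds[of n x] by (auto simp: w_def power_mult_distrib intro!: mult_left_le_one_le)
    qed
  qed
  have root: "(L_norm 6 v)\<^sup>2 = (LINT x|lborel. v x ^ 6) powr (1 / 3)" if "v \<in> H1" for v
  proof -
    have eq: "(LINT x|lborel. v x ^ 6) = L_norm 6 v powr 6"
      using sobolev_in_L6(2)[OF that] by (simp add: L_norm_nonneg)
    show ?thesis unfolding eq powr_powr by (simp add: L_norm_nonneg)
  qed
  have u6: "L_norm 6 u > 0"
  proof (rule ccontr)
    assume "\<not> L_norm 6 u > 0"
    then have "L_norm 6 u = 0" using L_norm_nonneg[of 6 u] by simp
    then show False using u(2) by simp
  qed
  then have "(LINT x|lborel. u x ^ 6) \<noteq> 0" using sobolev_in_L6(2)[OF u(1)] by (metis power_eq_0_iff less_irrefl)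
  then have pl: "(\<lambda>n. (LINT x|lborel. w n x ^ 6) powr (1 / 3)) \<longlonglongrightarrow> (LINT x|lborel. u x ^ 6) powr (1 / 3)"
    by (intro tendsto_powr L6 tendsto_const)
  have lim: "(\<lambda>n. (sobolev_const + \<delta>) * (L_norm 6 (w n))\<^sup>2 - (grad_norm (w n))\<^sup>2) \<longlonglongrightarrow>
     (sobolev_const + \<delta>) * (L_norm 6 u)\<^sup>2 - (grad_norm u)\<^sup>2"
    unfolding root[OF u(1)] root[OF c(1)] by (intro tendsto_diff tendsto_mult tendsto_const pl c(3))
  have "\<forall>\<^sub>F n in sequentially. (sobolev_const + \<delta>) * (L_norm 6 (w n))\<^sup>2 - (grad_norm (w n))\<^sup>2 > 0"
    by (rule order_tendstoD(1)[OF lim]) (use u(2) in simp)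
  then obtain n where n: "(sobolev_const + \<delta>) * (L_norm 6 (w n))\<^sup>2 - (grad_norm (w n))\<^sup>2 > 0"
    by (auto simp: eventually_sequentially)
  have ne: "L_norm 6 (w n) \<noteq> 0" using n by (auto simp: not_less)
  have "L_norm 2 (w n) \<noteq> 0"
  proof
    assume "L_norm 2 (w n) = 0"
    then have "AE x in lborel. w n x = 0" using L_norm_zero_AE[OF c(1)] by blast
    then have "(LINT x|lborel. w n x ^ 6) = 0" by (intro integral_eq_zero_AE) auto
    then show False using ne sobolev_in_L6(2)[OF c(1)] by (metis power_eq_0_iff)
  qed
  then show "\<exists>u\<in>W. L_norm 2 u > 0 \<and> L_norm 6 u > 0 \<and> (grad_norm u)\<^sup>2 < (sobolev_const + \<delta>) * (L_norm 6 u)\<^sup>2"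
    using n ne L_norm_nonneg[of 2 "w n"] L_norm_nonneg[of 6 "w n"] cutoff_W[OF u(1), of n]
    by (intro bexI[of _ "w n"]) (auto simp: w_def)
qed

section \<open>Gagliardo-Nirenberg and energy estimates\<close>

text \<open>The scale \<open>\<tau>\<close> is free; optimising it after integration replaces the Hoelder interpolation inequality.\<close>

lemma powr_split_bound:
  fixes t \<tau> p :: real
  assumes "\<tau> > 0" "2 < p" "p \<le> 6"
  shows "\<bar>t\<bar> powr p \<le> \<tau> powr (p - 2) * t\<^sup>2 + \<tau> powr (p - 6) * t ^ 6"
proof (cases "t = 0")
  case False
  then have t: "\<bar>t\<bar> > 0" by simp
  have t2: "\<bar>t\<bar> powr 2 = t\<^sup>2" using t by simp
  show ?thesis
  proof (cases "\<bar>t\<bar> \<le> \<tau>")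
    case True
    have "\<bar>t\<bar> powr p = \<bar>t\<bar> powr (p - 2) * t\<^sup>2" unfolding t2[symmetric] powr_add[symmetric] by simp
    also have "\<dots> \<le> \<tau> powr (p - 2) * t\<^sup>2"
      using assms True by (intro mult_right_mono powr_mono2) auto
    finally show ?thesis using assms by (simp add: add_increasing2)
  next
    case False
    have "\<bar>t\<bar> powr p = \<bar>t\<bar> powr (p - 6) * t ^ 6" unfolding abs_powr_6[symmetric] powr_add[symmetric] by simp
    also have "\<dots> \<le> \<tau> powr (p - 6) * t ^ 6"
      using assms False t by (intro mult_right_mono powr_mono2') auto
    finally show ?thesis using assms by (simp add: add_increasing)
  qed
qed (use assms in auto)

lemma S_grad_norm_pos:
  assumes "c > 0" "u \<in> S c"
  shows "u \<in> H1" "u \<in> W" "(L_norm 2 u)\<^sup>2 = c\<^sup>2" "(grad_norm u)\<^sup>2 > 0"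
proof -
  show 1: "u \<in> W" "(L_norm 2 u)\<^sup>2 = c\<^sup>2" using assms by (auto simp: S_iff)
  then show H: "u \<in> H1" by (simp add: W_def)
  show "(grad_norm u)\<^sup>2 > 0"
  proof (rule ccontr)
    assume "\<not> (grad_norm u)\<^sup>2 > 0"
    then have "grad_norm u = 0" by simp
    then have "L_norm 6 u = 0" using sobolev_L6[OF H] by simp
    then have "AE x in lborel. u x = 0" using L_norm_zero_AE[OF H] by blast
    then have "(LINT x|lborel. (u x)\<^sup>2) = 0" by (intro integral_eq_zero_AE) auto
    then show False using assms 1 L_norm_2_square[of u] by simp
  qed
qed

lemma integrable_powr:
  assumes u: "u \<in> H1" and p: "2 < p" "p \<le> 6"
  shows "integrable lborel (\<lambda>x. \<bar>u x\<bar> powr p)"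
proof (rule Bochner_Integration.integrable_bound)
  note w = H1_wgrad[OF u]
  show "integrable lborel (\<lambda>x. (u x)\<^sup>2 + u x ^ 6)"
    using w(4) sobolev_H1(1)[OF u] by (rule Bochner_Integration.integrable_add)
  show "(\<lambda>x. \<bar>u x\<bar> powr p) \<in> borel_measurable lborel" using w(3) by simp
  show "AE x in lborel. norm (\<bar>u x\<bar> powr p) \<le> norm ((u x)\<^sup>2 + u x ^ 6)"
    using powr_split_bound[of 1, OF _ p] by (intro AE_I2) simp
qed

lemma gagliardo_nirenberg:
  assumes c: "c > 0" and u: "u \<in> S c" and p: "2 < p" "p \<le> 6"
  shows "L_norm p u powr p \<le> 4097 * (((grad_norm u)\<^sup>2) powr (3 * (p - 2) / 4) * (c\<^sup>2) powr ((6 - p) / 4))"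
proof -
  note s = S_grad_norm_pos[OF c u]
  define A where "A = (grad_norm u)\<^sup>2"
  define M where "M = c\<^sup>2"
  have AM: "A > 0" "M > 0" using s c by (auto simp: A_def M_def)
  \<comment> \<open>This scale balances the two terms of the bound in \<open>powr_split_bound\<close>.\<close>
  define \<tau> where "\<tau> = (A ^ 3 / M) powr (1 / 4)"
  have \<tau>: "\<tau> > 0" using AM by (simp add: \<tau>_def)
  have i: "integrable lborel (\<lambda>x. (u x)\<^sup>2)" "integrable lborel (\<lambda>x. u x ^ 6)"
    using H1_wgrad[OF s(1)] sobolev_H1[OF s(1)] by auto
  have \<tau>p: "\<tau> powr r = A powr (3 * r / 4) * M powr (- r / 4)" for r
  proof -
    have A3: "A ^ 3 = A powr 3" using AM by simp
    have "(A powr 3 / M) powr (1 / 4 * r) = (A powr 3) powr (1 / 4 * r) / M powr (1 / 4 * r)"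
      by (rule powr_divide)
    then have "\<tau> powr r = A powr (3 * (1 / 4 * r)) / M powr (1 / 4 * r)"
      unfolding \<tau>_def A3 powr_powr .
    then show ?thesis using AM by (simp add: powr_minus_divide)
  qed
  have e1: "\<tau> powr (p - 2) * M = A powr (3 * (p - 2) / 4) * M powr ((6 - p) / 4)"
  proof -
    have "\<tau> powr (p - 2) * M = A powr (3 * (p - 2) / 4) * (M powr (- (p - 2) / 4) * M powr 1)"
      unfolding \<tau>p using AM by simp
    also have "M powr (- (p - 2) / 4) * M powr 1 = M powr ((6 - p) / 4)"
      unfolding powr_add[symmetric] by (rule arg_cong[where f="\<lambda>r. M powr r"]) (simp add: field_simps)
    finally show ?thesis .
  qed
  have e2: "\<tau> powr (p - 6) * A ^ 3 = A powr (3 * (p - 2) / 4) * M powr ((6 - p) / 4)"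
  proof -
    have "\<tau> powr (p - 6) * A ^ 3 = (A powr (3 * (p - 6) / 4) * A powr 3) * M powr (- (p - 6) / 4)"
      unfolding \<tau>p using AM by simp
    also have "A powr (3 * (p - 6) / 4) * A powr 3 = A powr (3 * (p - 2) / 4)"
      unfolding powr_add[symmetric] by (rule arg_cong[where f="\<lambda>r. A powr r"]) (simp add: field_simps)
    finally show ?thesis by simp
  qed
  have "L_norm p u powr p = (LINT x|lborel. \<bar>u x\<bar> powr p)" using p by (simp add: L_norm_powr)
  also have "\<dots> \<le> (LINT x|lborel. \<tau> powr (p - 2) * (u x)\<^sup>2 + \<tau> powr (p - 6) * u x ^ 6)"
    using i powr_split_bound[OF \<tau> p] integrable_powr[OF s(1) p]
    by (intro integral_mono) auto
  also have "\<dots> = \<tau> powr (p - 2) * M + \<tau> powr (p - 6) * (LINT x|lborel. u x ^ 6)"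
    using i s(3) L_norm_2_square[of u] by (simp add: M_def)
  also have "\<dots> \<le> \<tau> powr (p - 2) * M + \<tau> powr (p - 6) * (4096 * A ^ 3)"
    using sobolev_H1(2)[OF s(1)] unfolding A_def by (intro add_left_mono mult_left_mono) auto
  also have "\<dots> = 4097 * (A powr (3 * (p - 2) / 4) * M powr ((6 - p) / 4))"
    using e1 e2 by simp
  finally show ?thesis by (simp add: A_def M_def)
qed

lemma log_int_upper:
  assumes c: "c > 0" and u: "u \<in> S c"
  shows "log_int u \<le> 8194 * (((grad_norm u)\<^sup>2) powr (3 / 4) * (c\<^sup>2) powr (3 / 4))"
proof -
  note s = S_grad_norm_pos[OF c u]
  have "t\<^sup>2 * ln (t\<^sup>2) \<le> 2 * \<bar>t\<bar> powr 3" for t :: real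
  proof (cases "t = 0")
    case False
    have "ln (t\<^sup>2) = 2 * ln \<bar>t\<bar>" using False ln_realpow[of "\<bar>t\<bar>" 2] by simp
    also have "\<dots> \<le> 2 * \<bar>t\<bar>" using False ln_bound[of "\<bar>t\<bar>"] by simp
    finally have "t\<^sup>2 * ln (t\<^sup>2) \<le> t\<^sup>2 * (2 * \<bar>t\<bar>)" by (intro mult_left_mono) auto
    also have "\<dots> = 2 * \<bar>t\<bar> powr 3"
      using False by (simp add: power3_eq_cube power2_eq_square flip: power_abs)
    finally show ?thesis .
  qed simp
  then have "log_int u \<le> (LINT x|lborel. 2 * \<bar>u x\<bar> powr 3)"
    unfolding log_int_def using s(2) integrable_powr[OF s(1), of 3]
    by (intro integral_mono) (auto simp: W_iff)
  also have "\<dots> = 2 * L_norm 3 u powr 3" by (simp add: L_norm_powr)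
  also have "\<dots> \<le> 2 * (4097 * (((grad_norm u)\<^sup>2) powr (3 / 4) * (c\<^sup>2) powr (3 / 4)))"
    using gagliardo_nirenberg[OF c u, of 3] by (intro mult_left_mono) simp_all
  finally show ?thesis by simp
qed

lemma energy_lower:
  assumes c: "c > 0" and u: "u \<in> S c" and p: "2 < p" "p \<le> 6"
  shows "energy a b p c u \<ge> a / 2 * (grad_norm u)\<^sup>2 + b / 4 * ((grad_norm u)\<^sup>2)\<^sup>2
    - 4097 * (((grad_norm u)\<^sup>2) powr (3 * (p - 2) / 4) * (c\<^sup>2) powr ((6 - p) / 4))
    - 4097 * (((grad_norm u)\<^sup>2) powr (3 / 4) * (c\<^sup>2) powr (3 / 4))"
proof -
  have "1 / p * L_norm p u powr p \<le> 1 * L_norm p u powr p"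
    using p by (intro mult_right_mono) auto
  then have "1 / p * L_norm p u powr p \<le> 4097 * (((grad_norm u)\<^sup>2) powr (3 * (p - 2) / 4) * (c\<^sup>2) powr ((6 - p) / 4))"
    using gagliardo_nirenberg[OF c u p] by linarith
  moreover have "c\<^sup>2 \<ge> 0" by simp
  ultimately show ?thesis using log_int_upper[OF c u] unfolding energy_eq by linarith
qed

section \<open>The subcritical range \<open>p \<le> 14/3\<close>\<close>

text \<open>The common bound for the coefficients of the lower order terms of the energy.\<close>

definition err :: "real \<Rightarrow> real \<Rightarrow> real" where
  "err p c = 4097 * (c\<^sup>2) powr ((6 - p) / 4) + 4097 * (c\<^sup>2) powr (3 / 4)"

lemma err_tendsto: "p < 6 \<Longrightarrow> (err p \<longlongrightarrow> 0) (at_right 0)"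
  unfolding err_def[abs_def]
proof -
  assume p: "p < 6"
  have sq: "((\<lambda>c :: real. c\<^sup>2) \<longlongrightarrow> 0) (at_right 0)" by real_asymp
  have "((\<lambda>c :: real. 4097 * (c\<^sup>2) powr ((6 - p) / 4) + 4097 * (c\<^sup>2) powr (3 / 4)) \<longlongrightarrow>
     4097 * 0 powr ((6 - p) / 4) + 4097 * 0 powr (3 / 4)) (at_right 0)"
    using p by (intro tendsto_intros tendsto_powr' sq) auto
  then show "((\<lambda>c :: real. 4097 * (c\<^sup>2) powr ((6 - p) / 4) + 4097 * (c\<^sup>2) powr (3 / 4)) \<longlongrightarrow> 0) (at_right 0)"
    by simp
qed

lemma powr_le_1_plus_square:
  fixes A r :: real
  assumes "A > 0" "0 \<le> r" "r \<le> 2"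
  shows "A powr r \<le> 1 + A\<^sup>2"
proof (cases "A \<le> 1")
  case True
  then have "A powr r \<le> 1 powr r" using assms by (intro powr_mono2) auto
  then show ?thesis by (simp add: add_increasing2)
next
  case False
  then have "A powr r \<le> A powr 2" using assms by (intro powr_mono) auto
  then show ?thesis using assms by simp
qed

lemma energy_lower_err:
  assumes c: "c > 0" and u: "u \<in> S c" and p: "2 < p" "p \<le> 14 / 3"
  shows "energy a b p c u \<ge> a / 2 * (grad_norm u)\<^sup>2 + (b / 4 - err p c) * ((grad_norm u)\<^sup>2)\<^sup>2 - err p c"
proof -
  let ?A = "(grad_norm u)\<^sup>2"
  have A: "?A > 0" using S_grad_norm_pos[OF c u] by simp
  have "?A powr (3 * (p - 2) / 4) * (c\<^sup>2) powr ((6 - p) / 4) \<le> (1 + ?A\<^sup>2) * (c\<^sup>2) powr ((6 - p) / 4)"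
    using p by (intro mult_right_mono powr_le_1_plus_square A) auto
  moreover have "?A powr (3 / 4) * (c\<^sup>2) powr (3 / 4) \<le> (1 + ?A\<^sup>2) * (c\<^sup>2) powr (3 / 4)"
    by (intro mult_right_mono powr_le_1_plus_square A) auto
  moreover have "(b / 4 - err p c) * ?A\<^sup>2 - err p c = b / 4 * ?A\<^sup>2
     - 4097 * ((1 + ?A\<^sup>2) * (c\<^sup>2) powr ((6 - p) / 4)) - 4097 * ((1 + ?A\<^sup>2) * (c\<^sup>2) powr (3 / 4))"
    by (simp add: err_def algebra_simps)
  ultimately show ?thesis using energy_lower[OF c u p(1), of a b] p by linarith
qed

text \<open>Multiples of a fixed function have any prescribed mass; they serve as competitors.\<close>

lemma multiple_S:
  assumes v: "v \<in> W" and mu: "L_norm 2 v > 0" and c: "c > 0"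
  defines "x \<equiv> c / L_norm 2 v"
  defines "w \<equiv> \<lambda>y. x * v y"
  shows "w \<in> S c" "(grad_norm w)\<^sup>2 = x\<^sup>2 * (grad_norm v)\<^sup>2"
    "q > 0 \<Longrightarrow> L_norm q w powr q = x powr q * L_norm q v powr q"
    "log_int w = x\<^sup>2 * (ln (x\<^sup>2) * (L_norm 2 v)\<^sup>2 + log_int v)"
proof -
  have x: "x > 0" using mu c by (simp add: x_def)
  have vH: "v \<in> H1" using v by (simp add: W_def)
  have w: "w = (\<lambda>y. x * v (1 *\<^sub>R y))" by (simp add: w_def)
  have "(L_norm 2 w)\<^sup>2 = c\<^sup>2"
    unfolding w using H1_scale(3)[OF vH, of 1 x] mu by (simp add: x_def power_divide)
  then show "w \<in> S c" using W_scale(1)[OF v _ x, of 1] c by (simp add: S_iff w_def)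
  show "(grad_norm w)\<^sup>2 = x\<^sup>2 * (grad_norm v)\<^sup>2" unfolding w using H1_scale(2)[OF vH, of 1 x] by simp
  show "q > 0 \<Longrightarrow> L_norm q w powr q = x powr q * L_norm q v powr q"
    unfolding w using H1_scale(4)[OF vH, of 1 q x] x by simp
  show "log_int w = x\<^sup>2 * (ln (x\<^sup>2) * (L_norm 2 v)\<^sup>2 + log_int v)"
    unfolding w using W_scale(2)[OF v _ x, of 1] by simp
qed

lemma scaled_square_tendsto:
  fixes \<mu> :: real
  assumes "\<mu> > 0"
  shows "((\<lambda>c. (c / \<mu>)\<^sup>2) \<longlongrightarrow> 0) (at_right 0)"
    and "((\<lambda>c. (c / \<mu>)\<^sup>2 * ln ((c / \<mu>)\<^sup>2)) \<longlongrightarrow> 0) (at_right 0)"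
  using assms by real_asymp+

lemma m_upper:
  assumes p: "p > 0"
  obtains U where "(U \<longlongrightarrow> 0) (at_right 0)" "\<And>c. c > 0 \<Longrightarrow> m a b p c \<le> ereal (U c)"
proof -
  obtain v where v: "v \<in> W" "L_norm 2 v > 0" by (rule exists_nonzero_W) blast
  define A where "A = (grad_norm v)\<^sup>2"
  define \<mu> where "\<mu> = L_norm 2 v"
  define l where "l = log_int v"
  define U where "U c = a / 2 * ((c / \<mu>)\<^sup>2 * A) + b / 4 * ((c / \<mu>)\<^sup>2 * A)\<^sup>2 + c\<^sup>2 / 2
    - ((c / \<mu>)\<^sup>2 * ln ((c / \<mu>)\<^sup>2) * \<mu>\<^sup>2 + (c / \<mu>)\<^sup>2 * l) / 2" for c
  have mu: "\<mu> > 0" using v by (simp add: \<mu>_def)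
  show ?thesis
  proof (rule that)
    have "(U \<longlongrightarrow> a / 2 * (0 * A) + b / 4 * (0 * A)\<^sup>2 + 0\<^sup>2 / 2 - (0 * \<mu>\<^sup>2 + 0 * l) / 2) (at_right 0)"
      unfolding U_def[abs_def] by (intro tendsto_intros scaled_square_tendsto mu) auto
    then show "(U \<longlongrightarrow> 0) (at_right 0)" by simp
    fix c :: real assume c: "c > 0"
    note w = multiple_S[OF v c]
    have "m a b p c \<le> ereal (energy a b p c (\<lambda>y. c / L_norm 2 v * v y))"
      unfolding m_def by (rule INF_lower[OF w(1)])
    also have "\<dots> \<le> ereal (U c)"
      unfolding energy_eq w(2) w(4) U_def A_def \<mu>_def l_def
      using p by (simp add: field_simps)
    finally show "m a b p c \<le> ereal (U c)" .
  qed
qed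

lemma ereal_sandwich_0:
  assumes "(L \<longlongrightarrow> 0) F" "(U \<longlongrightarrow> 0) F" "\<forall>\<^sub>F c in F. ereal (L c) \<le> f c" "\<forall>\<^sub>F c in F. f c \<le> ereal (U c)"
  shows "(f \<longlongrightarrow> 0) F"
proof (rule tendsto_sandwich[OF assms(3,4)])
  show "((\<lambda>c. ereal (L c)) \<longlongrightarrow> 0) F" "((\<lambda>c. ereal (U c)) \<longlongrightarrow> 0) F"
    using assms(1,2) by (simp_all add: zero_ereal_def)
qed

lemma subcritical:
  assumes a: "a > 0" and b: "b > 0" and p: "2 < p" "p \<le> 14 / 3"
  shows "(m a b p \<longlongrightarrow> 0) (at_right 0)"
    and "\<forall>\<^sub>F c in at_right 0. u c \<in> S c \<and> ereal (energy a b p c (u c)) = m a b p c \<Longrightarrow>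
      ((\<lambda>c. (grad_norm (u c))\<^sup>2) \<longlongrightarrow> 0) (at_right 0)"
proof -
  have p0: "p > 0" using p by simp
  obtain U where U: "(U \<longlongrightarrow> 0) (at_right 0)" "\<And>c. c > 0 \<Longrightarrow> m a b p c \<le> ereal (U c)"
    by (rule m_upper[OF p0, of a b]) blast
  have err0: "(err p \<longlongrightarrow> 0) (at_right 0)" using p by (intro err_tendsto) simp
  have pos: "\<forall>\<^sub>F c :: real in at_right 0. c > 0" by (rule eventually_at_right_less)
  have eerr: "\<forall>\<^sub>F c in at_right 0. err p c < b / 4" using b by (intro order_tendstoD(2)[OF err0]) simp
  have low: "energy a b p c v \<ge> a / 2 * (grad_norm v)\<^sup>2 - err p c" if "c > 0" "err p c < b / 4" "v \<in> S c" for c v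
  proof -
    have "(b / 4 - err p c) * ((grad_norm v)\<^sup>2)\<^sup>2 \<ge> 0" using that by (intro mult_nonneg_nonneg) auto
    then show ?thesis using energy_lower_err[OF that(1,3) p, of a b] by linarith
  qed
  show "(m a b p \<longlongrightarrow> 0) (at_right 0)"
  proof (rule ereal_sandwich_0[where L="\<lambda>c. - err p c" and U=U])
    show "((\<lambda>c. - err p c) \<longlongrightarrow> 0) (at_right 0)" using tendsto_minus[OF err0] by simp
    show "\<forall>\<^sub>F c in at_right 0. ereal (- err p c) \<le> m a b p c"
      using pos eerr
    proof eventually_elim
      case (elim c)
      show ?case unfolding m_def
      proof (rule INF_greatest)
        fix v assume "v \<in> S c"
        moreover have "a / 2 * (grad_norm v)\<^sup>2 \<ge> 0" using a by simp
        ultimately show "ereal (- err p c) \<le> ereal (energy a b p c v)" using low[OF elim, of v] by simp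
      qed
    qed
    show "\<forall>\<^sub>F c in at_right 0. m a b p c \<le> ereal (U c)"
      using pos by eventually_elim (rule U(2))
  qed (rule U(1))
  assume u: "\<forall>\<^sub>F c in at_right 0. u c \<in> S c \<and> ereal (energy a b p c (u c)) = m a b p c"
  show "((\<lambda>c. (grad_norm (u c))\<^sup>2) \<longlongrightarrow> 0) (at_right 0)"
  proof (rule tendsto_sandwich[where f="\<lambda>_. 0" and h="\<lambda>c. 2 / a * (U c + err p c)"])
    have "((\<lambda>c. 2 / a * (U c + err p c)) \<longlongrightarrow> 2 / a * (0 + 0)) (at_right 0)"
      by (intro tendsto_intros U(1) err0)
    then show "((\<lambda>c. 2 / a * (U c + err p c)) \<longlongrightarrow> 0) (at_right 0)" by simp
    show "\<forall>\<^sub>F c in at_right 0. (grad_norm (u c))\<^sup>2 \<le> 2 / a * (U c + err p c)"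
      using pos eerr u
    proof eventually_elim
      case (elim c)
      have "ereal (energy a b p c (u c)) \<le> ereal (U c)" using elim(3) U(2)[OF elim(1)] by simp
      then have "energy a b p c (u c) \<le> U c" by simp
      moreover have "energy a b p c (u c) \<ge> a / 2 * (grad_norm (u c))\<^sup>2 - err p c"
        using low[OF elim(1,2)] elim(3) by blast
      ultimately have "a / 2 * (grad_norm (u c))\<^sup>2 \<le> U c + err p c" by linarith
      then show ?case using a by (simp add: field_simps)
    qed
  qed auto
qed

section \<open>The supercritical range: the manifold \<open>\<Lambda>\<^sup>+\<close>\<close>

text \<open>Eliminating \<open>\<parallel>u\<parallel>\<^sub>p\<close> from the two relations that define \<open>\<Lambda>\<^sup>+\<close> bounds the gradient by the mass, since
  \<open>q = 3(p - 2)/2 > 4\<close>.\<close>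

lemma Lambda_plus_bound:
  assumes a: "a > 0" and b: "b > 0" and p: "14 / 3 < p" and c: "c > 0"
    and u: "u \<in> Lambda_plus a b p c"
  shows "(grad_norm u)\<^sup>2 \<le> 3 * (3 * (p - 2) / 2) / (2 * (3 * (p - 2) / 2 - 2) * a) * c\<^sup>2"
proof -
  define q where "q = 3 * (p - 2) / 2"
  have q: "q > 4" using p by (simp add: q_def)
  have p0: "p > 0" using p by simp
  define A where "A = (grad_norm u)\<^sup>2"
  define B where "B = L_norm p u powr p"
  have 1: "a * A + b * A\<^sup>2 - q / p * B - 3 / 2 * c\<^sup>2 = 0"
    and 2: "2 * a * A + 4 * b * A\<^sup>2 - q\<^sup>2 / p * B > 0"
    using u Lambda_iff[OF p0 c, of u a b] unfolding A_def B_def q_def by blast+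
  have "q\<^sup>2 / p * B = q * (a * A + b * A\<^sup>2 - 3 / 2 * c\<^sup>2)"
    using 1 by (simp add: power2_eq_square algebra_simps)
  then have "(q - 2) * (a * A) + (q - 4) * (b * A\<^sup>2) < 3 / 2 * q * c\<^sup>2"
    using 2 by (simp add: algebra_simps)
  moreover have "(q - 4) * (b * A\<^sup>2) \<ge> 0" using q b by simp
  ultimately have "(q - 2) * (a * A) \<le> 3 / 2 * q * c\<^sup>2" by linarith
  then have "A \<le> 3 * q / (2 * (q - 2) * a) * c\<^sup>2"
    using q a by (simp add: field_simps)
  then show ?thesis unfolding A_def q_def .
qed

lemma m_plus_lower:
  assumes a: "a > 0" and b: "b > 0" and p: "14 / 3 < p" "p \<le> 6"
  obtains L where "(L \<longlongrightarrow> 0) (at_right 0)" "\<And>c. c > 0 \<Longrightarrow> ereal (L c) \<le> m_plus a b p c"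
proof -
  define K where "K = 3 * (3 * (p - 2) / 2) / (2 * (3 * (p - 2) / 2 - 2) * a)"
  have K: "K > 0" using p a by (simp add: K_def)
  define \<beta> where "\<beta> = 3 * (p - 2) / 4"
  have \<beta>: "\<beta> > 0" using p by (simp add: \<beta>_def)
  define L where "L c = - (4097 * (K powr \<beta> * (c\<^sup>2) powr (p / 2))) - 4097 * (K powr (3 / 4) * (c\<^sup>2) powr (3 / 2))" for c :: real
  show ?thesis
  proof (rule that)
    have sq: "((\<lambda>c :: real. c\<^sup>2) \<longlongrightarrow> 0) (at_right 0)" by real_asymp
    have "(L \<longlongrightarrow> - (4097 * (K powr \<beta> * 0 powr (p / 2))) - 4097 * (K powr (3 / 4) * 0 powr (3 / 2))) (at_right 0)"
      unfolding L_def[abs_def] using p by (intro tendsto_intros tendsto_powr' sq) auto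
    then show "(L \<longlongrightarrow> 0) (at_right 0)" by simp
    fix c :: real assume c: "c > 0"
    show "ereal (L c) \<le> m_plus a b p c"
      unfolding m_plus_def
    proof (rule INF_greatest)
      fix u assume u: "u \<in> Lambda_plus a b p c"
      then have uS: "u \<in> S c" by (simp add: Lambda_plus_def Lambda_def)
      define A where "A = (grad_norm u)\<^sup>2"
      have A: "A > 0" "A \<le> K * c\<^sup>2"
        using S_grad_norm_pos[OF c uS] Lambda_plus_bound[OF a b p(1) c u] by (auto simp: A_def K_def)
      have 1: "A powr \<beta> * (c\<^sup>2) powr ((6 - p) / 4) \<le> K powr \<beta> * (c\<^sup>2) powr (p / 2)"
      proof -
        have "A powr \<beta> * (c\<^sup>2) powr ((6 - p) / 4) \<le> (K * c\<^sup>2) powr \<beta> * (c\<^sup>2) powr ((6 - p) / 4)"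
          using A \<beta> by (intro mult_right_mono powr_mono2) auto
        also have "\<dots> = K powr \<beta> * ((c\<^sup>2) powr \<beta> * (c\<^sup>2) powr ((6 - p) / 4))"
          by (simp add: powr_mult)
        also have "(c\<^sup>2) powr \<beta> * (c\<^sup>2) powr ((6 - p) / 4) = (c\<^sup>2) powr (p / 2)"
          unfolding powr_add[symmetric] by (rule arg_cong[where f="\<lambda>r. _ powr r"]) (simp add: \<beta>_def field_simps)
        finally show ?thesis .
      qed
      have 2: "A powr (3 / 4) * (c\<^sup>2) powr (3 / 4) \<le> K powr (3 / 4) * (c\<^sup>2) powr (3 / 2)"
      proof -
        have "A powr (3 / 4) * (c\<^sup>2) powr (3 / 4) \<le> (K * c\<^sup>2) powr (3 / 4) * (c\<^sup>2) powr (3 / 4)"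
          using A by (intro mult_right_mono powr_mono2) auto
        also have "\<dots> = K powr (3 / 4) * ((c\<^sup>2) powr (3 / 4) * (c\<^sup>2) powr (3 / 4))"
          by (simp add: powr_mult)
        also have "(c\<^sup>2) powr (3 / 4) * (c\<^sup>2) powr (3 / 4) = (c\<^sup>2) powr (3 / 2)"
          unfolding powr_add[symmetric] by simp
        finally show ?thesis .
      qed
      have "a / 2 * A \<ge> 0" "b / 4 * A\<^sup>2 \<ge> 0" using a b A by auto
      moreover have "energy a b p c u \<ge> a / 2 * A + b / 4 * A\<^sup>2 - 4097 * (A powr \<beta> * (c\<^sup>2) powr ((6 - p) / 4))
         - 4097 * (A powr (3 / 4) * (c\<^sup>2) powr (3 / 4))"
        using energy_lower[OF c uS _ p(2), of a b] p unfolding A_def \<beta>_def by simp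
      ultimately have "L c \<le> energy a b p c u" using 1 2 unfolding L_def by linarith
      then show "ereal (L c) \<le> ereal (energy a b p c u)" by simp
    qed
  qed
qed

text \<open>The fibre equation for dilations of a function of given norms.\<close>

lemma dilate_Lambda:
  assumes u: "u \<in> S c" and p: "p > 0" and c: "c > 0"
  defines "A \<equiv> (grad_norm u)\<^sup>2" and "B \<equiv> L_norm p u powr p" and "q \<equiv> 3 * (p - 2) / 2"
  shows "dilate s u \<in> Lambda a b p c \<longleftrightarrow>
     a * (exp (2 * s) * A) + b * (exp (2 * s) * A)\<^sup>2 - q / p * (exp (q * s) * B) - 3 / 2 * c\<^sup>2 = 0"
    and "dilate s u \<in> Lambda_plus a b p c \<longleftrightarrow> dilate s u \<in> Lambda a b p c \<and>
     2 * a * (exp (2 * s) * A) + 4 * b * (exp (2 * s) * A)\<^sup>2 - q\<^sup>2 / p * (exp (q * s) * B) > 0"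
    and "dilate s u \<in> Lambda_minus a b p c \<longleftrightarrow> dilate s u \<in> Lambda a b p c \<and>
     2 * a * (exp (2 * s) * A) + 4 * b * (exp (2 * s) * A)\<^sup>2 - q\<^sup>2 / p * (exp (q * s) * B) < 0"
  using fiber_eq(2-4)[OF u p c, of s] unfolding Lambda_iff[OF p c] A_def B_def q_def by auto

text \<open>The competitor is a dilation of a multiple \<open>x v\<close> of a fixed function \<open>v\<close>. After division by \<open>x\<^sup>2\<close> the fibre
  equation is a small perturbation of \<open>a e\<^sup>2\<^sup>s A = (3/2) \<mu>\<^sup>2\<close>, so it has a root in the fixed interval
  \<open>[s\<^sub>0, s\<^sub>1]\<close> at whose ends \<open>a e\<^sup>2\<^sup>s A\<close> takes the values \<open>(3/4) \<mu>\<^sup>2\<close> and \<open>3 \<mu>\<^sup>2\<close>.\<close>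

lemma m_plus_upper:
  assumes a: "a > 0" and b: "b > 0" and p: "14 / 3 < p" "p \<le> 6"
  obtains U where "(U \<longlongrightarrow> 0) (at_right 0)" "\<forall>\<^sub>F c in at_right 0. m_plus a b p c \<le> ereal (U c)"
proof -
  obtain v where v: "v \<in> W" "L_norm 2 v > 0" by (rule exists_nonzero_W) blast
  define \<mu> where "\<mu> = L_norm 2 v"
  have mu: "\<mu> > 0" using v by (simp add: \<mu>_def)
  define A where "A = (grad_norm v)\<^sup>2"
  define B where "B = L_norm p v powr p"
  define l where "l = log_int v"
  have "v \<in> S \<mu>" using v by (simp add: S_def \<mu>_def)
  then have A: "A > 0" unfolding A_def by (rule S_grad_norm_pos(4)[OF mu])
  have B: "B \<ge> 0" by (simp add: B_def)
  have p0: "p > 0" using p by simp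
  define q where "q = 3 * (p - 2) / 2"
  have q: "q > 4" using p by (simp add: q_def)
  define s0 where "s0 = ln (3 / 4 * \<mu>\<^sup>2 / (a * A)) / 2"
  define s1 where "s1 = ln (3 * \<mu>\<^sup>2 / (a * A)) / 2"
  have es0: "a * (exp (2 * s0) * A) = 3 / 4 * \<mu>\<^sup>2" and es1: "a * (exp (2 * s1) * A) = 3 * \<mu>\<^sup>2"
    using mu a A by (simp_all add: s0_def s1_def)
  have s01: "s0 \<le> s1" unfolding s0_def s1_def using mu a A
    by (intro divide_right_mono ln_mono divide_right_mono) auto
  define U where "U c = a / 2 * (exp (2 * s1) * ((c / \<mu>)\<^sup>2 * A)) + b / 4 * (exp (4 * s1) * ((c / \<mu>)\<^sup>2 * A)\<^sup>2) + c\<^sup>2 / 2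
    - (3 * s0 * c\<^sup>2 + ((c / \<mu>)\<^sup>2 * ln ((c / \<mu>)\<^sup>2) * \<mu>\<^sup>2 + (c / \<mu>)\<^sup>2 * l)) / 2" for c
  show ?thesis
  proof (rule that)
    have "(U \<longlongrightarrow> a / 2 * (exp (2 * s1) * (0 * A)) + b / 4 * (exp (4 * s1) * (0 * A)\<^sup>2) + 0\<^sup>2 / 2
       - (3 * s0 * 0\<^sup>2 + (0 * \<mu>\<^sup>2 + 0 * l)) / 2) (at_right 0)"
      unfolding U_def[abs_def] by (intro tendsto_intros scaled_square_tendsto mu) auto
    then show "(U \<longlongrightarrow> 0) (at_right 0)" by simp
    have small: "((\<lambda>c. b * exp (4 * s0) * (c / \<mu>)\<^sup>2 * A\<^sup>2) \<longlongrightarrow> b * exp (4 * s0) * 0 * A\<^sup>2) (at_right 0)"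
      by (intro tendsto_intros scaled_square_tendsto mu)
    have xp: "((\<lambda>c. (c / \<mu>) powr (p - 2)) \<longlongrightarrow> 0) (at_right 0)"
    proof -
      have "((\<lambda>c. (c / \<mu>)) \<longlongrightarrow> 0 / \<mu>) (at_right 0)" using mu by (intro tendsto_intros) auto
      moreover have "\<forall>\<^sub>F c in at_right 0. c / \<mu> \<ge> 0"
        using eventually_at_right_less by eventually_elim (use mu in simp)
      ultimately have "((\<lambda>c. (c / \<mu>) powr (p - 2)) \<longlongrightarrow> (0 / \<mu>) powr (p - 2)) (at_right 0)"
        using p by (intro tendsto_powr' tendsto_const) auto
      then show ?thesis by simp
    qed
    have small2: "((\<lambda>c. q\<^sup>2 / p * (exp (q * s1) * ((c / \<mu>) powr (p - 2) * B))) \<longlongrightarrow>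
       q\<^sup>2 / p * (exp (q * s1) * (0 * B))) (at_right 0)"
      by (intro tendsto_intros xp)
    have ev1: "\<forall>\<^sub>F c in at_right 0. b * exp (4 * s0) * (c / \<mu>)\<^sup>2 * A\<^sup>2 < 3 / 4 * \<mu>\<^sup>2"
      by (rule order_tendstoD(2)[OF small]) (use mu in simp)
    have ev2: "\<forall>\<^sub>F c in at_right 0. q\<^sup>2 / p * (exp (q * s1) * ((c / \<mu>) powr (p - 2) * B)) < 3 / 2 * \<mu>\<^sup>2"
      by (rule order_tendstoD(2)[OF small2]) (use mu in simp)
    show "\<forall>\<^sub>F c in at_right 0. m_plus a b p c \<le> ereal (U c)"
      using eventually_at_right_less[of 0] ev1 ev2
    proof eventually_elim
      case (elim c)
      then have c: "c > 0" by simp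
      define x where "x = c / \<mu>"
      have x: "x > 0" using c mu by (simp add: x_def)
      have cx: "c\<^sup>2 = x\<^sup>2 * \<mu>\<^sup>2" using mu by (simp add: x_def power_divide)
      have xp2: "x powr p = x\<^sup>2 * x powr (p - 2)"
      proof -
        have "x powr p = x powr 2 * x powr (p - 2)" unfolding powr_add[symmetric] by simp
        then show ?thesis using x by simp
      qed
      define w where "w = (\<lambda>y. c / L_norm 2 v * v y)"
      note ww = multiple_S[OF v c, folded w_def, folded \<mu>_def, folded x_def, folded A_def l_def]
      have wB: "L_norm p w powr p = x\<^sup>2 * (x powr (p - 2) * B)"
        using ww(3)[OF p0] by (simp add: xp2 B_def)
      define F where "F s = a * (exp (2 * s) * (x\<^sup>2 * A)) + b * (exp (2 * s) * (x\<^sup>2 * A))\<^sup>2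
         - q / p * (exp (q * s) * (x\<^sup>2 * (x powr (p - 2) * B))) - 3 / 2 * c\<^sup>2" for s
      have Feq: "F s = x\<^sup>2 * (a * (exp (2 * s) * A) + b * exp (4 * s) * x\<^sup>2 * A\<^sup>2
         - q / p * (exp (q * s) * (x powr (p - 2) * B)) - 3 / 2 * \<mu>\<^sup>2)" for s
      proof -
        have "exp (4 * s) = (exp (2 * s))\<^sup>2" by (simp flip: exp_double)
        then show ?thesis unfolding F_def cx by (simp add: power_mult_distrib power2_eq_square algebra_simps)
      qed
      have Bp: "q / p * (exp (q * s) * (x powr (p - 2) * B)) \<ge> 0" for s
        using q p0 B by simp
      have qle: "q / p * (exp (q * s) * (x powr (p - 2) * B)) \<le> q\<^sup>2 / p * (exp (q * s1) * (x powr (p - 2) * B))"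
        if "s \<le> s1" for s
      proof -
        have "q / p \<le> q\<^sup>2 / p" using q p0 by (intro divide_right_mono) (auto simp: power2_eq_square)
        moreover have "exp (q * s) * (x powr (p - 2) * B) \<le> exp (q * s1) * (x powr (p - 2) * B)"
          using that q B by (intro mult_right_mono) auto
        ultimately show ?thesis by (rule mult_mono) (use q p0 B in auto)
      qed
      have "F s0 \<le> 0"
        unfolding Feq using elim(2) es0 Bp[of s0] by (intro mult_nonneg_nonpos) (auto simp: x_def)
      moreover have "F s1 \<ge> 0"
      proof -
        have "b * exp (4 * s1) * x\<^sup>2 * A\<^sup>2 \<ge> 0" using b by simp
        then have "0 \<le> a * (exp (2 * s1) * A) + b * exp (4 * s1) * x\<^sup>2 * A\<^sup>2
          - q / p * (exp (q * s1) * (x powr (p - 2) * B)) - 3 / 2 * \<mu>\<^sup>2"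
          using elim(3)[folded x_def] es1 qle[of s1, OF order_refl] by linarith
        then show ?thesis unfolding Feq by (rule mult_nonneg_nonneg[OF zero_le_power2])
      qed
      moreover have "\<forall>s. s0 \<le> s \<and> s \<le> s1 \<longrightarrow> isCont F s"
        unfolding F_def by (intro allI impI continuous_intros)
      ultimately obtain s where s: "s0 \<le> s" "s \<le> s1" "F s = 0"
        using IVT[of F s0 0 s1] s01 by blast
      have L: "dilate s w \<in> Lambda a b p c"
        using s(3) unfolding dilate_Lambda(1)[OF ww(1) p0 c] F_def wB ww(2) q_def .
      have "2 * (a * (exp (2 * s) * A)) - q\<^sup>2 / p * (exp (q * s) * (x powr (p - 2) * B)) > 0"
      proof -
        have "a * (exp (2 * s) * A) \<ge> a * (exp (2 * s0) * A)"
          using s a A by (intro mult_left_mono mult_right_mono) auto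
        moreover have "q\<^sup>2 / p * (exp (q * s) * (x powr (p - 2) * B)) \<le> q\<^sup>2 / p * (exp (q * s1) * (x powr (p - 2) * B))"
          using s q p0 B by (intro mult_left_mono mult_right_mono) auto
        ultimately show ?thesis using elim(3)[folded x_def] es0 by linarith
      qed
      then have "x\<^sup>2 * (2 * (a * (exp (2 * s) * A)) - q\<^sup>2 / p * (exp (q * s) * (x powr (p - 2) * B))) > 0"
        using x by simp
      moreover have "4 * b * (exp (2 * s) * (x\<^sup>2 * A))\<^sup>2 \<ge> 0" using b by simp
      ultimately have "2 * a * (exp (2 * s) * (x\<^sup>2 * A)) + 4 * b * (exp (2 * s) * (x\<^sup>2 * A))\<^sup>2
         - q\<^sup>2 / p * (exp (q * s) * (x\<^sup>2 * (x powr (p - 2) * B))) > 0"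
        by (simp add: algebra_simps)
      then have "dilate s w \<in> Lambda_plus a b p c"
        using L unfolding dilate_Lambda(2)[OF ww(1) p0 c] wB ww(2) q_def by blast
      then have "m_plus a b p c \<le> ereal (energy a b p c (dilate s w))"
        unfolding m_plus_def by (rule INF_lower)
      also have "energy a b p c (dilate s w) = fiber a b p c w s" by (simp add: fiber_def)
      also have "ereal \<dots> \<le> ereal (U c)"
      proof -
        have "exp (2 * s) * (x\<^sup>2 * A) \<le> exp (2 * s1) * (x\<^sup>2 * A)"
          "exp (4 * s) * (x\<^sup>2 * A)\<^sup>2 \<le> exp (4 * s1) * (x\<^sup>2 * A)\<^sup>2"
          using s A by (intro mult_right_mono; simp)+
        then have 1: "a / 2 * (exp (2 * s) * (x\<^sup>2 * A)) \<le> a / 2 * (exp (2 * s1) * (x\<^sup>2 * A))"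
          "b / 4 * (exp (4 * s) * (x\<^sup>2 * A)\<^sup>2) \<le> b / 4 * (exp (4 * s1) * (x\<^sup>2 * A)\<^sup>2)"
          using a b by (auto intro!: mult_left_mono)
        have 2: "1 / p * (exp (3 * (p - 2) / 2 * s) * L_norm p w powr p) \<ge> 0" using p0 by simp
        have 3: "3 * s * c\<^sup>2 \<ge> 3 * s0 * c\<^sup>2" using s by (intro mult_right_mono) auto
        have 4: "x\<^sup>2 * (ln (x\<^sup>2) * \<mu>\<^sup>2 + l) = x\<^sup>2 * ln (x\<^sup>2) * \<mu>\<^sup>2 + x\<^sup>2 * l" by (simp add: algebra_simps)
        have 5: "(3 * s0 * c\<^sup>2 + y) / 2 \<le> (3 * s * c\<^sup>2 + y) / 2" for y
          by (intro divide_right_mono add_right_mono 3) simp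
        have combine: "t1 + t2 - P + C - r \<le> t1' + t2' + C - r'"
          if "t1 \<le> t1'" "t2 \<le> t2'" "P \<ge> 0" "r' \<le> r" for t1 t1' t2 t2' P C r r' :: real
          using that by linarith
        show ?thesis
          unfolding fiber_eq(1)[OF ww(1) p0 c] ww(2) ww(4) U_def x_def[symmetric] 4 ereal_less_eq
          by (rule combine[OF 1 2 5])
      qed
      finally show ?case .
    qed
  qed
qed

lemma supercritical_plus:
  assumes a: "a > 0" and b: "b > 0" and p: "14 / 3 < p" "p \<le> 6"
  shows "(m_plus a b p \<longlongrightarrow> 0) (at_right 0)"
    and "\<forall>\<^sub>F c in at_right 0. u c \<in> Lambda_plus a b p c \<Longrightarrow>
      ((\<lambda>c. (grad_norm (u c))\<^sup>2) \<longlongrightarrow> 0) (at_right 0)"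
proof -
  obtain L where L: "(L \<longlongrightarrow> 0) (at_right 0)" "\<And>c. c > 0 \<Longrightarrow> ereal (L c) \<le> m_plus a b p c"
    by (rule m_plus_lower[OF a b p]) blast
  obtain U where U: "(U \<longlongrightarrow> 0) (at_right 0)" "\<forall>\<^sub>F c in at_right 0. m_plus a b p c \<le> ereal (U c)"
    by (rule m_plus_upper[OF a b p]) blast
  have pos: "\<forall>\<^sub>F c :: real in at_right 0. c > 0" by (rule eventually_at_right_less)
  show "(m_plus a b p \<longlongrightarrow> 0) (at_right 0)"
  proof (rule ereal_sandwich_0[OF L(1) U(1) _ U(2)])
    show "\<forall>\<^sub>F c in at_right 0. ereal (L c) \<le> m_plus a b p c"
      using pos by eventually_elim (rule L(2))
  qed
  define K where "K = 3 * (3 * (p - 2) / 2) / (2 * (3 * (p - 2) / 2 - 2) * a)"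
  assume u: "\<forall>\<^sub>F c in at_right 0. u c \<in> Lambda_plus a b p c"
  show "((\<lambda>c. (grad_norm (u c))\<^sup>2) \<longlongrightarrow> 0) (at_right 0)"
  proof (rule tendsto_sandwich[where f="\<lambda>_. 0" and h="\<lambda>c. K * c\<^sup>2"])
    have "((\<lambda>c :: real. K * c\<^sup>2) \<longlongrightarrow> K * 0\<^sup>2) (at_right 0)" by (intro tendsto_intros)
    then show "((\<lambda>c. K * c\<^sup>2) \<longlongrightarrow> 0) (at_right 0)" by simp
    show "\<forall>\<^sub>F c in at_right 0. (grad_norm (u c))\<^sup>2 \<le> K * c\<^sup>2"
      using pos u unfolding K_def by eventually_elim (rule Lambda_plus_bound[OF a b p(1)])
  qed auto
qed

section \<open>The manifold \<open>\<Lambda>\<^sup>-\<close> in the range \<open>14/3 < p < 6\<close>\<close>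

text \<open>On \<open>\<Lambda>\<^sup>-\<close> one has \<open>4b A\<^sup>2 < (q\<^sup>2/p) \<parallel>u\<parallel>\<^sub>p\<^sup>p\<close>, and the right-hand side is at most a constant times
  \<open>A\<^sup>q\<^sup>/\<^sup>2 c\<^sup>(\<^sup>6\<^sup>-\<^sup>p\<^sup>)\<^sup>/\<^sup>2\<close> with \<open>q/2 > 2\<close>; hence \<open>A\<close> cannot stay bounded as \<open>c \<rightarrow> 0\<close>.\<close>

lemma supercritical_minus:
  assumes a: "a > 0" and b: "b > 0" and p: "14 / 3 < p" "p < 6"
    and u: "\<forall>\<^sub>F c in at_right 0. u c \<in> Lambda_minus a b p c"
  shows "filterlim (\<lambda>c. (grad_norm (u c))\<^sup>2) at_top (at_right 0)"
  unfolding filterlim_at_top_dense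
proof
  fix Z :: real
  define q where "q = 3 * (p - 2) / 2"
  have q: "q > 4" using p by (simp add: q_def)
  have p0: "p > 0" using p by simp
  define Y where "Y = max Z 1"
  define k where "k = q\<^sup>2 / p * 4097"
  have k: "k > 0" using q p0 by (simp add: k_def)
  have sq: "((\<lambda>c :: real. c\<^sup>2) \<longlongrightarrow> 0) (at_right 0)" by real_asymp
  have lim: "((\<lambda>c :: real. k * ((c\<^sup>2) powr ((6 - p) / 4) * Y powr (q / 2 - 2))) \<longlongrightarrow>
      k * (0 powr ((6 - p) / 4) * Y powr (q / 2 - 2))) (at_right 0)"
    using p by (intro tendsto_intros tendsto_powr' sq) auto
  have ev: "\<forall>\<^sub>F c :: real in at_right 0. k * ((c\<^sup>2) powr ((6 - p) / 4) * Y powr (q / 2 - 2)) < 4 * b"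
    by (rule order_tendstoD(2)[OF lim]) (use b in simp)
  show "\<forall>\<^sub>F c in at_right 0. Z < (grad_norm (u c))\<^sup>2"
    using eventually_at_right_less[of 0] u ev
  proof eventually_elim
    case (elim c)
    then have c: "c > 0" and uS: "u c \<in> S c" by (simp_all add: Lambda_minus_def Lambda_def)
    define A where "A = (grad_norm (u c))\<^sup>2"
    define M where "M = (c\<^sup>2) powr ((6 - p) / 4)"
    have A: "A > 0" using S_grad_norm_pos[OF c uS] by (simp add: A_def)
    have "2 * a * A + 4 * b * A\<^sup>2 - q\<^sup>2 / p * L_norm p (u c) powr p < 0"
      using elim(2) Lambda_iff(3)[OF p0 c, of "u c" a b] unfolding A_def q_def by blast
    moreover have "q\<^sup>2 / p * L_norm p (u c) powr p \<le> q\<^sup>2 / p * (4097 * (A powr (q / 2) * M))"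
    proof (rule mult_left_mono)
      have qq: "3 * (p - 2) / 4 = q / 2" by (simp add: q_def)
      show "L_norm p (u c) powr p \<le> 4097 * (A powr (q / 2) * M)"
        using gagliardo_nirenberg[OF c uS, of p] p unfolding A_def M_def qq by simp
    qed (use p0 in simp)
    moreover have "2 * a * A \<ge> 0" using a A by simp
    ultimately have "4 * b * A\<^sup>2 < q\<^sup>2 / p * (4097 * (A powr (q / 2) * M))" by linarith
    then have "4 * b * A\<^sup>2 < k * (A powr (q / 2) * M)" unfolding k_def by (simp only: mult.assoc)
    also have "A powr (q / 2) = A powr (q / 2 - 2) * A\<^sup>2"
    proof -
      have "A powr (q / 2) = A powr (q / 2 - 2) * A powr 2" unfolding powr_add[symmetric] by simp
      then show ?thesis using A by simp
    qed
    finally have "A\<^sup>2 * (4 * b) < A\<^sup>2 * (k * (M * A powr (q / 2 - 2)))" by (simp add: mult_ac)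
    then have 1: "4 * b < k * (M * A powr (q / 2 - 2))" using A by (simp only: mult_less_cancel_left_pos zero_less_power)
    show "Z < (grad_norm (u c))\<^sup>2"
    proof (rule ccontr)
      assume "\<not> Z < (grad_norm (u c))\<^sup>2"
      then have "A \<le> Y" by (simp add: A_def Y_def)
      then have "A powr (q / 2 - 2) \<le> Y powr (q / 2 - 2)" using A q by (intro powr_mono2) auto
      then have "k * (M * A powr (q / 2 - 2)) \<le> k * (M * Y powr (q / 2 - 2))"
        using k by (intro mult_left_mono) (auto simp: M_def)
      then show False using 1 elim(3) unfolding M_def by linarith
    qed
  qed
qed

section \<open>The critical exponent \<open>p = 6\<close>\<close>

text \<open>The energy on \<open>\<Lambda>\<close> for \<open>p = 6\<close> as a function of the squared gradient norm, up to terms that vanish with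
  the mass.\<close>

definition crit_level :: "real \<Rightarrow> real \<Rightarrow> real \<Rightarrow> real" where
  "crit_level a b A = a / 3 * A + b / 12 * A\<^sup>2"

text \<open>The positive root of \<open>a + b X = X\<^sup>2 / s\<^sup>3\<close>, that is, of the fibre equation for \<open>p = 6\<close> and zero mass at a
  function with Sobolev quotient \<open>s\<close>.\<close>

definition crit_root :: "real \<Rightarrow> real \<Rightarrow> real \<Rightarrow> real" where
  "crit_root a b s = s / 2 * (b * s\<^sup>2 + sqrt (b\<^sup>2 * s ^ 4 + 4 * a * s))"

lemma crit_root:
  assumes a: "a > 0" and b: "b > 0" and s: "s > 0"
  shows "crit_root a b s > 0" "a * s ^ 3 + b * s ^ 3 * crit_root a b s = (crit_root a b s)\<^sup>2"
    "crit_level a b (crit_root a b s) = C_limit a b s"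
proof -
  define D where "D = sqrt (b\<^sup>2 * s ^ 4 + 4 * a * s)"
  have pos: "b\<^sup>2 * s ^ 4 + 4 * a * s > 0" using assms by (intro add_pos_pos) auto
  then have D: "D\<^sup>2 = b\<^sup>2 * s ^ 4 + 4 * a * s" "D > 0" by (simp_all add: D_def)
  have r: "crit_root a b s = s / 2 * (b * s\<^sup>2 + D)" by (simp add: crit_root_def D_def)
  show "crit_root a b s > 0" unfolding r using assms D by (intro mult_pos_pos add_pos_pos) auto
  have "(crit_root a b s)\<^sup>2 = s\<^sup>2 / 4 * (b\<^sup>2 * s ^ 4 + 2 * b * s\<^sup>2 * D + D\<^sup>2)"
    unfolding r by (simp add: power2_eq_square power4_eq_xxxx algebra_simps)
  also have "\<dots> = a * s ^ 3 + b * s ^ 3 * crit_root a b s"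
    unfolding r D(1) by (simp add: power2_eq_square power4_eq_xxxx power3_eq_cube algebra_simps)
  finally have sq: "(crit_root a b s)\<^sup>2 = a * s ^ 3 + b * s ^ 3 * crit_root a b s" .
  then show "a * s ^ 3 + b * s ^ 3 * crit_root a b s = (crit_root a b s)\<^sup>2" ..
  have "(b\<^sup>2 * s ^ 4 + 4 * a * s) powr (3 / 2) = D ^ 3"
  proof -
    have Dp: "D = (b\<^sup>2 * s ^ 4 + 4 * a * s) powr (1 / 2)" using pos by (simp add: D_def powr_half_sqrt)
    have "D ^ 3 = D powr 3" using D(2) by simp
    also have "\<dots> = (b\<^sup>2 * s ^ 4 + 4 * a * s) powr (1 / 2 * 3)" unfolding Dp powr_powr ..
    finally show ?thesis by simp
  qed
  also have "D ^ 3 = (b\<^sup>2 * s ^ 4 + 4 * a * s) * D" using D(1) by (simp add: power3_eq_cube power2_eq_square)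
  finally have C: "C_limit a b s = a * b * s ^ 3 / 4 + b ^ 3 * s ^ 6 / 24 + (b\<^sup>2 * s ^ 4 + 4 * a * s) * D / 24"
    by (simp add: C_limit_def)
  have "crit_level a b (crit_root a b s) = a / 3 * (s / 2 * (b * s\<^sup>2 + D)) +
     b / 12 * (a * s ^ 3 + b * s ^ 3 * (s / 2 * (b * s\<^sup>2 + D)))"
    unfolding crit_level_def sq unfolding r ..
  also have "\<dots> = C_limit a b s"
    unfolding C by (simp add: field_simps power_numeral_reduce)
  finally show "crit_level a b (crit_root a b s) = C_limit a b s" .
qed

text \<open>The factorisation of the limiting fibre equation.\<close>

lemma crit_factor:
  assumes a: "a > 0" and b: "b > 0" and s: "s > 0"
  shows "a * X + b * X\<^sup>2 - X ^ 3 / s ^ 3 =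
    X * (crit_root a b s - X) * (X + a * s ^ 3 / crit_root a b s) / s ^ 3"
proof -
  define R where "R = crit_root a b s"
  have R: "R > 0" "a * s ^ 3 + b * s ^ 3 * R = R\<^sup>2" using crit_root[OF assms] by (auto simp: R_def)
  have bs: "b * s ^ 3 = R - a * s ^ 3 / R" using R by (simp add: field_simps power2_eq_square)
  have "(R - X) * (X + a * s ^ 3 / R) = X * (R - a * s ^ 3 / R) + a * s ^ 3 - X\<^sup>2"
    using R by (simp add: field_simps power2_eq_square)
  also have "\<dots> = a * s ^ 3 + b * s ^ 3 * X - X\<^sup>2" unfolding bs[symmetric] by simp
  finally have *: "X * (R - X) * (X + a * s ^ 3 / R) = X * (a * s ^ 3 + b * s ^ 3 * X - X\<^sup>2)"
    by (simp add: mult.assoc)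
  show ?thesis unfolding R_def[symmetric] * using s
    by (simp add: field_simps power2_eq_square power3_eq_cube)
qed

lemma L6_powr: "L_norm 6 u powr 6 = ((L_norm 6 u)\<^sup>2) ^ 3"
  by (simp add: L_norm_nonneg flip: power_mult)

lemma energy_Lambda_6:
  assumes c: "c > 0" and u: "u \<in> Lambda a b 6 c"
  shows "energy a b 6 c u = crit_level a b ((grad_norm u)\<^sup>2) + 3 / 4 * c\<^sup>2 - log_int u / 2"
proof -
  have "a * (grad_norm u)\<^sup>2 + b * ((grad_norm u)\<^sup>2)\<^sup>2 - L_norm 6 u powr 6 - 3 / 2 * c\<^sup>2 = 0"
    using Lambda_iff(1)[of 6 c u a b] c u by simp
  then have "L_norm 6 u powr 6 = a * (grad_norm u)\<^sup>2 + b * ((grad_norm u)\<^sup>2)\<^sup>2 - 3 / 2 * c\<^sup>2" by linarith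
  then show ?thesis unfolding energy_eq crit_level_def by (simp add: algebra_simps)
qed

text \<open>The second estimate keeps \<open>A\<close> away from \<open>0\<close>, which excludes the trivial root of the limiting equation.\<close>

lemma Lambda_minus_6:
  assumes a: "a > 0" and b: "b > 0" and c: "c > 0" and u: "u \<in> Lambda_minus a b 6 c"
  defines "A \<equiv> (grad_norm u)\<^sup>2" and "\<sigma> \<equiv> sobolev_const"
  shows "a * A + b * A\<^sup>2 - A ^ 3 / \<sigma> ^ 3 \<le> 3 / 2 * c\<^sup>2" "A\<^sup>2 > a * \<sigma> ^ 3 / 3" "A > 0"
proof -
  have uS: "u \<in> S c" using u by (simp add: Lambda_minus_def Lambda_def)
  show A: "A > 0" using S_grad_norm_pos[OF c uS] by (simp add: A_def)
  have \<sigma>: "\<sigma> > 0" using sobolev_const_ge by (simp add: \<sigma>_def)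
  define B where "B = L_norm 6 u powr 6"
  have 1: "a * A + b * A\<^sup>2 - B - 3 / 2 * c\<^sup>2 = 0" and 2: "2 * a * A + 4 * b * A\<^sup>2 - 6 * B < 0"
    using Lambda_iff[of 6 c u a b] c u unfolding A_def B_def by simp_all
  have "(L_norm 6 u)\<^sup>2 \<le> A / \<sigma>"
    using sobolev_const_le[OF S_grad_norm_pos(1)[OF c uS]] \<sigma> unfolding A_def \<sigma>_def
    by (simp add: pos_le_divide_eq mult.commute)
  then have "((L_norm 6 u)\<^sup>2) ^ 3 \<le> (A / \<sigma>) ^ 3" by (intro power_mono) auto
  then have B: "B \<le> A ^ 3 / \<sigma> ^ 3" unfolding B_def L6_powr by (simp add: power_divide)
  then show "a * A + b * A\<^sup>2 - A ^ 3 / \<sigma> ^ 3 \<le> 3 / 2 * c\<^sup>2" using 1 by linarith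
  have "b * A\<^sup>2 \<ge> 0" using b by simp
  then have "a / 3 * A < A ^ 3 / \<sigma> ^ 3" using 2 B by linarith
  then have "A * (a / 3) < A * (A\<^sup>2 / \<sigma> ^ 3)" by (simp add: power2_eq_square power3_eq_cube mult.commute)
  then have "a / 3 < A\<^sup>2 / \<sigma> ^ 3" using A by (simp only: mult_less_cancel_left_pos)
  then show "A\<^sup>2 > a * \<sigma> ^ 3 / 3" using \<sigma> by (simp add: field_simps)
qed

text \<open>The competitor is \<open>k v(r x)\<close> with \<open>k\<^sup>2 = r = \<mu>/c\<close> for an almost optimal \<open>v\<close>: this scaling keeps the gradient
  norm and the \<open>L\<^sup>6\<close> norm and shrinks the mass to \<open>c\<close>. A dilation then moves it onto \<open>\<Lambda>\<^sup>-\<close>; as the limiting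
  fibre function \<open>f\<close> is positive at \<open>X\<^sub>0\<close> and vanishes at \<open>R\<close>, the squared gradient norm ends up
  between these values.\<close>

lemma m_minus_upper_6:
  assumes a: "a > 0" and b: "b > 0" and \<epsilon>: "\<epsilon> > 0"
  shows "\<forall>\<^sub>F c in at_right 0. m_minus a b 6 c \<le> ereal (C_limit a b sobolev_const + \<epsilon>)"
proof -
  define \<sigma> where "\<sigma> = sobolev_const"
  have \<sigma>: "\<sigma> > 0" using sobolev_const_ge by (simp add: \<sigma>_def)
  have "isCont (\<lambda>s. crit_level a b (crit_root a b s)) \<sigma>"
    unfolding crit_level_def crit_root_def isCont_def by (intro tendsto_intros) auto
  then obtain \<delta> where \<delta>: "\<delta> > 0" "\<And>s. \<bar>s - \<sigma>\<bar> < \<delta> \<Longrightarrow>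
      \<bar>crit_level a b (crit_root a b s) - crit_level a b (crit_root a b \<sigma>)\<bar> < \<epsilon> / 2"
    using \<epsilon> unfolding continuous_at_eps_delta dist_real_def by (meson half_gt_zero)
  obtain v where v: "v \<in> W" "L_norm 2 v > 0" "L_norm 6 v > 0"
    "(grad_norm v)\<^sup>2 < (\<sigma> + \<delta>) * (L_norm 6 v)\<^sup>2"
    using sobolev_const_optimal[OF \<delta>(1)] unfolding \<sigma>_def by blast
  have vH: "v \<in> H1" using v(1) by (simp add: W_def)
  define \<mu> where "\<mu> = L_norm 2 v"
  have mu: "\<mu> > 0" using v by (simp add: \<mu>_def)
  define A where "A = (grad_norm v)\<^sup>2"
  define l where "l = log_int v"
  define t where "t = A / (L_norm 6 v)\<^sup>2"
  have ts: "\<sigma> \<le> t" "t < \<sigma> + \<delta>"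
    using v sobolev_const_le[OF vH] by (auto simp: t_def A_def \<sigma>_def pos_le_divide_eq pos_divide_less_eq)
  then have t: "t > 0" using \<sigma> by simp
  have Apos: "A > 0" using t v(3) unfolding t_def by (simp add: zero_less_divide_iff A_def)
  have B: "L_norm 6 v powr 6 = A ^ 3 / t ^ 3"
  proof -
    have "(L_norm 6 v)\<^sup>2 = A / t" using t v(3) Apos by (simp add: t_def)
    then show ?thesis unfolding L6_powr by (simp add: power_divide)
  qed
  define R where "R = crit_root a b t"
  have R: "R > 0" unfolding R_def by (rule crit_root(1)[OF a b t])
  have ER: "crit_level a b R < C_limit a b \<sigma> + \<epsilon> / 2"
  proof -
    have "\<bar>crit_level a b (crit_root a b t) - crit_level a b (crit_root a b \<sigma>)\<bar> < \<epsilon> / 2"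
      using ts by (intro \<delta>(2)) simp
    then show ?thesis unfolding crit_root(3)[OF a b \<sigma>] R_def by linarith
  qed
  \<comment> \<open>The dilation with parameter \<open>s1\<close> has squared gradient norm exactly \<open>R\<close>.\<close>
  define s1 where "s1 = ln (R / A) / 2"
  define s0 where "s0 = s1 - 1"
  have es1: "exp (2 * s1) * A = R" using R Apos by (simp add: s1_def)
  define X0 where "X0 = exp (2 * s0) * A"
  have X0: "X0 > 0" "X0 < R"
  proof -
    show "X0 > 0" using Apos by (simp add: X0_def)
    have "exp (2 * s0) < exp (2 * s1)" by (simp add: s0_def)
    then show "X0 < R" unfolding X0_def es1[symmetric] using Apos by (rule mult_strict_right_mono)
  qed
  define f where "f X = a * X + b * X\<^sup>2 - X ^ 3 / t ^ 3" for X
  have fR: "f R = 0" unfolding f_def crit_factor[OF a b t] R_def[symmetric] by simp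
  have f0: "f X0 > 0"
    unfolding f_def crit_factor[OF a b t] R_def[symmetric] using X0 R a t
    by (intro divide_pos_pos mult_pos_pos add_pos_pos) auto
  define U where "U c = crit_level a b R + 3 / 4 * c\<^sup>2 - (3 * s0 * c\<^sup>2 + ((c / \<mu>)\<^sup>2 * l - (c / \<mu>)\<^sup>2 * ln ((c / \<mu>)\<^sup>2) * \<mu>\<^sup>2 / 2)) / 2" for c
  have "(U \<longlongrightarrow> crit_level a b R + 3 / 4 * 0\<^sup>2 - (3 * s0 * 0\<^sup>2 + (0 * l - 0 * \<mu>\<^sup>2 / 2)) / 2) (at_right 0)"
    unfolding U_def[abs_def] by (intro tendsto_intros scaled_square_tendsto mu) auto
  then have U: "(U \<longlongrightarrow> crit_level a b R) (at_right 0)" by simp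
  have ev1: "\<forall>\<^sub>F c in at_right 0. U c < C_limit a b \<sigma> + \<epsilon>"
    by (rule order_tendstoD(2)[OF U]) (use ER \<epsilon> in linarith)
  have sq: "((\<lambda>c :: real. 9 * c\<^sup>2) \<longlongrightarrow> 0) (at_right 0)" by real_asymp
  have ev2: "\<forall>\<^sub>F c :: real in at_right 0. 9 * c\<^sup>2 < min (4 * a * X0) (6 * f X0)"
    by (rule order_tendstoD(2)[OF sq]) (use X0 a f0 in auto)
  show ?thesis
    using eventually_at_right_less[of 0] ev1 ev2
  proof eventually_elim
    case (elim c)
    then have c: "c > 0" by simp
    define r where "r = \<mu> / c"
    have r: "r > 0" using mu c by (simp add: r_def)
    define k where "k = sqrt r"
    have k: "k > 0" "k\<^sup>2 = r" using r by (auto simp: k_def)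
    define w where "w = (\<lambda>x. k * v (r *\<^sub>R x))"
    note h = H1_scale[OF vH r, of k, folded w_def]
    have kr: "k\<^sup>2 / r ^ 3 = (c / \<mu>)\<^sup>2"
      unfolding k(2) using mu c by (simp add: r_def power2_eq_square power3_eq_cube field_simps)
    have wA: "(grad_norm w)\<^sup>2 = A" using h(2) k r by (simp add: A_def)
    have "(L_norm 2 w)\<^sup>2 = c\<^sup>2"
      unfolding h(3) kr using mu by (simp add: \<mu>_def power_divide)
    then have wS: "w \<in> S c" using W_scale(1)[OF v(1) r k(1)] c by (simp add: S_iff w_def)
    have wB: "L_norm 6 w powr 6 = A ^ 3 / t ^ 3"
    proof -
      have "\<bar>k\<bar> powr 6 = (k\<^sup>2) ^ 3" using k(1) by (simp flip: power_mult)
      then have "\<bar>k\<bar> powr 6 / r ^ 3 = 1" using k r by simp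
      then show ?thesis using H1_scale(4)[OF vH r, where k=k and q=6, folded w_def] B k(1) by simp
    qed
    have wl: "log_int w = (c / \<mu>)\<^sup>2 * l - (c / \<mu>)\<^sup>2 * ln ((c / \<mu>)\<^sup>2) * \<mu>\<^sup>2 / 2"
    proof -
      have "ln (k\<^sup>2) = - ln ((c / \<mu>)\<^sup>2) / 2"
        unfolding k(2) r_def using mu c by (simp add: ln_div ln_realpow)
      then show ?thesis
        unfolding w_def W_scale(2)[OF v(1) r k(1)] kr by (simp add: \<mu>_def l_def algebra_simps)
    qed
    define F where "F s = f (exp (2 * s) * A) - 3 / 2 * c\<^sup>2" for s
    have "F s0 \<ge> 0" using elim(3) by (simp add: F_def flip: X0_def)
    moreover have "F s1 \<le> 0" by (simp add: F_def es1 fR)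
    moreover have "\<forall>s. s0 \<le> s \<and> s \<le> s1 \<longrightarrow> isCont F s"
      unfolding F_def f_def using t by (intro allI impI continuous_intros) auto
    ultimately obtain s where s: "s0 \<le> s" "s \<le> s1" "F s = 0"
      using IVT2[of F s1 0 s0] by (auto simp: s0_def)
    define X where "X = exp (2 * s) * A"
    have X: "X0 \<le> X" "X \<le> R"
      unfolding X_def X0_def es1[symmetric] using s Apos by (auto intro!: mult_right_mono)
    have fX: "a * X + b * X\<^sup>2 - X ^ 3 / t ^ 3 - 3 / 2 * c\<^sup>2 = 0"
      using s(3) unfolding F_def f_def X_def .
    have L: "dilate s w \<in> Lambda a b 6 c"
      unfolding dilate_Lambda(1)[OF wS _ c, of 6, simplified] wA wB using fX[unfolded X_def]
      by (simp add: power_mult_distrib flip: exp_of_nat_mult)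
    have "4 * a * X0 \<le> 4 * a * X" using X a by simp
    then have "9 * c\<^sup>2 < 4 * a * X" using elim(3) by simp
    moreover have "b * X\<^sup>2 \<ge> 0" using b by simp
    ultimately have "2 * a * X + 4 * b * X\<^sup>2 - 6 * (X ^ 3 / t ^ 3) < 0" using fX by linarith
    then have "dilate s w \<in> Lambda_minus a b 6 c"
      using L unfolding dilate_Lambda(3)[OF wS _ c, of 6, simplified] wA wB X_def
      by (simp add: power_mult_distrib flip: exp_of_nat_mult)
    then have "m_minus a b 6 c \<le> ereal (energy a b 6 c (dilate s w))"
      unfolding m_minus_def by (rule INF_lower)
    also have "energy a b 6 c (dilate s w) = crit_level a b X + 3 / 4 * c\<^sup>2 - (3 * s * c\<^sup>2 + log_int w) / 2"
      unfolding energy_Lambda_6[OF c L] fiber_eq(3,5)[OF wS zero_less_numeral c] wA X_def ..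
    also have "\<dots> \<le> U c"
    proof -
      have "crit_level a b X \<le> crit_level a b R"
        unfolding crit_level_def using X X0 a b by (intro add_mono mult_left_mono power_mono) auto
      moreover have "3 * s * c\<^sup>2 \<ge> 3 * s0 * c\<^sup>2" using s by (intro mult_right_mono) auto
      ultimately show ?thesis
        unfolding U_def wl[symmetric] by (intro diff_mono add_mono divide_right_mono) auto
    qed
    also have "U c \<le> C_limit a b sobolev_const + \<epsilon>" using elim(2) by (simp add: \<sigma>_def)
    finally show ?case by simp
  qed
qed

text \<open>The Sobolev inequality forces \<open>liminf A \<ge> R\<close>, and the energy bound \<open>I \<le> crit_level R + o(1)\<close> forces
  \<open>limsup A \<le> R\<close>, because the energy is \<open>crit_level A\<close> up to an error that is controlled once \<open>A\<close> is
  bounded.\<close>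

lemma critical_minus:
  assumes a: "a > 0" and b: "b > 0"
    and u: "\<forall>\<^sub>F c in at_right 0. u c \<in> Lambda_minus a b 6 c \<and> ereal (energy a b 6 c (u c)) = m_minus a b 6 c"
  shows "((\<lambda>c. (grad_norm (u c))\<^sup>2) \<longlongrightarrow> crit_root a b sobolev_const) (at_right 0)"
    and "((\<lambda>c. energy a b 6 c (u c)) \<longlongrightarrow> C_limit a b sobolev_const) (at_right 0)"
proof -
  define \<sigma> where "\<sigma> = sobolev_const"
  have \<sigma>: "\<sigma> > 0" using sobolev_const_ge by (simp add: \<sigma>_def)
  define R where "R = crit_root a b \<sigma>"
  have R: "R > 0" unfolding R_def by (rule crit_root(1)[OF a b \<sigma>])
  have ER: "crit_level a b R = C_limit a b \<sigma>" unfolding R_def by (rule crit_root(3)[OF a b \<sigma>])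
  define E where "E = crit_level a b"
  define A where "A c = (grad_norm (u c))\<^sup>2" for c
  define \<omega> where "\<omega> c = 4097 * (c\<^sup>2) powr (3 / 4)" for c :: real
  have pos: "\<forall>\<^sub>F c :: real in at_right 0. c > 0" by (rule eventually_at_right_less)
  have \<omega>0: "(\<omega> \<longlongrightarrow> 0) (at_right 0)"
  proof -
    have sq: "((\<lambda>c :: real. c\<^sup>2) \<longlongrightarrow> 0) (at_right 0)" by real_asymp
    have "(\<omega> \<longlongrightarrow> 4097 * 0 powr (3 / 4)) (at_right 0)"
      unfolding \<omega>_def[abs_def] by (intro tendsto_intros tendsto_powr' sq) auto
    then show ?thesis by simp
  qed
  have low: "\<forall>\<^sub>F c in at_right 0. E (A c) - \<omega> c * (1 + (A c)\<^sup>2) \<le> energy a b 6 c (u c)"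
    using pos u
  proof eventually_elim
    case (elim c)
    then have L: "u c \<in> Lambda a b 6 c" and uS: "u c \<in> S c" by (auto simp: Lambda_minus_def Lambda_def)
    have A: "A c > 0" using S_grad_norm_pos[OF elim(1) uS] by (simp add: A_def)
    have "(A c) powr (3 / 4) * (c\<^sup>2) powr (3 / 4) \<le> (1 + (A c)\<^sup>2) * (c\<^sup>2) powr (3 / 4)"
      by (intro mult_right_mono powr_le_1_plus_square A) auto
    then have "log_int (u c) / 2 \<le> \<omega> c * (1 + (A c)\<^sup>2)"
      using log_int_upper[OF elim(1) uS] unfolding \<omega>_def A_def by (simp add: mult_ac)
    moreover have "c\<^sup>2 \<ge> 0" by simp
    ultimately show ?case unfolding energy_Lambda_6[OF elim(1) L] E_def A_def by linarith
  qed
  have up: "\<forall>\<^sub>F c in at_right 0. energy a b 6 c (u c) \<le> E R + \<epsilon>" if "\<epsilon> > 0" for \<epsilon>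
    using u m_minus_upper_6[OF a b that]
  proof eventually_elim
    case (elim c)
    then have "ereal (energy a b 6 c (u c)) \<le> ereal (C_limit a b sobolev_const + \<epsilon>)" by simp
    then show ?case by (simp add: ER E_def \<sigma>_def)
  qed
  define Z where "Z = 3 / a * (E R + 1 + b / 12)"
  have bounded: "\<forall>\<^sub>F c in at_right 0. 0 < A c \<and> A c \<le> Z"
  proof -
    have "\<forall>\<^sub>F c in at_right 0. \<omega> c < b / 12" using b by (intro order_tendstoD(2)[OF \<omega>0]) simp
    from pos u low up[OF zero_less_one] this show ?thesis
    proof eventually_elim
      case (elim c)
      have "u c \<in> S c" using elim(2) by (simp add: Lambda_minus_def Lambda_def)
      then have A: "A c > 0" using S_grad_norm_pos[OF elim(1)] by (simp add: A_def)
      have "\<omega> c * (1 + (A c)\<^sup>2) \<le> b / 12 * (1 + (A c)\<^sup>2)"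
        using elim(5) by (intro mult_right_mono) auto
      then have "a / 3 * A c \<le> E R + 1 + b / 12"
        using elim(3,4) unfolding E_def crit_level_def[of a b "A c"] by (simp add: algebra_simps)
      then have "A c \<le> Z" unfolding Z_def using a by (simp add: field_simps)
      then show ?case using A by simp
    qed
  qed
  define \<rho> where "\<rho> c = \<omega> c * (1 + Z\<^sup>2)" for c
  have "(\<rho> \<longlongrightarrow> 0 * (1 + Z\<^sup>2)) (at_right 0)" unfolding \<rho>_def[abs_def] by (intro tendsto_intros \<omega>0)
  then have \<rho>0: "(\<rho> \<longlongrightarrow> 0) (at_right 0)" by simp
  have low2: "\<forall>\<^sub>F c in at_right 0. E (A c) - \<rho> c \<le> energy a b 6 c (u c)"
    using low bounded
  proof eventually_elim
    case (elim c)
    have "(A c)\<^sup>2 \<le> Z\<^sup>2" using elim(2) by (intro power_mono) auto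
    then have "\<omega> c * (1 + (A c)\<^sup>2) \<le> \<rho> c" unfolding \<rho>_def by (intro mult_left_mono) (auto simp: \<omega>_def)
    then show ?case using elim(1) by linarith
  qed
  have Alim: "(A \<longlongrightarrow> R) (at_right 0)"
  proof (rule order_tendstoI)
    fix y assume y: "R < y"
    define \<epsilon> where "\<epsilon> = a / 9 * (y - R)"
    have \<epsilon>: "\<epsilon> > 0" using y a by (simp add: \<epsilon>_def)
    have "\<forall>\<^sub>F c in at_right 0. \<rho> c < \<epsilon>" by (rule order_tendstoD(2)[OF \<rho>0 \<epsilon>])
    from low2 up[OF \<epsilon>] this show "\<forall>\<^sub>F c in at_right 0. A c < y"
    proof eventually_elim
      case (elim c)
      show ?case
      proof (rule ccontr)
        assume "\<not> A c < y"
        then have Ay: "A c \<ge> y" by simp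
        have "(A c)\<^sup>2 \<ge> R\<^sup>2" using Ay y R by (intro power_mono) auto
        then have "b / 12 * (A c)\<^sup>2 \<ge> b / 12 * R\<^sup>2" using b by (intro mult_left_mono) auto
        moreover have "a / 3 * A c \<ge> a / 3 * y" using Ay a by (intro mult_left_mono) auto
        moreover have "a / 3 * y = a / 3 * R + 3 * \<epsilon>" by (simp add: \<epsilon>_def field_simps)
        ultimately have "E (A c) \<ge> E R + 3 * \<epsilon>" unfolding E_def crit_level_def by linarith
        then show False using elim \<epsilon> by linarith
      qed
    qed
  next
    fix y assume y: "y < R"
    define r0 where "r0 = sqrt (a * \<sigma> ^ 3 / 3)"
    have r0: "r0 > 0" using a \<sigma> by (simp add: r0_def)
    define \<kappa> where "\<kappa> = r0 * (R - y) * r0 / \<sigma> ^ 3"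
    have \<kappa>: "\<kappa> > 0" using r0 y \<sigma> by (simp add: \<kappa>_def)
    have sq: "((\<lambda>c :: real. 3 / 2 * c\<^sup>2) \<longlongrightarrow> 0) (at_right 0)" by real_asymp
    have "\<forall>\<^sub>F c :: real in at_right 0. 3 / 2 * c\<^sup>2 < \<kappa>" by (rule order_tendstoD(2)[OF sq \<kappa>])
    from pos u this show "\<forall>\<^sub>F c in at_right 0. y < A c"
    proof eventually_elim
      case (elim c)
      note L = Lambda_minus_6[OF a b elim(1), of "u c", folded A_def \<sigma>_def]
      have L1: "a * A c + b * (A c)\<^sup>2 - A c ^ 3 / \<sigma> ^ 3 \<le> 3 / 2 * c\<^sup>2" and L2: "(A c)\<^sup>2 > a * \<sigma> ^ 3 / 3" and L3: "A c > 0"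
        using L elim(2) by blast+
      have Ar: "A c > r0" unfolding r0_def using L2 L3 by (intro real_less_lsqrt) auto
      show ?case
      proof (rule ccontr)
        assume "\<not> y < A c"
        then have Ay: "A c \<le> y" by simp
        have h: "a * \<sigma> ^ 3 / R > 0" using a \<sigma> R by simp
        have "\<kappa> \<le> A c * (R - A c) * (A c + a * \<sigma> ^ 3 / R) / \<sigma> ^ 3"
          unfolding \<kappa>_def using Ay Ar r0 y \<sigma> h by (intro divide_right_mono mult_mono) auto
        also have "\<dots> = a * A c + b * (A c)\<^sup>2 - A c ^ 3 / \<sigma> ^ 3"
          unfolding crit_factor[OF a b \<sigma>] R_def ..
        finally show False using L1 elim(3) by linarith
      qed
    qed
  qed
  then show "((\<lambda>c. (grad_norm (u c))\<^sup>2) \<longlongrightarrow> crit_root a b sobolev_const) (at_right 0)"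
    by (simp add: A_def[abs_def] R_def \<sigma>_def)
  have El: "((\<lambda>c. E (A c) - \<rho> c) \<longlongrightarrow> E R - 0) (at_right 0)"
    unfolding E_def crit_level_def by (intro tendsto_intros Alim \<rho>0)
  have "((\<lambda>c. energy a b 6 c (u c)) \<longlongrightarrow> E R) (at_right 0)"
  proof (rule order_tendstoI)
    fix y assume "y < E R"
    then have "\<forall>\<^sub>F c in at_right 0. y < E (A c) - \<rho> c" using El by (intro order_tendstoD) auto
    with low2 show "\<forall>\<^sub>F c in at_right 0. y < energy a b 6 c (u c)" by eventually_elim linarith
  next
    fix y assume "E R < y"
    then have "(y - E R) / 2 > 0" by simp
    from up[OF this] show "\<forall>\<^sub>F c in at_right 0. energy a b 6 c (u c) < y"
      by eventually_elim (use \<open>E R < y\<close> in \<open>simp add: field_simps\<close>)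
  qed
  then show "((\<lambda>c. energy a b 6 c (u c)) \<longlongrightarrow> C_limit a b sobolev_const) (at_right 0)"
    by (simp add: E_def ER \<sigma>_def)
qed

section \<open>The asymptotic behaviour\<close>

theorem theorem2p5:
  fixes a b p :: real
  assumes "a > 0" and "b > 0" and "2 < p" and "p \<le> 6"
  shows
    "(\<forall>u :: real \<Rightarrow> real^3 \<Rightarrow> real.
        (\<forall>\<^sub>F c in at_right 0. is_u_plus a b p c (u c)) \<longrightarrow>
        ((\<lambda>c. (grad_norm (u c))\<^sup>2) \<longlongrightarrow> 0) (at_right 0)) \<and>
     (p \<le> 14 / 3 \<longrightarrow> ((\<lambda>c. m a b p c) \<longlongrightarrow> 0) (at_right 0)) \<and>
     (14 / 3 < p \<longrightarrow> ((\<lambda>c. m_plus a b p c) \<longlongrightarrow> 0) (at_right 0)) \<and>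
     (14 / 3 < p \<and> p < 6 \<longrightarrow>
       (\<forall>u :: real \<Rightarrow> real^3 \<Rightarrow> real.
          (\<forall>\<^sub>F c in at_right 0. is_u_minus a b p c (u c)) \<longrightarrow>
          filterlim (\<lambda>c. (grad_norm (u c))\<^sup>2) at_top (at_right 0))) \<and>
     (p = 6 \<and> critical_condition a b sobolev_const \<longrightarrow>
       (\<forall>u :: real \<Rightarrow> real^3 \<Rightarrow> real.
          (\<forall>\<^sub>F c in at_right 0. is_u_minus a b p c (u c)) \<longrightarrow>
          ((\<lambda>c. (grad_norm (u c))\<^sup>2) \<longlongrightarrow>
             sobolev_const / 2 * (b * sobolev_const\<^sup>2
               + sqrt (b\<^sup>2 * sobolev_const ^ 4 + 4 * a * sobolev_const))) (at_right 0) \<and>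
          ((\<lambda>c. energy a b p c (u c)) \<longlongrightarrow> C_limit a b sobolev_const) (at_right 0)))"
proof (intro conjI allI impI)
  fix u assume u: "\<forall>\<^sub>F c in at_right 0. is_u_plus a b p c (u c)"
  show "((\<lambda>c. (grad_norm (u c))\<^sup>2) \<longlongrightarrow> 0) (at_right 0)"
  proof (cases "p \<le> 14 / 3")
    case True
    have "\<forall>\<^sub>F c in at_right 0. u c \<in> S c \<and> ereal (energy a b p c (u c)) = m a b p c"
      using u by eventually_elim (use True in \<open>simp add: is_u_plus_def solution_def\<close>)
    then show ?thesis by (rule subcritical(2)[OF assms(1-3) True])
  next
    case False
    have "\<forall>\<^sub>F c in at_right 0. u c \<in> Lambda_plus a b p c"
      using u by eventually_elim (use False in \<open>simp add: is_u_plus_def\<close>)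
    then show ?thesis using False assms by (intro supercritical_plus(2)[of a b p]) auto
  qed
next
  assume "p \<le> 14 / 3"
  then show "((\<lambda>c. m a b p c) \<longlongrightarrow> 0) (at_right 0)"
    using subcritical(1)[OF assms(1-3)] by simp
next
  assume "14 / 3 < p"
  then show "((\<lambda>c. m_plus a b p c) \<longlongrightarrow> 0) (at_right 0)"
    using supercritical_plus(1)[OF assms(1,2) _ assms(4)] by simp
next
  fix u assume p: "14 / 3 < p \<and> p < 6" and u: "\<forall>\<^sub>F c in at_right 0. is_u_minus a b p c (u c)"
  have "\<forall>\<^sub>F c in at_right 0. u c \<in> Lambda_minus a b p c"
    using u by eventually_elim (simp add: is_u_minus_def)
  then show "filterlim (\<lambda>c. (grad_norm (u c))\<^sup>2) at_top (at_right 0)"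
    using p assms by (intro supercritical_minus[of a b p]) auto
next
  fix u assume p: "p = 6 \<and> critical_condition a b sobolev_const"
    and u: "\<forall>\<^sub>F c in at_right 0. is_u_minus a b p c (u c)"
  have "\<forall>\<^sub>F c in at_right 0. u c \<in> Lambda_minus a b 6 c \<and> ereal (energy a b 6 c (u c)) = m_minus a b 6 c"
    using u by eventually_elim (use p in \<open>simp add: is_u_minus_def\<close>)
  note lim = critical_minus[OF assms(1,2) this]
  show "((\<lambda>c. (grad_norm (u c))\<^sup>2) \<longlongrightarrow>
     sobolev_const / 2 * (b * sobolev_const\<^sup>2
       + sqrt (b\<^sup>2 * sobolev_const ^ 4 + 4 * a * sobolev_const))) (at_right 0)"
    using lim(1) by (simp add: crit_root_def)
  show "((\<lambda>c. energy a b p c (u c)) \<longlongrightarrow> C_limit a b sobolev_const) (at_right 0)"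
    using lim(2) p by simp
qed

end
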